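(* Let $\ell \in \mathbb{N}$ be fixed, and let $A$ be an arbitrary positive number. Then for all sufficiently large $T$, \[ \max_{t \in [\sqrt{T},T]} \operatorname{Re} \zeta^{(\ell)}\left(\frac{1}{2} + \frac{A}{\log\log T} +\mathrm{i}t\right) \ge \exp\left( \left( \lambda(A)+o(1)\right)\sqrt{\frac{\log T\, \log\log\log T}{\log\log T}} \right), \] where \[ \lambda(A) = \frac{1}{\mathrm{e}^A \sqrt{\mathrm{e}-1}}, \] and $o(1)$ denotes a quantity tending to $0$ as $T\to\infty$ (with $\ell$ and $A$ fixed).
   Context: $\zeta(s)$ denotes the Riemann zeta function (with its meromorphic continuation to $\mathbb{C}$), $\zeta^{(\ell)}$ denotes its $\ell$-th derivative with respect to the complex variable $s$, with $\zeta^{(0)}=\zeta$; $\mathbb{N}$ denotes the non-negative integers (so $\ell=0$ is allowed); $\operatorname{Re}$ denotes the real part, $\log$ is the natural logarithm, and $\mathrm{e}$ is its base. *)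

theory Defs
  imports "HOL-Complex_Analysis.Complex_Analysis"
begin

(* The meromorphic continuation to the whole plane of the Dirichlet series.  The requirement
   nicely_meromorphic_on UNIV leaves no removable singularities and fixes the value 0 at poles,
   so by the identity theorem at most one function qualifies (with value 0 at s = 1). *)
definition zeta :: "complex \<Rightarrow> complex" where
  "zeta = (THE f. f nicely_meromorphic_on UNIV \<and>
             (\<forall>s. Re s > 1 \<longrightarrow> (\<lambda>n. 1 / of_nat (Suc n) powr s) sums f s))"

end

theory Submission
  imports Defs "HOL-Probability.Probability" "HOL-Real_Asymp.Real_Asymp"
begin

text \<open>The proof is the resonance method, on the line \<open>Re s = \<sigma>\<close> with \<open>\<sigma> = 1/2 + A / log log T\<close>. If
\<open>Re \<zeta>^(l)(\<sigma> + i t) \<le> S\<close> for \<open>t\<close> in \<open>[\<surd>T, T]\<close>, then every average of this function of \<open>t\<close> against a nonnegative weight living there is at most \<open>S\<close>, so it suffices to find a weight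
for which the average is large.

Two averages are taken. The first one is local. In the region of absolute convergence
\<open>\<zeta>^(l)(s) = (-1)^l \<Sum> (log n)^l n^(-s)\<close>, and the convolution of \<open>\<zeta>^(l)\<close> in the imaginary direction with
\<open>exp (- u\<^sup>2 / 2) (1 + (-1)^l cos (\<omega> u))\<close> is, up to a bounded error, a Dirichlet polynomial with
nonnegative coefficients concentrated on \<open>log n \<approx> \<omega>\<close> (\<open>smoothing\<close>). The kernel is nonnegative, the
cosine undoes the sign \<open>(-1)^l\<close>, and the unmodulated Gaussian only sees bounded \<open>n\<close>, so odd and even
derivatives behave alike. Moreover the polynomial is at most a small power of \<open>T\<close> as long as \<open>\<omega>\<close> is
a small multiple of \<open>log T\<close>.

The second average is against \<open>|R(t)|\<^sup>2 exp (- t\<^sup>2 / (2 \<tau>\<^sup>2))\<close> with \<open>\<tau> = T / log T\<close> and a resonator \<open>R\<close>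
built from a finite set \<open>M\<close> of positive rational numbers \<open>m\<close> with weights \<open>F(m)\<close>. The numbers in \<open>M\<close>
are far larger than \<open>T\<close> and their logarithms may be extremely close together; the members whose
logarithms lie in a common cell of length \<open>1 / \<tau>\<close> are therefore merged into one frequency with
coefficient the square root of the sum of the \<open>F(m)\<^sup>2\<close>. The Gaussian has a positive Fourier
transform and all coefficients are nonnegative, so every term of the average is nonnegative, and the
average dominates the correlations \<open>F(m) F(m n)\<close> over all pairs \<open>m, m n\<close> in \<open>M\<close> (\<open>resonator\<close>). The range
\<open>|t| \<le> 2 \<surd>T\<close>, on which nothing is assumed, is harmless because \<open>|R|\<^sup>2\<close> exceeds its mean by at most the
factor \<open>|M|\<close>, and \<open>|M| \<le> T^(9/20)\<close> (\<open>resonance_bound\<close>).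

It remains to make the correlations large. The set \<open>M\<close> consists of quotients of squarefree numbers:
vectors of exponents in \<open>{-1, 0, 1}\<close> on a set of primes \<open>P\<close>, with \<open>F\<close> multiplicative and \<open>f(p)\<close> the weight
of a nonzero exponent. Without a restriction on the size of \<open>M\<close> the correlation sum and the sum of
the \<open>F(m)\<^sup>2\<close> factor over the primes, and their quotient is about \<open>exp (\<Sum> 2 f(p) p^(-\<sigma>))\<close>, because each prime
can be gained in two ways, from \<open>-1\<close> to \<open>0\<close> and from \<open>0\<close> to \<open>1\<close>. Compared with squarefree integers this
gains a factor \<open>\<surd>2\<close> in the exponent. The size of \<open>M\<close> is controlled by one linear constraint
\<open>\<Sum> c(p) |e(p)| \<le> Z\<close>, and Markov's inequality shows that the constraint costs only a bounded factor as soon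
as \<open>Z\<close> exceeds the mean cost (\<open>shift_correlation_ge\<close>). With \<open>L = log T\<close>, \<open>u(p) = log (p / L)\<close>,
\<open>c(p) = u(p)\<close>, \<open>f(p) = c \<surd>(L / p) / u(p)\<close> and \<open>H = \<Sum> 1 / (p u(p))\<close> the mean cost is \<open>2 c\<^sup>2 L H\<close> and the exponent
is about \<open>2 c e^(-A) \<surd>L H\<close>. Mertens' theorem gives \<open>H \<ge> 0.85 log log log T / log log T\<close>, which
is the source of the triple logarithm (\<open>resonator_parameters\<close>). Eliminating \<open>c\<close> yields at least the exponent
\<open>4/5 e^(-A) \<surd>(log T log log log T / log log T)\<close>. As \<open>4/5 > 1 / \<surd>(e - 1)\<close>, the theorem holds with the error
function \<open>\<epsilon> = 0\<close>.\<close>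

section \<open>Continuation of the zeta function\<close>

lemma series_holomorphic:
  fixes f :: "nat \<Rightarrow> complex \<Rightarrow> complex"
  assumes "open S" and hol: "\<And>n. f n holomorphic_on S"
    and maj: "\<And>x. x \<in> S \<Longrightarrow> \<exists>d h. 0 < d \<and> cball x d \<subseteq> S \<and> summable h \<and>
               (\<forall>n. \<forall>y\<in>cball x d. norm (f n y) \<le> h n)"
  shows "(\<lambda>x. \<Sum>n. f n x) holomorphic_on S"
proof (rule holomorphic_uniform_sequence[where f = "\<lambda>n x. \<Sum>i<n. f i x"])
  show "open S" by fact
  show "(\<lambda>x. \<Sum>i<n. f i x) holomorphic_on S" for n
    by (intro holomorphic_intros hol)
  fix x assume "x \<in> S"
  from maj[OF this] obtain d h
    where d: "0 < d" "cball x d \<subseteq> S" "summable h" "\<forall>n. \<forall>y\<in>cball x d. norm (f n y) \<le> h n"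
    by (elim exE conjE)
  have "uniform_limit (cball x d) (\<lambda>n x. \<Sum>i<n. f i x) (\<lambda>x. \<Sum>n. f n x) sequentially"
    by (intro Weierstrass_m_test[OF _ d(3)]) (use d(4) in auto)
  thus "\<exists>d. 0 < d \<and> cball x d \<subseteq> S \<and>
          uniform_limit (cball x d) (\<lambda>n x. \<Sum>i<n. f i x) (\<lambda>x. \<Sum>n. f n x) sequentially"
    using d by blast
qed

lemma summable_Suc_powr:
  fixes a :: real
  assumes "a < -1"
  shows "summable (\<lambda>n. real (Suc n) powr a)"
  using assms summable_real_powr_iff[of a] summable_Suc_iff[of "\<lambda>n. real n powr a"] by simp

lemma norm_of_nat_powr:
  "norm (of_nat (Suc n) powr s :: complex) = real (Suc n) powr Re s"
  using norm_powr_real_powr[of "of_nat (Suc n)" s] by (metis Re_complex_of_real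
    of_nat_0_le_iff of_real_of_nat_eq Reals_of_nat)

text \<open>The Taylor remainder of order \<open>m\<close>, at distance \<open>1\<close> from \<open>n + 1\<close>, of the function \<open>x \<mapsto> x^(-w)\<close>.
Summed over \<open>n\<close> it converges in a half-plane that grows with \<open>m\<close>.\<close>

definition step_remainder :: "nat \<Rightarrow> nat \<Rightarrow> complex \<Rightarrow> complex" where
  "step_remainder m n w = of_nat (Suc (Suc n)) powr (-w) -
     (\<Sum>j\<le>m. (-w gchoose j) * of_nat (Suc n) powr (-w - of_nat j))"

lemma norm_step_remainder:
  assumes "Re w > - real m - 1"
  shows "norm (step_remainder m n w) \<le>
           (\<Prod>k<Suc m. norm (w + of_nat k)) * real (Suc n) powr (- Re w - real m - 1)"
proof -
  define S where "S = {z. Im z = 0 \<and> Re z \<ge> real (Suc n)}"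
  define f where "f = (\<lambda>i x. (\<Prod>k<i. - w - of_nat k) * x powr (-w - of_nat i))"
  have "S = {z. Re z \<ge> real (Suc n)} \<inter> ({z. Im z \<le> 0} \<inter> {z. Im z \<ge> 0})"
    by (auto simp: S_def)
  hence S: "convex S"
    by (auto intro!: convex_Int convex_halfspace_Re_ge convex_halfspace_Im_ge convex_halfspace_Im_le)
  have pos: "x \<notin> \<real>\<^sub>\<le>\<^sub>0" if "x \<in> S" for x
    using that by (auto simp: S_def complex_nonpos_Reals_iff)
  have *: "norm (f 0 (of_nat (Suc (Suc n))) - (\<Sum>i\<le>m. f i (of_nat (Suc n)) * (of_nat (Suc (Suc n)) - of_nat (Suc n)) ^ i / fact i))
    \<le> ((\<Prod>k<Suc m. norm (w + of_nat k)) * real (Suc n) powr (- Re w - real m - 1)) *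
       norm (of_nat (Suc (Suc n)) - of_nat (Suc n) :: complex) ^ Suc m / fact m"
  proof (rule complex_Taylor[OF S])
    fix i x assume x: "x \<in> S"
    have "((\<lambda>x. x powr (-w - of_nat i)) has_field_derivative (-w - of_nat i) * x powr (-w - of_nat i - 1)) (at x within S)"
      using pos[OF x] by (intro has_field_derivative_at_within[OF has_field_derivative_powr])
    from DERIV_cmult[OF this, of "\<Prod>k<i. - w - of_nat k"]
    show "(f i has_field_derivative f (Suc i) x) (at x within S)"
      unfolding f_def by (simp add: algebra_simps)
  next
    fix x assume x: "x \<in> S"
    hence "Re x \<ge> real (Suc n)" "x \<in> \<real>" by (auto simp: S_def complex_is_Real_iff)
    hence "norm (x powr (-w - of_nat (Suc m))) = Re x powr (- Re w - real m - 1)"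
      by (subst norm_powr_real_powr) (auto simp: algebra_simps)
    also have "\<dots> \<le> real (Suc n) powr (- Re w - real m - 1)"
      using assms \<open>Re x \<ge> real (Suc n)\<close> by (intro powr_mono2') auto
    finally have 1: "norm (x powr (-w - of_nat (Suc m))) \<le> real (Suc n) powr (- Re w - real m - 1)" .
    have "norm (\<Prod>k<Suc m. - w - of_nat k) = (\<Prod>k<Suc m. norm (w + of_nat k))"
      unfolding prod_norm[symmetric]
      by (intro prod.cong refl) (metis add.commute minus_add_distrib norm_minus_cancel uminus_add_conv_diff add_uminus_conv_diff)
    thus "norm (f (Suc m) x) \<le> (\<Prod>k<Suc m. norm (w + of_nat k)) * real (Suc n) powr (- Re w - real m - 1)"
      unfolding f_def norm_mult using 1 by (intro mult_mono) (auto intro!: prod_nonneg simp del: prod.lessThan_Suc)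
  qed (auto simp: S_def)
  have g: "(-w gchoose i) = (\<Prod>k<i. - w - of_nat k) / fact i" for i
    by (simp add: gbinomial_prod_rev atLeast0LessThan)
  have "f 0 (of_nat (Suc (Suc n))) - (\<Sum>i\<le>m. f i (of_nat (Suc n)) * (of_nat (Suc (Suc n)) - of_nat (Suc n)) ^ i / fact i)
     = step_remainder m n w"
    unfolding step_remainder_def f_def g by simp
  moreover have "norm (of_nat (Suc (Suc n)) - of_nat (Suc n) :: complex) = 1" by simp
  moreover have "B * 1 ^ Suc m / fact m \<le> B" if "B \<ge> 0" for B :: real
    using mult_left_mono[OF fact_ge_1[of m] that] by (simp add: divide_le_eq)
  moreover have "0 \<le> (\<Prod>k<Suc m. norm (w + of_nat k)) * real (Suc n) powr (- Re w - real m - 1)"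
    by (intro mult_nonneg_nonneg prod_nonneg) auto
  ultimately show ?thesis using * by (metis order_trans)
qed

lemma half_plane_nonempty: "{s. 1 < Re s} \<noteq> {}"
proof -
  have "2 \<in> {s. 1 < Re s}" by simp
  thus ?thesis by blast
qed

lemma step_remainder_holomorphic: "step_remainder m n holomorphic_on A"
  unfolding step_remainder_def [abs_def] gbinomial_prod_rev by (intro holomorphic_intros) auto

lemma step_remainder_sum_holomorphic:
  "(\<lambda>w. \<Sum>n. step_remainder m n w) holomorphic_on {w. Re w > - real m}"
proof (rule series_holomorphic)
  show "open {w. - real m < Re w}" by (rule open_halfspace_Re_gt)
  fix x assume "x \<in> {w. - real m < Re w}"
  define d where "d = (Re x + real m) / 2"
  have d: "d > 0" using \<open>x \<in> _\<close> by (auto simp: d_def)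
  have Re_y: "Re y \<ge> - real m + d" if "y \<in> cball x d" for y
    using that abs_Re_le_cmod[of "x - y"] by (auto simp: dist_norm d_def field_simps)
  have sub: "cball x d \<subseteq> {w. - real m < Re w}" using Re_y d by force
  define C where "C = (\<Prod>k<Suc m. norm x + d + real k)"
  have "norm (step_remainder m n y) \<le> C * real (Suc n) powr (- 1 - d)" if y: "y \<in> cball x d" for n y
  proof -
    have "norm (step_remainder m n y) \<le> (\<Prod>k<Suc m. norm (y + of_nat k)) * real (Suc n) powr (- Re y - real m - 1)"
      using Re_y[OF y] d by (intro norm_step_remainder) auto
    also have "\<dots> \<le> C * real (Suc n) powr (- 1 - d)"
      unfolding C_def
    proof (intro mult_mono prod_mono conjI powr_mono)
      fix k
      have "norm y \<le> norm x + d" using y norm_triangle_ineq2[of y x] by (auto simp: dist_norm norm_minus_commute)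
      thus "norm (y + of_nat k) \<le> norm x + d + real k"
        using norm_triangle_ineq[of y "of_nat k"] by simp
    qed (use Re_y[OF y] d in \<open>auto intro!: prod_nonneg mult_nonneg_nonneg simp del: prod.lessThan_Suc\<close>)
    finally show ?thesis .
  qed
  moreover have "summable (\<lambda>n. C * real (Suc n) powr (- 1 - d))"
    using d by (intro summable_mult summable_Suc_powr) auto
  ultimately show "\<exists>d h. 0 < d \<and> cball x d \<subseteq> {w. - real m < Re w} \<and> summable h \<and>
               (\<forall>n. \<forall>y\<in>cball x d. norm (step_remainder m n y) \<le> h n)"
    using d sub by blast
qed (rule step_remainder_holomorphic)

lemma dirichlet_summable:
  assumes "Re s > 1"
  shows "summable (\<lambda>n. 1 / of_nat (Suc n) powr s :: complex)"
proof (rule summable_comparison_test_ev[OF always_eventually])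
  show "summable (\<lambda>n. real (Suc n) powr (- Re s))" using assms by (intro summable_Suc_powr) auto
  show "\<forall>n. norm (1 / of_nat (Suc n) powr s :: complex) \<le> real (Suc n) powr (- Re s)"
    by (simp add: norm_divide norm_of_nat_powr powr_minus field_simps del: of_nat_Suc)
qed

text \<open>The differences \<open>(n + 2)^(-w) - (n + 1)^(-w)\<close> telescope, and the Taylor term of order \<open>j\<close> sums to a
multiple of the Dirichlet series at \<open>w + j\<close>.\<close>

lemma step_remainder_sums:
  assumes "Re w > 0"
  defines "Z \<equiv> \<lambda>s. \<Sum>n. 1 / of_nat (Suc n) powr s :: complex"
  shows "(\<lambda>n. step_remainder m n w) sums (- 1 - (\<Sum>j=1..m. (-w gchoose j) * Z (w + of_nat j)))"
proof -
  have "(\<lambda>n. of_nat (Suc n) powr (- w)) \<longlonglongrightarrow> (0::complex)"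
  proof (rule tendsto_norm_zero_cancel)
    have "(\<lambda>n. real (Suc n) powr (- Re w)) \<longlonglongrightarrow> 0"
      using assms by (intro tendsto_neg_powr filterlim_compose[OF filterlim_real_sequentially filterlim_Suc]) auto
    thus "(\<lambda>n. norm (of_nat (Suc n) powr (- w) :: complex)) \<longlonglongrightarrow> 0"
      unfolding norm_of_nat_powr by simp
  qed
  from telescope_sums[OF this]
  have t: "(\<lambda>n. of_nat (Suc (Suc n)) powr (- w) - of_nat (Suc n) powr (-w)) sums (- 1 :: complex)" by simp
  have "(\<lambda>n. of_nat (Suc n) powr (-w - of_nat j)) sums Z (w + of_nat j)" if "j \<ge> 1" for j
  proof -
    have "of_nat (Suc n) powr (-w - of_nat j) = 1 / (of_nat (Suc n) powr (w + of_nat j) :: complex)" for n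
      by (metis minus_add_distrib powr_minus inverse_eq_divide uminus_add_conv_diff add.commute add_uminus_conv_diff)
    thus ?thesis unfolding Z_def using dirichlet_summable[of "w + of_nat j"] assms that
      by (simp add: summable_sums del: of_nat_Suc)
  qed
  hence "(\<lambda>n. \<Sum>j=1..m. (-w gchoose j) * of_nat (Suc n) powr (-w - of_nat j)) sums (\<Sum>j=1..m. (-w gchoose j) * Z (w + of_nat j))"
    by (intro sums_sum sums_mult) auto
  from sums_diff[OF t this] show ?thesis
    unfolding step_remainder_def by (simp add: atMost_atLeast0 sum.atLeast_Suc_atMost algebra_simps del: of_nat_Suc)
qed

text \<open>This formula moves the boundary of a continuation to the left: the right-hand side involves \<open>zeta\<close>
only at points shifted by at least \<open>1\<close>, and the remainder series is holomorphic for
\<open>Re s > 1 - m\<close>. The binomial coefficient of order \<open>j\<close> supplies the factor \<open>s + j - 2\<close> that cancels the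
pole of \<open>zeta\<close> at the shifted point, so that only the function \<open>(s - 1) zeta(s)\<close> occurs.\<close>

lemma dirichlet_recurrence:
  assumes "Re s > 1" "m \<ge> 1"
  defines "Z \<equiv> \<lambda>s. \<Sum>n. 1 / of_nat (Suc n) powr s :: complex"
  shows "(s - 1) * Z s = 1 + (\<Sum>n. step_remainder m n (s - 1)) -
           (\<Sum>j=2..m. ((1 - s) gchoose (j - 1)) / of_nat j * ((s + of_nat j - 2) * Z (s + of_nat j - 1)))"
proof -
  have "(\<Sum>n. step_remainder m n (s - 1)) = - 1 - (\<Sum>j=1..m. (- (s - 1) gchoose j) * Z (s - 1 + of_nat j))"
    using step_remainder_sums[of "s - 1" m] assms by (intro sums_unique[symmetric]) (simp add: Z_def)
  also have "(\<Sum>j=1..m. (- (s - 1) gchoose j) * Z (s - 1 + of_nat j)) =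
     (1 - s) * Z s + (\<Sum>j=2..m. ((1 - s) gchoose j) * Z (s - 1 + of_nat j))"
    using assms(2) by (subst sum.atLeast_Suc_atMost) (auto simp: numeral_2_eq_2)
  also have "(\<Sum>j=2..m. ((1 - s) gchoose j) * Z (s - 1 + of_nat j)) =
     - (\<Sum>j=2..m. ((1 - s) gchoose (j - 1)) / of_nat j * ((s + of_nat j - 2) * Z (s + of_nat j - 1)))"
    unfolding sum_negf[symmetric]
  proof (intro sum.cong refl)
    fix j assume "j \<in> {2..m}"
    then obtain i where i: "j = Suc i" by (cases j) auto
    have *: "of_nat (Suc i) * ((1 - s) gchoose Suc i) = ((1 - s) - of_nat i) * ((1 - s) gchoose i)"
      using gbinomial_absorb_comp[of "1 - s" i] gbinomial_absorption[of i "1 - s"] by simp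
    have neg: "a * g / k * z = - (g / k * ((- a) * z))" for a g k z :: complex by simp
    from * have "((1 - s) gchoose Suc i) = ((1 - s) - of_nat i) * ((1 - s) gchoose i) / of_nat (Suc i)"
      by (metis nonzero_mult_div_cancel_left of_nat_neq_0)
    moreover have e: "s + of_nat j - 2 = - ((1 - s) - of_nat i)" by (simp add: i)
    moreover have "Z (s - 1 + of_nat j) = Z (s + of_nat j - 1)" by (simp add: algebra_simps)
    ultimately show "((1 - s) gchoose j) * Z (s - 1 + of_nat j) =
      - (((1 - s) gchoose (j - 1)) / of_nat j * ((s + of_nat j - 2) * Z (s + of_nat j - 1)))"
      using neg[of "(1 - s) - of_nat i" "(1 - s) gchoose i"] by (simp only: i diff_Suc_1)
  qed
  finally show ?thesis by (simp add: algebra_simps)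
qed

lemma continuation_halfplane:
  "\<exists>G. G holomorphic_on {s. Re s > 1 - real m} \<and>
      (\<forall>s. Re s > 1 \<longrightarrow> G s = (s - 1) * (\<Sum>n. 1 / of_nat (Suc n) powr s))"
proof (induction m)
  case 0
  have "(\<lambda>s. \<Sum>n. 1 / of_nat (Suc n) powr s :: complex) holomorphic_on {s. Re s > 1}"
  proof (rule series_holomorphic)
    show "open {s. 1 < Re s}" by (rule open_halfspace_Re_gt)
    fix x assume "x \<in> {w. 1 < Re w}"
    define d where "d = (Re x - 1) / 2"
    have d: "d > 0" using \<open>x \<in> _\<close> by (auto simp: d_def)
    have Re_y: "Re y \<ge> 1 + d" if "y \<in> cball x d" for y
      using that abs_Re_le_cmod[of "x - y"] by (auto simp: dist_norm d_def field_simps)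
    have sub: "cball x d \<subseteq> {w. 1 < Re w}" using Re_y d by force
    have "norm (1 / of_nat (Suc n) powr y :: complex) \<le> real (Suc n) powr (- 1 - d)" if y: "y \<in> cball x d" for n y
    proof -
      have "norm (1 / of_nat (Suc n) powr y :: complex) = real (Suc n) powr (- Re y)"
        by (simp add: norm_divide norm_of_nat_powr powr_minus field_simps del: of_nat_Suc)
      also have "\<dots> \<le> real (Suc n) powr (- 1 - d)" using Re_y[OF y] by (intro powr_mono) auto
      finally show ?thesis .
    qed
    moreover have "summable (\<lambda>n. real (Suc n) powr (- 1 - d))" using d by (intro summable_Suc_powr) auto
    ultimately show "\<exists>d h. 0 < d \<and> cball x d \<subseteq> {w. 1 < Re w} \<and> summable h \<and>
               (\<forall>n. \<forall>y\<in>cball x d. norm (1 / of_nat (Suc n) powr y :: complex) \<le> h n)"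
      using d sub by blast
  qed (auto intro!: holomorphic_intros simp del: of_nat_Suc)
  hence "(\<lambda>s. (s - 1) * (\<Sum>n. 1 / of_nat (Suc n) powr s :: complex)) holomorphic_on {s. Re s > 1}"
    by (intro holomorphic_intros)
  thus ?case by (intro exI[of _ "\<lambda>s. (s - 1) * (\<Sum>n. 1 / of_nat (Suc n) powr s :: complex)"]) auto
next
  case (Suc m)
  then obtain G where G: "G holomorphic_on {s. Re s > 1 - real m}"
    "\<And>s. Re s > 1 \<Longrightarrow> G s = (s - 1) * (\<Sum>n. 1 / of_nat (Suc n) powr s)" by blast
  define H where "H = (\<lambda>s. 1 + (\<Sum>n. step_remainder (Suc m) n (s - 1)) -
           (\<Sum>j=2..Suc m. ((1 - s) gchoose (j - 1)) / of_nat j * G (s + of_nat j - 1)))"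
  have 1: "(\<lambda>s. \<Sum>n. step_remainder (Suc m) n (s - 1)) holomorphic_on {s. Re s > 1 - real (Suc m)}"
    by (rule holomorphic_on_compose_gen[of "\<lambda>s. s - 1" _ "\<lambda>w. \<Sum>n. step_remainder (Suc m) n w", unfolded o_def, OF _ step_remainder_sum_holomorphic])
       (auto intro!: holomorphic_intros)
  have 2: "(\<lambda>s. G (s + of_nat j - 1)) holomorphic_on {s. Re s > 1 - real (Suc m)}" if "j \<ge> 2" for j
    by (rule holomorphic_on_compose_gen[of "\<lambda>s. s + of_nat j - 1" _ G, unfolded o_def, OF _ G(1)])
       (use that in \<open>auto intro!: holomorphic_intros\<close>)
  have "H holomorphic_on {s. Re s > 1 - real (Suc m)}"
    unfolding H_def gbinomial_prod_rev by (intro holomorphic_intros 1 2) auto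
  moreover have "H s = (s - 1) * (\<Sum>n. 1 / of_nat (Suc n) powr s)" if s: "Re s > 1" for s
  proof -
    have "G (s + of_nat j - 1) = (s + of_nat j - 2) * (\<Sum>n. 1 / of_nat (Suc n) powr (s + of_nat j - 1))" if "j \<ge> 2" for j
      using that s by (subst G(2)) (auto simp: algebra_simps)
    thus ?thesis unfolding H_def using dirichlet_recurrence[OF s, of "Suc m"] by (simp del: of_nat_Suc)
  qed
  ultimately show ?case by blast
qed

lemma entire_continuation:
  "\<exists>G. G holomorphic_on UNIV \<and> (\<forall>s. Re s > 1 \<longrightarrow> G s = (s - 1) * (\<Sum>n. 1 / of_nat (Suc n) powr s))"
proof -
  obtain G where G: "\<And>m. G m holomorphic_on {s. Re s > 1 - real m}"
      "\<And>m s. Re s > 1 \<Longrightarrow> G m s = (s - 1) * (\<Sum>n. 1 / of_nat (Suc n) powr s)"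
    using continuation_halfplane by metis
  have agree: "G m s = G m' s" if "m \<le> m'" "Re s > 1 - real m" for m m' s
  proof (rule analytic_continuation_open[of "{s. Re s > 1}" "{s. Re s > 1 - real m}" "G m" "G m'"])
    show "{s. 1 < Re s} \<noteq> {}" using half_plane_nonempty .
    show "connected {s. Re s > 1 - real m}" by (intro convex_connected convex_halfspace_Re_gt)
    show "G m' holomorphic_on {s. Re s > 1 - real m}"
      by (rule holomorphic_on_subset[OF G(1)]) (use that in auto)
  qed (use that G in \<open>auto simp: open_halfspace_Re_gt\<close>)
  define H where "H s = G (nat \<lceil>2 - Re s\<rceil>) s" for s
  have H_eq: "H s = G m s" if "Re s > 1 - real m" for s m
  proof -
    have "Re s > 1 - real (nat \<lceil>2 - Re s\<rceil>)" by linarith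
    thus ?thesis unfolding H_def using agree[of m "nat \<lceil>2 - Re s\<rceil>" s] agree[of "nat \<lceil>2 - Re s\<rceil>" m s] that
      by (metis nle_le)
  qed
  have "H holomorphic_on UNIV"
  proof -
    have "H holomorphic_on (\<Union>m. {s. Re s > 1 - real m})"
    proof (rule holomorphic_on_UN_open)
      show "H holomorphic_on {s. Re s > 1 - real m}" for m
        using G(1)[of m] by (rule holomorphic_transform) (auto simp: H_eq)
    qed (auto simp: open_halfspace_Re_gt)
    moreover have "(\<Union>m. {s. Re s > 1 - real m}) = UNIV"
    proof safe
      fix s :: complex
      show "s \<in> (\<Union>m. {s. Re s > 1 - real m})"
        by (rule UN_I[of "nat \<lceil>2 - Re s\<rceil>"]) (simp, simp, linarith)
    qed auto
    ultimately show ?thesis by simp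
  qed
  moreover have "H s = (s - 1) * (\<Sum>n. 1 / of_nat (Suc n) powr s)" if "Re s > 1" for s
    using H_eq[of 0 s] G(2)[of s 0] that by simp
  ultimately show ?thesis by blast
qed

text \<open>The identity theorem: the difference, with its removable singularities removed, vanishes near one
point and hence everywhere, so both functions have the same poles and the same limits.\<close>

lemma nicely_meromorphic_unique:
  assumes f: "f nicely_meromorphic_on UNIV" and g: "g nicely_meromorphic_on UNIV"
    and eq: "\<forall>\<^sub>F z in at a. f z = g z"
  shows "f = g"
proof
  fix z
  have mero: "f meromorphic_on UNIV" "g meromorphic_on UNIV"
    using f g by (auto simp: nicely_meromorphic_on_def)
  define h where "h = remove_sings (\<lambda>z. f z - g z)"
  have hm: "(\<lambda>z. f z - g z) meromorphic_on UNIV" using mero by (intro meromorphic_intros)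
  hence h: "h nicely_meromorphic_on UNIV" unfolding h_def by (rule remove_sings_nicely_meromorphic)
  have ev: "\<forall>\<^sub>F w in at z. h w = f w - g w" for z
    unfolding h_def using hm
    by (intro eventually_remove_sings_eq_at meromorphic_on_isolated_singularity) (auto intro: meromorphic_on_subset)
  have "\<forall>\<^sub>F w in at a. h w = 0" using ev[of a] eq by eventually_elim auto
  hence "\<exists>\<^sub>F w in at a. h w = 0" by (intro eventually_frequently) auto
  from frequently_eq_meromorphic_imp_constant[OF this h] have h0: "h w = 0" for w by auto
  have fg: "\<forall>\<^sub>F w in at z. f w = g w" using ev[of z] h0 by (auto elim!: eventually_mono)
  have "is_pole f z \<longleftrightarrow> is_pole g z" by (intro is_pole_cong fg refl)
  moreover have "f \<midarrow>z\<rightarrow> l \<longleftrightarrow> g \<midarrow>z\<rightarrow> l" for l by (intro tendsto_cong fg)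
  moreover have "\<not> is_pole f z" if "f \<midarrow>z\<rightarrow> l" for l
    using that by (metis at_neq_bot is_pole_def not_tendsto_and_filterlim_at_infinity)
  moreover have "is_pole f z \<and> f z = 0 \<or> f \<midarrow>z\<rightarrow> f z" "is_pole g z \<and> g z = 0 \<or> g \<midarrow>z\<rightarrow> g z"
    using f g unfolding nicely_meromorphic_on_def by auto
  ultimately show "f z = g z" by (metis LIM_unique)
qed

text \<open>Besides the existence of the continuation this records the recurrence for \<open>m = 1\<close>, which holds for
\<open>Re s > 0\<close> and from which the growth of \<open>zeta\<close> on the critical strip is read off. It also gives the
value \<open>1\<close> of \<open>(s - 1) zeta(s)\<close> at \<open>s = 1\<close>, so that the point \<open>1\<close> really is a pole and the value \<open>0\<close> there,
which division by zero produces, is the prescribed one.\<close>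

lemma zeta_continuation:
  obtains G where "G holomorphic_on UNIV" "\<And>s. zeta s = G s / (s - 1)"
     "\<And>s. Re s > 0 \<Longrightarrow> G s = 1 + (\<Sum>n. step_remainder 1 n (s - 1))"
     "\<And>s. Re s > 1 \<Longrightarrow> (\<lambda>n. 1 / of_nat (Suc n) powr s) sums zeta s"
proof -
  obtain G where G: "G holomorphic_on UNIV"
    "\<And>s. Re s > 1 \<Longrightarrow> G s = (s - 1) * (\<Sum>n. 1 / of_nat (Suc n) powr s)"
    using entire_continuation by blast
  have G1: "G s = 1 + (\<Sum>n. step_remainder 1 n (s - 1))" if "Re s > 0" for s
  proof (rule analytic_continuation_open[of "{s. Re s > 1}" "{s. Re s > 0}" G])
    show "{s. 1 < Re s} \<noteq> {}" using half_plane_nonempty .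
    show "connected {s. Re s > 0}" by (intro convex_connected convex_halfspace_Re_gt)
    show "G holomorphic_on {s. Re s > 0}" using G(1) by (rule holomorphic_on_subset) auto
    show "(\<lambda>s. 1 + (\<Sum>n. step_remainder 1 n (s - 1))) holomorphic_on {s. Re s > 0}"
      by (intro holomorphic_intros holomorphic_on_compose_gen[of "\<lambda>s. s - 1" _ "\<lambda>w. \<Sum>n. step_remainder 1 n w", unfolded o_def, OF _ step_remainder_sum_holomorphic])
         auto
    show "G z = 1 + (\<Sum>n. step_remainder 1 n (z - 1))" if "z \<in> {s. Re s > 1}" for z
      using dirichlet_recurrence[of z 1] G(2)[of z] that by simp
  qed (use that in \<open>auto simp: open_halfspace_Re_gt\<close>)
  have "step_remainder 1 n 0 = 0" for n
    using of_nat_neq_0[of n, where ?'a = complex] of_nat_neq_0[of "Suc n", where ?'a = complex]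
    unfolding step_remainder_def by (simp del: of_nat_Suc)
  hence "G 1 = 1" using G1[of 1] by simp
  define f where "f s = G s / (s - 1)" for s
  have nice: "f nicely_meromorphic_on UNIV"
    unfolding nicely_meromorphic_on_def
  proof (intro conjI ballI)
    show "f meromorphic_on UNIV" unfolding f_def
      using G(1) by (intro meromorphic_intros analytic_on_imp_meromorphic_on) (auto simp: analytic_on_open)
    fix z
    show "is_pole f z \<and> f z = 0 \<or> f \<midarrow>z\<rightarrow> f z"
    proof (cases "z = 1")
      case True
      have "is_pole (\<lambda>s. G s / (s - 1)) 1"
        by (rule is_pole_divide) (use G(1) \<open>G 1 = 1\<close> in
          \<open>auto simp: holomorphic_on_imp_continuous_on continuous_on_eq_continuous_at[symmetric] eventually_at_filter intro!: tendsto_eq_intros filterlim_at[THEN iffD2]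
             dest!: holomorphic_on_imp_continuous_on simp: continuous_on_eq_continuous_at\<close>)
      thus ?thesis using True by (simp add: f_def[abs_def])
    next
      case False
      have "isCont G z" using G(1) by (meson UNIV_I continuous_on_eq_continuous_at holomorphic_on_imp_continuous_on open_UNIV)
      hence "isCont f z" unfolding f_def using False by (intro continuous_intros) auto
      thus ?thesis by (simp add: isCont_def)
    qed
  qed
  have sums: "(\<lambda>n. 1 / of_nat (Suc n) powr s) sums f s" if "Re s > 1" for s
  proof -
    have "f s = (\<Sum>n. 1 / of_nat (Suc n) powr s)" using that G(2)[of s] by (auto simp: f_def)
    thus ?thesis using dirichlet_summable[OF that] by (simp add: summable_sums)
  qed
  have "zeta = f"
    unfolding zeta_def
  proof (rule the_equality)
    show "f nicely_meromorphic_on UNIV \<and> (\<forall>s. 1 < Re s \<longrightarrow> (\<lambda>n. 1 / of_nat (Suc n) powr s) sums f s)"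
      using nice sums by blast
    fix g assume g: "g nicely_meromorphic_on UNIV \<and> (\<forall>s. 1 < Re s \<longrightarrow> (\<lambda>n. 1 / of_nat (Suc n) powr s) sums g s)"
    have "\<forall>\<^sub>F s in at 2. s \<in> {s. Re s > 1}"
      by (intro eventually_at_in_open' open_halfspace_Re_gt) auto
    hence "\<forall>\<^sub>F s in at 2. g s = f s"
      by eventually_elim (use g sums sums_unique2 in \<open>auto; blast\<close>)
    thus "g = f" using g nice by (intro nicely_meromorphic_unique[of g f 2]) auto
  qed
  show ?thesis
  proof (rule that[OF G(1) _ G1])
    show "zeta s = G s / (s - 1)" for s by (simp add: \<open>zeta = f\<close> f_def)
    show "(\<lambda>n. 1 / of_nat (Suc n) powr s) sums zeta s" if "Re s > 1" for s
      unfolding \<open>zeta = f\<close> by (rule sums[OF that])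
  qed
qed

section \<open>Dirichlet series and growth of the derivatives of zeta\<close>

lemma zeta_holomorphic: "zeta holomorphic_on - {1}"
proof -
  obtain G where "G holomorphic_on UNIV" and z: "\<And>s. zeta s = G s / (s - 1)"
    using zeta_continuation by metis
  hence "(\<lambda>s. G s / (s - 1)) holomorphic_on - {1}"
    by (intro holomorphic_intros) (auto intro: holomorphic_on_subset)
  thus ?thesis using z by (simp add: fun_eq_iff cong: holomorphic_cong)
qed

lemma zeta_derivs_holomorphic: "(deriv ^^ l) zeta holomorphic_on - {1}"
  by (intro holomorphic_higher_deriv zeta_holomorphic) auto

lemma zeta_linear_growth:
  "\<exists>C>0. \<forall>s. Re s \<ge> 1/4 \<longrightarrow> Im s \<ge> 1 \<longrightarrow> norm (zeta s) \<le> C * norm s"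
proof -
  obtain G where z: "\<And>s. zeta s = G s / (s - 1)"
    and G: "\<And>s. Re s > 0 \<Longrightarrow> G s = 1 + (\<Sum>n. step_remainder 1 n (s - 1))"
    using zeta_continuation by metis
  define C where "C = (\<Sum>n. real (Suc n) powr (-5/4))"
  have sm: "summable (\<lambda>n. real (Suc n) powr (-5/4))" by (intro summable_Suc_powr) auto
  have "norm (zeta s) \<le> (1 + C) * norm s" if s: "Re s \<ge> 1/4" "Im s \<ge> 1" for s
  proof -
    have s1: "norm (s - 1) \<ge> 1" "norm s \<ge> 1"
      using abs_Im_le_cmod[of "s - 1"] abs_Im_le_cmod[of s] s by auto
    have b: "norm (step_remainder 1 n (s - 1)) \<le> norm (s - 1) * norm s * real (Suc n) powr (-5/4)" for n
    proof -
      have "norm (step_remainder 1 n (s - 1)) \<le>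
        (\<Prod>k<Suc 1. norm (s - 1 + of_nat k)) * real (Suc n) powr (- Re (s - 1) - real 1 - 1)"
        using s by (intro norm_step_remainder) auto
      also have "\<dots> \<le> norm (s - 1) * norm s * real (Suc n) powr (-5/4)"
        using s by (intro mult_mono powr_mono) auto
      finally show ?thesis .
    qed
    have "norm (\<Sum>n. step_remainder 1 n (s - 1)) \<le> (\<Sum>n. norm (s - 1) * norm s * real (Suc n) powr (-5/4))"
      by (rule norm_suminf_le) (use b sm in \<open>auto intro!: summable_mult\<close>)
    also have "\<dots> = norm (s - 1) * norm s * C" unfolding C_def by (rule suminf_mult[OF sm])
    finally have "norm (G s) \<le> 1 + norm (s - 1) * norm s * C"
      using G[of s] s norm_triangle_ineq[of 1 "\<Sum>n. step_remainder 1 n (s - 1)"] by simp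
    also have "\<dots> \<le> (1 + C) * norm s * norm (s - 1)"
      using mult_mono[OF s1] by (simp add: algebra_simps)
    finally have "norm (G s) \<le> (1 + C) * norm s * norm (s - 1)" .
    moreover have "norm (s - 1) > 0" using s1 by linarith
    ultimately show ?thesis by (simp add: z norm_divide divide_le_eq)
  qed
  moreover have "1 + C > 0" unfolding C_def using suminf_nonneg[OF sm] by (simp add: add_pos_nonneg)
  ultimately show ?thesis by blast
qed

text \<open>Cauchy's inequality on circles of radius \<open>1/4\<close>, which stay away from the pole.\<close>

lemma zeta_deriv_linear_growth:
  "\<exists>C>0. \<forall>s. Re s \<ge> 1/2 \<longrightarrow> Im s \<ge> 2 \<longrightarrow> norm ((deriv ^^ l) zeta s) \<le> C * norm s"
proof -
  obtain C where C: "C > 0" "\<And>s. Re s \<ge> 1/4 \<Longrightarrow> Im s \<ge> 1 \<Longrightarrow> norm (zeta s) \<le> C * norm s"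
    using zeta_linear_growth by blast
  have "norm ((deriv ^^ l) zeta s) \<le> (2 * C * fact l * 4 ^ l) * norm s" if s: "Re s \<ge> 1/2" "Im s \<ge> 2" for s
  proof -
    have s1: "norm s \<ge> 1" using abs_Im_le_cmod[of s] s by auto
    have sub: "cball s (1/4) \<subseteq> - {1}"
    proof safe
      assume "1 \<in> cball s (1/4)"
      thus False using abs_Im_le_cmod[of "s - 1"] s by (auto simp: dist_norm)
    qed
    have "norm ((deriv ^^ l) zeta s) \<le> fact l * (C * (2 * norm s)) / (1/4) ^ l"
    proof (rule Cauchy_inequality)
      show "zeta holomorphic_on ball s (1/4)"
        using zeta_holomorphic by (rule holomorphic_on_subset) (use sub in auto)
      show "continuous_on (cball s (1/4)) zeta"
        by (rule holomorphic_on_imp_continuous_on) (use zeta_holomorphic sub in \<open>auto intro: holomorphic_on_subset\<close>)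
      fix y assume y: "norm (s - y) = 1/4"
      hence "Re y \<ge> 1/4" "Im y \<ge> 1"
        using abs_Re_le_cmod[of "s - y"] abs_Im_le_cmod[of "s - y"] s by auto
      hence "norm (zeta y) \<le> C * norm y" by (rule C)
      also have "norm y \<le> 2 * norm s" using y s1 norm_triangle_ineq2[of y s] by (simp add: norm_minus_commute)
      finally show "norm (zeta y) \<le> C * (2 * norm s)" using C(1) by simp
    qed simp
    thus ?thesis by (simp add: power_one_over field_simps)
  qed
  moreover have "2 * C * fact l * 4 ^ l > 0" using C(1) by simp
  ultimately show ?thesis by blast
qed

lemma ln_power_le_powr:
  fixes a :: real
  assumes "a > 0"
  shows "\<exists>K>0. \<forall>x\<ge>1. ln x ^ l \<le> K * x powr a"
proof (cases "l = 0")
  case True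
  have "ln x ^ l \<le> 1 * x powr a" if "x \<ge> 1" for x
    using that assms True by (simp add: ge_one_powr_ge_zero)
  thus ?thesis by (intro exI[of _ 1]) auto
next
  case False
  have "ln x ^ l \<le> (real l / a) ^ l * x powr a" if "x \<ge> 1" for x
  proof -
    have "ln x \<le> x powr (a / l) / (a / l)" using that assms False by (intro ln_powr_bound) auto
    hence "ln x ^ l \<le> (x powr (a / l) / (a / l)) ^ l" using that by (intro power_mono) auto
    also have "\<dots> = (real l / a) ^ l * (x powr (a / l)) ^ l" by (simp add: power_divide power_mult_distrib)
    also have "(x powr (a / l)) ^ l = x powr a" using False that
      by (simp add: powr_realpow[symmetric] powr_powr)
    finally show ?thesis .
  qed
  moreover have "(real l / a) ^ l > 0" using assms False by simp
  ultimately show ?thesis by blast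
qed

lemma zeta_deriv_dirichlet_series:
  "Re s > 1 \<Longrightarrow> (\<lambda>n. of_real ((- ln (real (Suc n))) ^ l) * of_nat (Suc n) powr (-s)) sums (deriv ^^ l) zeta s"
proof (induction l arbitrary: s)
  case 0
  obtain G where "\<And>s. Re s > 1 \<Longrightarrow> (\<lambda>n. 1 / of_nat (Suc n) powr s) sums zeta s"
    using zeta_continuation by metis
  from this[OF 0] show ?case by (simp add: powr_minus field_simps del: of_nat_Suc)
next
  case (Suc l)
  define f where "f = (\<lambda>n s. of_real ((- ln (real (Suc n))) ^ l) * of_nat (Suc n) powr (-s) :: complex)"
  define f' where "f' = (\<lambda>n s. of_real ((- ln (real (Suc n))) ^ Suc l) * of_nat (Suc n) powr (-s) :: complex)"
  define S where "S = {s. Re s > 1}"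
  have S: "open S" unfolding S_def by (rule open_halfspace_Re_gt)
  have "\<exists>g g'. \<forall>x \<in> S. ((\<lambda>n. f n x) sums g x) \<and> ((\<lambda>n. f' n x) sums g' x) \<and> (g has_field_derivative g' x) (at x)"
  proof (rule series_and_derivative_comparison_complex[OF S])
    fix n x
    have L: "Ln (of_nat (Suc n)) = of_real (ln (real (Suc n)))"
      by (metis Ln_of_real of_nat_0_less_iff of_real_of_nat_eq zero_less_Suc)
    have "((\<lambda>x. of_nat (Suc n) powr (- x)) has_field_derivative
            (Ln (of_nat (Suc n)) * of_nat (Suc n) powr (- x)) * (- 1)) (at x)"
      by (rule DERIV_chain2[OF has_field_derivative_powr_right]) (auto intro!: derivative_eq_intros simp del: of_nat_Suc)
    from DERIV_cmult[OF this, of "of_real ((- ln (real (Suc n))) ^ l)"]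
    show "(f n has_field_derivative f' n x) (at x)"
      unfolding f_def f'_def by (simp add: L mult_ac del: of_nat_Suc)
  next
    fix x assume x: "x \<in> S"
    define d where "d = (Re x - 1) / 2"
    have d: "d > 0" using x by (auto simp: d_def S_def)
    obtain K where K: "K > 0" "\<And>x. x \<ge> 1 \<Longrightarrow> ln x ^ l \<le> K * x powr (d / 2)"
      using ln_power_le_powr[of "d/2" l] d by auto
    define h where "h = (\<lambda>n. complex_of_real (K * real (Suc n) powr (- 1 - d / 2)))"
    have "norm (f n y) \<le> norm (h n)" if y: "y \<in> ball x d" for n y
    proof -
      have Re_y: "Re y \<ge> 1 + d"
        using y abs_Re_le_cmod[of "x - y"] by (auto simp: dist_norm d_def field_simps)
      have "norm (f n y) = ln (real (Suc n)) ^ l * real (Suc n) powr (- Re y)"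
        unfolding f_def norm_mult norm_of_nat_powr by (simp add: norm_power del: of_nat_Suc)
      also have "\<dots> \<le> (K * real (Suc n) powr (d / 2)) * real (Suc n) powr (- 1 - d)"
        using Re_y K(1) by (intro mult_mono K powr_mono) auto
      also have "\<dots> = K * real (Suc n) powr (d / 2 + (- 1 - d))"
        by (simp only: mult.assoc powr_add)
      also have "d / 2 + (- 1 - d) = - 1 - d / 2" by simp
      finally show ?thesis using K(1) by (simp add: h_def norm_mult del: of_nat_Suc)
    qed
    moreover have "summable h" unfolding h_def
      by (intro summable_of_real summable_mult summable_Suc_powr) (use d in auto)
    moreover have "range h \<subseteq> \<real>\<^sub>\<ge>\<^sub>0" using K(1) by (auto simp: h_def complex_nonneg_Reals_iff simp del: of_real_mult of_nat_Suc)
    ultimately show "\<exists>d h. 0 < d \<and> summable h \<and> range h \<subseteq> \<real>\<^sub>\<ge>\<^sub>0 \<and> (\<forall>\<^sub>F n in sequentially. \<forall>y\<in>ball x d \<inter> S. cmod(f n y) \<le> cmod (h n))"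
      using d by (intro exI[of _ d] exI[of _ h]) (auto intro!: always_eventually)
  qed
  then obtain g g' where g: "\<And>x. x \<in> S \<Longrightarrow> (\<lambda>n. f n x) sums g x"
     "\<And>x. x \<in> S \<Longrightarrow> (\<lambda>n. f' n x) sums g' x" "\<And>x. x \<in> S \<Longrightarrow> (g has_field_derivative g' x) (at x)"
    by metis
  have eq: "g x = (deriv ^^ l) zeta x" if "x \<in> S" for x
    using g(1)[OF that] Suc.IH[of x] that sums_unique2 by (auto simp: f_def S_def)
  have "((deriv ^^ l) zeta has_field_derivative g' s) (at s)"
    by (rule has_field_derivative_transform_within_open[OF g(3)[of s] S]) (use Suc.prems eq in \<open>auto simp: S_def\<close>)
  hence "(deriv ^^ Suc l) zeta s = g' s" by (simp add: DERIV_imp_deriv)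
  thus ?case using g(2)[of s] Suc.prems by (simp add: S_def f'_def del: of_nat_Suc)
qed

text \<open>On \<open>Re z = 2\<close> a power of the length is saved. This compensates the size of the smoothing kernel there,
which is a smaller power.\<close>

lemma zeta_deriv_tail:
  "\<exists>C>0. \<forall>X\<ge>1. \<forall>z. Re z = 2 \<longrightarrow>
     norm ((deriv ^^ l) zeta z - (\<Sum>n<X. of_real ((- ln (real (Suc n))) ^ l) * of_nat (Suc n) powr (-z))) \<le> C * real X powr (-1/2)"
proof -
  obtain K :: real where K: "K > 0" "\<And>x. x \<ge> 1 \<Longrightarrow> ln x ^ l \<le> K * x powr (1/4)"
    using ln_power_le_powr[of "1/4" l] by auto
  define C where "C = (\<Sum>n. real (Suc n) powr (-5/4))"
  have sm: "summable (\<lambda>n. real (Suc n) powr (-5/4))" by (intro summable_Suc_powr) auto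
  have "C > 0" unfolding C_def using sm by (intro suminf_pos) auto
  have "norm ((deriv ^^ l) zeta z - (\<Sum>n<X. of_real ((- ln (real (Suc n))) ^ l) * of_nat (Suc n) powr (-z))) \<le> K * C * real X powr (-1/2)"
    if X: "X \<ge> 1" and z: "Re z = 2" for X z
  proof -
    define a where "a = (\<lambda>n. of_real ((- ln (real (Suc n))) ^ l) * of_nat (Suc n) powr (-z) :: complex)"
    have a: "a sums (deriv ^^ l) zeta z" unfolding a_def using z by (intro zeta_deriv_dirichlet_series) auto
    have b: "norm (a (n + X)) \<le> K * real X powr (-1/2) * real (Suc (n + X)) powr (-5/4)" for n
    proof -
      have "norm (a (n + X)) = ln (real (Suc (n + X))) ^ l * real (Suc (n + X)) powr (- 2)"
        unfolding a_def norm_mult norm_of_nat_powr using z by (simp add: norm_power del: of_nat_Suc)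
      also have "\<dots> \<le> (K * real (Suc (n + X)) powr (1/4)) * real (Suc (n + X)) powr (-2)"
        using K(1) by (intro mult_mono K) auto
      also have "\<dots> = K * real (Suc (n + X)) powr (-1/2) * real (Suc (n + X)) powr (-5/4)"
        by (simp add: mult.assoc powr_add[symmetric] del: of_nat_Suc)
      also have "\<dots> \<le> K * real X powr (-1/2) * real (Suc (n + X)) powr (-5/4)"
        using K(1) X by (intro mult_mono powr_mono2') auto
      finally show ?thesis .
    qed
    have sm': "summable (\<lambda>n. real (Suc (n + X)) powr (-5/4))"
      using summable_ignore_initial_segment[OF sm, of X] by simp
    have "(deriv ^^ l) zeta z - (\<Sum>n<X. a n) = (\<Sum>n. a (n + X))"
      using suminf_minus_initial_segment[of a X] a by (simp add: sums_iff)
    also have "norm \<dots> \<le> (\<Sum>n. K * real X powr (-1/2) * real (Suc (n + X)) powr (-5/4))"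
      by (rule norm_suminf_le) (use b sm' in \<open>auto intro!: summable_mult simp del: of_nat_Suc\<close>)
    also have "\<dots> = K * real X powr (-1/2) * (\<Sum>n. real (Suc (n + X)) powr (-5/4))"
      by (rule suminf_mult[OF sm'])
    also have "\<dots> \<le> K * real X powr (-1/2) * C"
      using suminf_minus_initial_segment[OF sm, of X] K(1)
      by (intro mult_left_mono) (simp_all add: C_def sum_nonneg del: of_nat_Suc)
    finally show ?thesis unfolding a_def by (simp only: mult_ac)
  qed
  moreover have "K * C > 0" using K(1) \<open>C > 0\<close> by simp
  ultimately show ?thesis by blast
qed

section \<open>Gaussian integrals\<close>

lemma gaussian_fourier:
  fixes \<tau> y :: real
  assumes "\<tau> > 0"
  shows "integrable lborel (\<lambda>t. of_real (exp (- t\<^sup>2 / (2 * \<tau>\<^sup>2))) * cis (t * y))"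
    and "(\<integral>t. of_real (exp (- t\<^sup>2 / (2 * \<tau>\<^sup>2))) * cis (t * y) \<partial>lborel) = of_real (sqrt (2 * pi) * \<tau> * exp (- (\<tau> * y)\<^sup>2 / 2))"
proof -
  interpret real_distribution std_normal_distribution by (rule real_dist_normal_dist)
  define g where "g = (\<lambda>x. std_normal_density x *\<^sub>R iexp (\<tau> * y * x))"
  have int: "integrable std_normal_distribution (\<lambda>x. iexp (\<tau> * y * x))"
    by (rule integrable_const_bound[of _ 1]) auto
  have ig: "integrable lborel g" unfolding g_def
    using int by (subst (asm) integrable_density) auto
  have "(\<integral>x. g x \<partial>lborel) = char std_normal_distribution (\<tau> * y)"
    unfolding char_def g_def by (subst integral_density) (auto simp: mult_ac)
  also have "\<dots> = of_real (exp (- (\<tau> * y)\<^sup>2 / 2))" by (simp add: char_std_normal_distribution)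
  finally have vg: "(\<integral>x. g x \<partial>lborel) = of_real (exp (- (\<tau> * y)\<^sup>2 / 2))" .
  have eq: "of_real (exp (- t\<^sup>2 / (2 * \<tau>\<^sup>2))) * cis (t * y) = of_real (sqrt (2 * pi)) * g (0 + (1/\<tau>) * t)" for t
  proof -
    have "std_normal_density (t / \<tau>) = (1 / sqrt (2 * pi)) * exp (- t\<^sup>2 / (2 * \<tau>\<^sup>2))"
      unfolding std_normal_density_def by (simp add: power_divide mult.commute)
    thus ?thesis using assms by (simp add: g_def scaleR_conv_of_real cis_conv_exp mult_ac)
  qed
  have ig': "integrable lborel (\<lambda>t. g (0 + (1/\<tau>) * t))"
    using assms lborel_integrable_real_affine[OF ig, of "1/\<tau>" 0] by simp
  show "integrable lborel (\<lambda>t. of_real (exp (- t\<^sup>2 / (2 * \<tau>\<^sup>2))) * cis (t * y))"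
    unfolding eq using ig' by simp
  have "(\<integral>x. g x \<partial>lborel) = \<bar>1/\<tau>\<bar> *\<^sub>R (\<integral>t. g (0 + (1/\<tau>) * t) \<partial>lborel)"
    using assms by (intro lborel_integral_real_affine) auto
  hence "(\<integral>t. g (0 + (1/\<tau>) * t) \<partial>lborel) = of_real \<tau> * (\<integral>x. g x \<partial>lborel)"
    using assms by (simp add: scaleR_conv_of_real field_simps)
  thus "(\<integral>t. of_real (exp (- t\<^sup>2 / (2 * \<tau>\<^sup>2))) * cis (t * y) \<partial>lborel) = of_real (sqrt (2 * pi) * \<tau> * exp (- (\<tau> * y)\<^sup>2 / 2))"
    unfolding eq using ig' by (simp add: vg)
qed

lemma gaussian_cos:
  fixes \<tau> y :: real
  assumes "\<tau> > 0"
  shows "integrable lborel (\<lambda>t. exp (- t\<^sup>2 / (2 * \<tau>\<^sup>2)) * cos (t * y))"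
    and "(\<integral>t. exp (- t\<^sup>2 / (2 * \<tau>\<^sup>2)) * cos (t * y) \<partial>lborel) = sqrt (2 * pi) * \<tau> * exp (- (\<tau> * y)\<^sup>2 / 2)"
proof -
  show "integrable lborel (\<lambda>t. exp (- t\<^sup>2 / (2 * \<tau>\<^sup>2)) * cos (t * y))"
    using integrable_Re[OF gaussian_fourier(1)[OF assms, of y]] by simp
  have "(\<integral>t. exp (- t\<^sup>2 / (2 * \<tau>\<^sup>2)) * cos (t * y) \<partial>lborel) = Re (\<integral>t. of_real (exp (- t\<^sup>2 / (2 * \<tau>\<^sup>2))) * cis (t * y) \<partial>lborel)"
    using integral_Re[OF gaussian_fourier(1)[OF assms, of y]] by simp
  thus "(\<integral>t. exp (- t\<^sup>2 / (2 * \<tau>\<^sup>2)) * cos (t * y) \<partial>lborel) = sqrt (2 * pi) * \<tau> * exp (- (\<tau> * y)\<^sup>2 / 2)"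
    using gaussian_fourier(2)[OF assms, of y] by simp
qed

lemma gaussian_tail:
  fixes \<tau> a :: real
  assumes "\<tau> > 0" "a \<ge> 0"
  shows "set_integrable lborel {t. \<bar>t\<bar> > a} (\<lambda>t. exp (- t\<^sup>2 / (2 * \<tau>\<^sup>2)))"
    and "(LINT t:{t. \<bar>t\<bar> > a}|lborel. exp (- t\<^sup>2 / (2 * \<tau>\<^sup>2))) \<le> 4 * \<tau> * exp (- a\<^sup>2 / (4 * \<tau>\<^sup>2))"
proof -
  have i1: "integrable lborel (\<lambda>t. exp (- t\<^sup>2 / (2 * \<tau>\<^sup>2)))"
    using gaussian_cos(1)[OF assms(1), of 0] by simp
  have p: "sqrt 2 * \<tau> > 0" using assms by simp
  have e: "2 * (sqrt 2 * \<tau>)\<^sup>2 = 4 * \<tau>\<^sup>2" by (simp add: power_mult_distrib)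
  have i2: "integrable lborel (\<lambda>t. exp (- t\<^sup>2 / (4 * \<tau>\<^sup>2)))"
    using gaussian_cos(1)[OF p, of 0] unfolding e by simp
  have v2: "(\<integral>t. exp (- t\<^sup>2 / (4 * \<tau>\<^sup>2)) \<partial>lborel) = sqrt (2 * pi) * (sqrt 2 * \<tau>)"
    using gaussian_cos(2)[OF p, of 0] unfolding e by simp
  have m: "{t. \<bar>t\<bar> > a} \<in> sets lborel" by measurable
  show s: "set_integrable lborel {t. \<bar>t\<bar> > a} (\<lambda>t. exp (- t\<^sup>2 / (2 * \<tau>\<^sup>2)))"
    unfolding set_integrable_def using integrable_mult_indicator[OF m i1] .
  have "(LINT t:{t. \<bar>t\<bar> > a}|lborel. exp (- t\<^sup>2 / (2 * \<tau>\<^sup>2))) \<le> (\<integral>t. exp (- a\<^sup>2 / (4 * \<tau>\<^sup>2)) * exp (- t\<^sup>2 / (4 * \<tau>\<^sup>2)) \<partial>lborel)"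
    unfolding set_lebesgue_integral_def
  proof (rule integral_mono)
    show "integrable lborel (\<lambda>t. indicat_real {t. a < \<bar>t\<bar>} t *\<^sub>R exp (- t\<^sup>2 / (2 * \<tau>\<^sup>2)))"
      using s unfolding set_integrable_def .
    show "integrable lborel (\<lambda>t. exp (- a\<^sup>2 / (4 * \<tau>\<^sup>2)) * exp (- t\<^sup>2 / (4 * \<tau>\<^sup>2)))" using i2 by simp
    fix t
    have "exp (- t\<^sup>2 / (2 * \<tau>\<^sup>2)) \<le> exp (- a\<^sup>2 / (4 * \<tau>\<^sup>2)) * exp (- t\<^sup>2 / (4 * \<tau>\<^sup>2))" if "\<bar>t\<bar> > a"
    proof -
      have "a\<^sup>2 \<le> t\<^sup>2" using that assms by (simp add: abs_le_square_iff[symmetric])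
      hence "- t\<^sup>2 / (2 * \<tau>\<^sup>2) \<le> - a\<^sup>2 / (4 * \<tau>\<^sup>2) + - t\<^sup>2 / (4 * \<tau>\<^sup>2)"
        using assms by (simp add: field_simps)
      thus ?thesis by (simp add: exp_add[symmetric])
    qed
    thus "indicat_real {t. a < \<bar>t\<bar>} t *\<^sub>R exp (- t\<^sup>2 / (2 * \<tau>\<^sup>2)) \<le> exp (- a\<^sup>2 / (4 * \<tau>\<^sup>2)) * exp (- t\<^sup>2 / (4 * \<tau>\<^sup>2))"
      by (auto simp: indicator_def)
  qed
  also have "\<dots> = exp (- a\<^sup>2 / (4 * \<tau>\<^sup>2)) * (sqrt (2 * pi) * sqrt 2 * \<tau>)"
    using v2 by simp
  also have "sqrt (2 * pi) * sqrt 2 = 2 * sqrt pi" by (simp add: real_sqrt_mult)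
  also have "exp (- a\<^sup>2 / (4 * \<tau>\<^sup>2)) * (2 * sqrt pi * \<tau>) \<le> exp (- a\<^sup>2 / (4 * \<tau>\<^sup>2)) * (2 * 2 * \<tau>)"
    using assms pi_less_4 real_sqrt_le_mono[of pi 4] by (intro mult_left_mono mult_right_mono) auto
  finally show "(LINT t:{t. \<bar>t\<bar> > a}|lborel. exp (- t\<^sup>2 / (2 * \<tau>\<^sup>2))) \<le> 4 * \<tau> * exp (- a\<^sup>2 / (4 * \<tau>\<^sup>2))"
    by (simp add: mult_ac)
qed

text \<open>Cauchy's theorem on a rectangle.\<close>

lemma left_edge_bound:
  assumes "a < b" "c < d" and hol: "H holomorphic_on cbox (Complex a c) (Complex b d)"
    and bot: "\<And>x. x \<in> {a..b} \<Longrightarrow> norm (H (Complex x c)) \<le> B1"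
    and top: "\<And>x. x \<in> {a..b} \<Longrightarrow> norm (H (Complex x d)) \<le> B1"
    and right: "\<And>y. y \<in> {c..d} \<Longrightarrow> norm (H (Complex b y)) \<le> B2"
  shows "norm (integral {c..d} (\<lambda>y. H (Complex a y))) \<le> 2 * B1 * (b - a) + B2 * (d - c)"
proof -
  let ?p1 = "Complex a c" let ?p2 = "Complex b c" let ?p3 = "Complex b d" let ?p4 = "Complex a d"
  have img: "path_image (rectpath ?p1 ?p3) \<subseteq> cbox ?p1 ?p3"
    using assms by (intro path_image_rectpath_subset_cbox) auto
  have cont: "continuous_on (cbox ?p1 ?p3) H" using hol by (rule holomorphic_on_imp_continuous_on)
  have seg: "closed_segment u v \<subseteq> cbox ?p1 ?p3" if "u \<in> cbox ?p1 ?p3" "v \<in> cbox ?p1 ?p3" for u v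
    using that by (intro closed_segment_subset) (auto simp: convex_box)
  have mem: "?p1 \<in> cbox ?p1 ?p3" "?p2 \<in> cbox ?p1 ?p3" "?p3 \<in> cbox ?p1 ?p3" "?p4 \<in> cbox ?p1 ?p3"
    using assms by (auto simp: in_cbox_complex_iff)
  have ci: "H contour_integrable_on linepath u v" if "u \<in> cbox ?p1 ?p3" "v \<in> cbox ?p1 ?p3" for u v
    using continuous_on_subset[OF cont seg[OF that]] by (rule contour_integrable_continuous_linepath)
  have "(H has_contour_integral 0) (rectpath ?p1 ?p3)"
    by (rule Cauchy_theorem_convex_simple[OF hol]) (use img in \<open>auto simp: convex_box\<close>)
  hence "contour_integral (rectpath ?p1 ?p3) H = 0" by (rule contour_integral_unique)
  also have "contour_integral (rectpath ?p1 ?p3) H = contour_integral (linepath ?p1 ?p2) H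
     + (contour_integral (linepath ?p2 ?p3) H + (contour_integral (linepath ?p3 ?p4) H + contour_integral (linepath ?p4 ?p1) H))"
    using ci mem by (simp add: rectpath_def Let_def contour_integrable_joinI)
  also have "contour_integral (linepath ?p4 ?p1) H = - contour_integral (linepath ?p1 ?p4) H"
    using continuous_on_subset[OF cont seg[of ?p4 ?p1]] mem
    by (intro contour_integral_reverse_linepath) auto
  also have "contour_integral (linepath ?p1 ?p4) H = \<i> * integral {c..d} (\<lambda>y. H (Complex a y))"
    using assms by (intro contour_integral_linepath_same_Re) auto
  finally have eq: "\<i> * integral {c..d} (\<lambda>y. H (Complex a y)) = contour_integral (linepath ?p1 ?p2) H
     + (contour_integral (linepath ?p2 ?p3) H + contour_integral (linepath ?p3 ?p4) H)" by (simp add: algebra_simps)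
  have nn: "0 \<le> B1" "0 \<le> B2" using bot[of a] right[of c] assms(1,2) by (auto intro: order_trans[OF norm_ge_zero])
  have 1: "norm (contour_integral (linepath ?p1 ?p2) H) \<le> B1 * norm (?p2 - ?p1)"
  proof (rule contour_integral_bound_linepath[OF ci[OF mem(1,2)] nn(1)])
    fix x assume "x \<in> closed_segment ?p1 ?p2"
    hence "x = Complex (Re x) c" "Re x \<in> {a..b}" using assms by (auto simp: closed_segment_same_Im closed_segment_eq_real_ivl complex_eq_iff)
    thus "norm (H x) \<le> B1" using bot by metis
  qed
  have 2: "norm (contour_integral (linepath ?p2 ?p3) H) \<le> B2 * norm (?p3 - ?p2)"
  proof (rule contour_integral_bound_linepath[OF ci[OF mem(2,3)] nn(2)])
    fix x assume "x \<in> closed_segment ?p2 ?p3"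
    hence "x = Complex b (Im x)" "Im x \<in> {c..d}" using assms by (auto simp: closed_segment_same_Re closed_segment_eq_real_ivl complex_eq_iff)
    thus "norm (H x) \<le> B2" using right by metis
  qed
  have 3: "norm (contour_integral (linepath ?p3 ?p4) H) \<le> B1 * norm (?p4 - ?p3)"
  proof (rule contour_integral_bound_linepath[OF ci[OF mem(3,4)] nn(1)])
    fix x assume "x \<in> closed_segment ?p3 ?p4"
    hence "x = Complex (Re x) d" "Re x \<in> {a..b}" using assms by (auto simp: closed_segment_same_Im closed_segment_eq_real_ivl complex_eq_iff)
    thus "norm (H x) \<le> B1" using top by metis
  qed
  have n: "norm (?p2 - ?p1) = b - a" "norm (?p3 - ?p2) = d - c" "norm (?p4 - ?p3) = b - a"
    using assms by (simp_all add: cmod_def)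
  have "norm (integral {c..d} (\<lambda>y. H (Complex a y))) = norm (\<i> * integral {c..d} (\<lambda>y. H (Complex a y)))"
    by (simp add: norm_mult)
  also have "\<dots> \<le> B1 * (b - a) + (B2 * (d - c) + B1 * (b - a))"
    unfolding eq using 1 2 3 unfolding n by (intro order_trans[OF norm_triangle_ineq] add_mono)
  finally show ?thesis by (simp add: algebra_simps)
qed

lemma gaussian_majorant_split:
  fixes q :: "real \<Rightarrow> real"
  assumes q: "integrable lborel q" and "\<tau> > 0" "U \<ge> 0"
    and bd: "\<And>u. \<bar>q u\<bar> \<le> M * exp (- u\<^sup>2 / (2 * \<tau>\<^sup>2))"
  shows "\<bar>(\<integral>u. q u \<partial>lborel) - (LINT u:{-U..U}|lborel. q u)\<bar> \<le> M * (4 * \<tau> * exp (- U\<^sup>2 / (4 * \<tau>\<^sup>2)))"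
proof -
  have si: "set_integrable lborel A q" if "A \<in> sets borel" for A
    unfolding set_integrable_def using integrable_mult_indicator[OF _ q, of A] that by simp
  have M: "M \<ge> 0" using bd[of 0] by (auto intro: order_trans[OF abs_ge_zero])
  have "(\<integral>u. q u \<partial>lborel) = (LINT u:{-U..U} \<union> {u. \<bar>u\<bar> > U}|lborel. q u)"
    unfolding set_lebesgue_integral_def by (intro Bochner_Integration.integral_cong refl) (auto simp: indicator_def)
  also have "\<dots> = (LINT u:{-U..U}|lborel. q u) + (LINT u:{u. \<bar>u\<bar> > U}|lborel. q u)"
    by (rule set_integral_Un) (auto intro!: si)
  finally have "\<bar>(\<integral>u. q u \<partial>lborel) - (LINT u:{-U..U}|lborel. q u)\<bar> = \<bar>LINT u:{u. \<bar>u\<bar> > U}|lborel. q u\<bar>" by simp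
  also have "\<dots> \<le> (LINT u:{u. \<bar>u\<bar> > U}|lborel. M * exp (- u\<^sup>2 / (2 * \<tau>\<^sup>2)))"
    unfolding set_lebesgue_integral_def
  proof (rule integral_abs_bound_integral)
    show "integrable lborel (\<lambda>u. indicat_real {u. U < \<bar>u\<bar>} u *\<^sub>R q u)"
      using si[of "{u. U < \<bar>u\<bar>}"] unfolding set_integrable_def by simp
    show "integrable lborel (\<lambda>u. indicat_real {u. U < \<bar>u\<bar>} u *\<^sub>R (M * exp (- u\<^sup>2 / (2 * \<tau>\<^sup>2))))"
      using set_integrable_mult_right[OF gaussian_tail(1)[OF assms(2,3)], of M] unfolding set_integrable_def by auto
  qed (use bd in \<open>auto simp: indicator_def\<close>)
  also have "\<dots> = M * (LINT u:{u. \<bar>u\<bar> > U}|lborel. exp (- u\<^sup>2 / (2 * \<tau>\<^sup>2)))" by simp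
  also have "\<dots> \<le> M * (4 * \<tau> * exp (- U\<^sup>2 / (4 * \<tau>\<^sup>2)))"
    using M by (intro mult_left_mono gaussian_tail(2) assms)
  finally show ?thesis .
qed

text \<open>Modulation by \<open>cos (\<omega> u)\<close> adds Gaussian windows around \<open>\<omega>\<close> and \<open>- \<omega>\<close> to the one around \<open>0\<close>, with a sign
that can be chosen freely through \<open>e\<close>.\<close>

lemma modulated_kernel_fourier:
  fixes \<omega> y t e :: real
  shows "has_bochner_integral lborel (\<lambda>u. cos ((t + u) * y) * (exp (- u\<^sup>2 / 2) * (1 + e * cos (\<omega> * u))))
           (sqrt (2 * pi) * cos (t * y) * (exp (- y\<^sup>2 / 2) + e / 2 * (exp (- (y - \<omega>)\<^sup>2 / 2) + exp (- (y + \<omega>)\<^sup>2 / 2))))"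
proof -
  define E where "E = (\<lambda>y u. of_real (exp (- u\<^sup>2 / 2)) * cis (u * y))"
  have E: "has_bochner_integral lborel (E y) (of_real (sqrt (2 * pi) * exp (- y\<^sup>2 / 2)))" for y
    using gaussian_fourier[of 1 y] by (simp add: E_def[abs_def] has_bochner_integral_iff)
  have "has_bochner_integral lborel (\<lambda>u. Re (cis (t * y) * (E y u + of_real (e / 2) * (E (y - \<omega>) u + E (y + \<omega>) u))))
     (Re (cis (t * y) * (of_real (sqrt (2 * pi) * exp (- y\<^sup>2 / 2)) +
        of_real (e / 2) * (of_real (sqrt (2 * pi) * exp (- (y - \<omega>)\<^sup>2 / 2)) + of_real (sqrt (2 * pi) * exp (- (y + \<omega>)\<^sup>2 / 2))))))"
    by (intro has_bochner_integral_Re has_bochner_integral_mult_right has_bochner_integral_add E)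
  also have "(\<lambda>u. Re (cis (t * y) * (E y u + of_real (e / 2) * (E (y - \<omega>) u + E (y + \<omega>) u)))) =
      (\<lambda>u. cos ((t + u) * y) * (exp (- u\<^sup>2 / 2) * (1 + e * cos (\<omega> * u))))"
  proof
    fix u
    have "E (y - \<omega>) u + E (y + \<omega>) u = E y u * of_real (2 * cos (\<omega> * u))"
    proof -
      have c: "cis (u * (y - \<omega>)) = cis (u * y) * cis (- (\<omega> * u))" "cis (u * (y + \<omega>)) = cis (u * y) * cis (\<omega> * u)"
        by (simp_all add: cis_mult algebra_simps)
      have "cis (- (\<omega> * u)) + cis (\<omega> * u) = of_real (2 * cos (\<omega> * u))" by (simp add: complex_eq_iff)
      moreover have "E (y - \<omega>) u + E (y + \<omega>) u = E y u * (cis (- (\<omega> * u)) + cis (\<omega> * u))"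
        unfolding E_def c by (simp only: distrib_left mult.assoc)
      ultimately show ?thesis by simp
    qed
    hence "cis (t * y) * (E y u + of_real (e / 2) * (E (y - \<omega>) u + E (y + \<omega>) u)) =
        of_real (exp (- u\<^sup>2 / 2) * (1 + e * cos (\<omega> * u))) * cis ((t + u) * y)"
      by (simp add: E_def distrib_right cis_mult[symmetric] algebra_simps)
    thus "Re (cis (t * y) * (E y u + of_real (e / 2) * (E (y - \<omega>) u + E (y + \<omega>) u))) =
       cos ((t + u) * y) * (exp (- u\<^sup>2 / 2) * (1 + e * cos (\<omega> * u)))"
      by (simp add: mult_ac)
  qed
  also have "(Re (cis (t * y) * (of_real (sqrt (2 * pi) * exp (- y\<^sup>2 / 2)) +
        of_real (e / 2) * (of_real (sqrt (2 * pi) * exp (- (y - \<omega>)\<^sup>2 / 2)) + of_real (sqrt (2 * pi) * exp (- (y + \<omega>)\<^sup>2 / 2))))))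
     = sqrt (2 * pi) * cos (t * y) * (exp (- y\<^sup>2 / 2) + e / 2 * (exp (- (y - \<omega>)\<^sup>2 / 2) + exp (- (y + \<omega>)\<^sup>2 / 2)))"
    by (simp add: algebra_simps)
  finally show ?thesis .
qed

section \<open>Smoothing the derivative of zeta into a positive Dirichlet polynomial\<close>

definition zeta_deriv_partial :: "nat \<Rightarrow> nat \<Rightarrow> complex \<Rightarrow> complex" where
  "zeta_deriv_partial l X z = (\<Sum>n<X. of_real ((- ln (real (Suc n))) ^ l) * of_nat (Suc n) powr (-z))"

text \<open>The entire function whose values on the imaginary axis are the smoothing kernel
\<open>exp (- u\<^sup>2 / 2) (1 + e cos (\<omega> u))\<close>.\<close>

definition modulated_gaussian :: "real \<Rightarrow> real \<Rightarrow> complex \<Rightarrow> complex" where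
  "modulated_gaussian e \<omega> w = exp (w\<^sup>2 / 2) * (1 + of_real e * (exp (of_real \<omega> * w) + exp (- (of_real \<omega> * w))) / 2)"

lemma modulated_gaussian_imaginary:
  "modulated_gaussian e \<omega> (Complex 0 u) = of_real (exp (- u\<^sup>2 / 2) * (1 + e * cos (\<omega> * u)))"
proof -
  have "exp (of_real \<omega> * Complex 0 u) + exp (- (of_real \<omega> * Complex 0 u)) = 2 * of_real (cos (\<omega> * u))"
    by (simp add: complex_eq_iff Re_exp Im_exp)
  moreover have "exp ((Complex 0 u)\<^sup>2 / 2) = of_real (exp (- u\<^sup>2 / 2))"
    by (simp add: complex_eq_iff Re_exp Im_exp power2_eq_square Re_divide_numeral Im_divide_numeral)
  ultimately show ?thesis unfolding modulated_gaussian_def by simp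
qed

lemma norm_modulated_gaussian:
  assumes "\<bar>e\<bar> \<le> 1" "\<omega> \<ge> 0" "0 \<le> x" "x \<le> 3/2"
  shows "norm (modulated_gaussian e \<omega> (Complex x y)) \<le> 8 * exp (3/2 * \<omega>) * exp (- y\<^sup>2 / 2)"
proof -
  have 1: "norm (exp ((Complex x y)\<^sup>2 / 2)) \<le> 4 * exp (- y\<^sup>2 / 2)"
  proof -
    have "norm (exp ((Complex x y)\<^sup>2 / 2)) = exp (x\<^sup>2 / 2) * exp (- y\<^sup>2 / 2)"
      by (simp add: norm_exp_eq_Re exp_add[symmetric] power2_eq_square Re_divide_numeral diff_divide_distrib)
    also have "exp (x\<^sup>2 / 2) \<le> (4::real)"
    proof -
      have "x\<^sup>2 \<le> (3/2)\<^sup>2" using assms by (intro power_mono) auto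
      hence "exp (x\<^sup>2 / 2) \<le> exp (9/8)" by (simp add: power2_eq_square)
      also have "exp (9/8::real) \<le> exp (5/4)" by simp
      also have "exp (5/4::real) = exp (1/4) * exp 1" by (simp add: exp_add[symmetric])
      also have "exp (1/4::real) \<le> 1 + 1/4 + (1/4)\<^sup>2" by (rule exp_bound) auto
      also have "(1 + 1/4 + (1/4)\<^sup>2) * exp 1 \<le> (1 + 1/4 + (1/4)\<^sup>2) * (3::real)"
        by (intro mult_left_mono exp_le) auto
      also have "\<dots> \<le> 4" by (simp add: power2_eq_square)
      finally show ?thesis by simp
    qed
    finally show ?thesis by simp
  qed
  have e1: "exp (\<omega> * x) \<le> exp (3/2 * \<omega>)" "exp (- (\<omega> * x)) \<le> exp (3/2 * \<omega>)"
  proof -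
    have "\<omega> * x \<le> \<omega> * (3/2)" using assms by (intro mult_left_mono) auto
    thus "exp (\<omega> * x) \<le> exp (3/2 * \<omega>)" by (simp add: mult.commute)
    have "0 \<le> \<omega> * x" using assms by simp
    hence "- (\<omega> * x) \<le> 3/2 * \<omega>" using assms by linarith
    thus "exp (- (\<omega> * x)) \<le> exp (3/2 * \<omega>)" by (simp only: exp_le_cancel_iff)
  qed
  have tri: "norm (1 + of_real e * (a + b) / 2) \<le> 1 + \<bar>e\<bar> * (norm a + norm b) / 2" for a b :: complex
  proof -
    have "norm (1 + of_real e * (a + b) / 2) \<le> norm (1::complex) + norm (of_real e * (a + b) / 2)"
      by (rule norm_triangle_ineq)
    also have "\<dots> = 1 + \<bar>e\<bar> * norm (a + b) / 2" by (simp add: norm_mult norm_divide)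
    also have "\<dots> \<le> 1 + \<bar>e\<bar> * (norm a + norm b) / 2"
      by (intro add_left_mono divide_right_mono mult_left_mono norm_triangle_ineq) auto
    finally show ?thesis .
  qed
  have "norm (1 + of_real e * (exp (of_real \<omega> * Complex x y) + exp (- (of_real \<omega> * Complex x y))) / 2)
      \<le> 1 + \<bar>e\<bar> * (norm (exp (of_real \<omega> * Complex x y)) + norm (exp (- (of_real \<omega> * Complex x y)))) / 2"
    by (rule tri)
  also have "\<dots> \<le> 1 + 1 * (exp (3/2 * \<omega>) + exp (3/2 * \<omega>)) / 2"
    using e1 assms by (intro add_left_mono divide_right_mono mult_mono add_mono) (auto simp: norm_exp_eq_Re)
  also have "\<dots> \<le> 2 * exp (3/2 * \<omega>)" using assms by simp
  finally have 2: "norm (1 + of_real e * (exp (of_real \<omega> * Complex x y) + exp (- (of_real \<omega> * Complex x y))) / 2) \<le> 2 * exp (3/2 * \<omega>)" .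
  have "norm (modulated_gaussian e \<omega> (Complex x y)) \<le> (4 * exp (- y\<^sup>2 / 2)) * (2 * exp (3/2 * \<omega>))"
    unfolding modulated_gaussian_def norm_mult by (intro mult_mono 1 2) auto
  thus ?thesis by (simp add: mult_ac)
qed

lemma norm_zeta_deriv_partial:
  "\<exists>K>0. \<forall>X z. Re z \<ge> 1/2 \<longrightarrow> norm (zeta_deriv_partial l X z) \<le> K * real X"
proof -
  obtain K :: real where K: "K > 0" "\<And>x. x \<ge> 1 \<Longrightarrow> ln x ^ l \<le> K * x powr (1/2)"
    using ln_power_le_powr[of "1/2" l] by auto
  have "norm (zeta_deriv_partial l X z) \<le> K * real X" if "Re z \<ge> 1/2" for X z
  proof -
    have "norm (zeta_deriv_partial l X z) \<le> (\<Sum>n<X. K)"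
      unfolding zeta_deriv_partial_def
    proof (rule sum_norm_le)
      fix n
      have "norm (of_real ((- ln (real (Suc n))) ^ l) * of_nat (Suc n) powr (-z) :: complex) = ln (real (Suc n)) ^ l * real (Suc n) powr (- Re z)"
        unfolding norm_mult norm_of_nat_powr by (simp add: norm_power del: of_nat_Suc)
      also have "\<dots> \<le> (K * real (Suc n) powr (1/2)) * real (Suc n) powr (-1/2)"
        using that K(1) by (intro mult_mono K powr_mono) auto
      also have "\<dots> = K * real (Suc n) powr (1/2 + (-1/2))" by (simp only: mult.assoc powr_add)
      finally show "norm (of_real ((- ln (real (Suc n))) ^ l) * of_nat (Suc n) powr (-z) :: complex) \<le> K" by simp
    qed
    thus ?thesis by (simp add: mult.commute)
  qed
  thus ?thesis using K(1) by blast
qed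

lemma zeta_deriv_partial_holomorphic: "zeta_deriv_partial l X holomorphic_on A"
  unfolding zeta_deriv_partial_def[abs_def] by (intro holomorphic_intros)

lemma Re_zeta_deriv_partial:
  "Re (zeta_deriv_partial l X (Complex \<sigma> v)) = (-1) ^ l *
     (\<Sum>n<X. ln (real (Suc n)) ^ l * real (Suc n) powr (-\<sigma>) * cos (v * ln (real (Suc n))))"
proof -
  have "Re (of_real ((- ln (real (Suc n))) ^ l) * of_nat (Suc n) powr (- Complex \<sigma> v)) =
     (-1) ^ l * (ln (real (Suc n)) ^ l * real (Suc n) powr (-\<sigma>) * cos (v * ln (real (Suc n))))" for n
  proof -
    have L: "Ln (of_nat (Suc n)) = of_real (ln (real (Suc n)))"
      by (metis Ln_of_real of_nat_0_less_iff of_real_of_nat_eq zero_less_Suc)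
    have "of_nat (Suc n) powr (- Complex \<sigma> v) = exp (- Complex \<sigma> v * of_real (ln (real (Suc n))))"
      unfolding powr_def L by (simp del: of_nat_Suc)
    hence "Re (of_nat (Suc n) powr (- Complex \<sigma> v)) = exp (- \<sigma> * ln (real (Suc n))) * cos (v * ln (real (Suc n)))"
      by (simp add: Re_exp del: of_nat_Suc)
    also have "exp (- \<sigma> * ln (real (Suc n))) = real (Suc n) powr (-\<sigma>)"
      unfolding powr_def by (simp del: of_nat_Suc)
    finally have "Re (of_nat (Suc n) powr (- Complex \<sigma> v)) = real (Suc n) powr (-\<sigma>) * cos (v * ln (real (Suc n)))" .
    moreover have "Re (of_real a * z) = a * Re z" for a z by simp
    moreover have "(- ln (real (Suc n))) ^ l = (-1) ^ l * ln (real (Suc n)) ^ l" by (rule power_minus)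
    ultimately show ?thesis by (simp only: mult.assoc)
  qed
  thus ?thesis unfolding zeta_deriv_partial_def by (simp add: sum_distrib_left del: of_nat_Suc)
qed

text \<open>The index \<open>n\<close> belongs to the integer \<open>n + 1\<close>.\<close>

definition window_coeff :: "nat \<Rightarrow> real \<Rightarrow> real \<Rightarrow> nat \<Rightarrow> real" where
  "window_coeff l \<sigma> \<omega> n = ln (real (Suc n)) ^ l * real (Suc n) powr (-\<sigma>) * exp (- (ln (real (Suc n)) - \<omega>)\<^sup>2 / 2)"

definition line_bound :: "nat \<Rightarrow> real \<Rightarrow> real \<Rightarrow> real \<Rightarrow> bool" where
  "line_bound l T \<sigma> S \<longleftrightarrow> 0 \<le> S \<and> (\<forall>y\<in>{sqrt T..T}. Re ((deriv ^^ l) zeta (Complex \<sigma> y)) \<le> S)"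

lemma window_coeff_nonneg: "0 \<le> window_coeff l \<sigma> \<omega> n"
  by (simp add: window_coeff_def)

text \<open>By the inequality \<open>- x\<^sup>2 / 2 \<le> 2 - 2 x\<close> the window is dominated by \<open>(n + 1)^(-2)\<close>.\<close>

lemma window_coeff_le:
  "\<exists>K>0. \<forall>\<sigma> \<omega> n. 1/2 \<le> \<sigma> \<longrightarrow> window_coeff l \<sigma> \<omega> n \<le> K * real (Suc n) powr (-2) * exp (2 * \<omega>)"
proof -
  obtain K :: real where K: "K > 0" "\<And>x. x \<ge> 1 \<Longrightarrow> ln x ^ l \<le> K * x powr (1/2)"
    using ln_power_le_powr[of "1/2" l] by auto
  have "window_coeff l \<sigma> \<omega> n \<le> K * exp 2 * real (Suc n) powr (-2) * exp (2 * \<omega>)" if "1/2 \<le> \<sigma>" for \<sigma> \<omega> n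
  proof -
    have parab: "- x\<^sup>2 / 2 \<le> 2 - 2 * x" for x :: real
    proof -
      have "0 \<le> (x - 2)\<^sup>2" by simp
      also have "(x - 2)\<^sup>2 = x\<^sup>2 - 4 * x + 4" by (simp add: power2_eq_square algebra_simps)
      finally show ?thesis by simp
    qed
    have "window_coeff l \<sigma> \<omega> n \<le>
        (K * real (Suc n) powr (1/2)) * real (Suc n) powr (-1/2) * exp (2 + (-2) * ln (real (Suc n)) + 2 * \<omega>)"
      unfolding window_coeff_def
    proof (intro mult_mono)
      show "ln (real (Suc n)) ^ l \<le> K * real (Suc n) powr (1/2)" by (intro K(2)) auto
      show "real (Suc n) powr (-\<sigma>) \<le> real (Suc n) powr (-1/2)" using that by (intro powr_mono) auto
      show "exp (- (ln (real (Suc n)) - \<omega>)\<^sup>2 / 2) \<le> exp (2 + (-2) * ln (real (Suc n)) + 2 * \<omega>)"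
        using parab[of "ln (real (Suc n)) - \<omega>"] by simp
    qed (use K(1) in auto)
    also have "\<dots> = K * exp 2 * real (Suc n) powr (1/2 + (-1/2)) * exp ((-2) * ln (real (Suc n))) * exp (2 * \<omega>)"
      by (simp only: powr_add exp_add mult_ac)
    also have "exp ((-2) * ln (real (Suc n))) = real (Suc n) powr (-2)" by (simp add: powr_def)
    finally show ?thesis by simp
  qed
  thus ?thesis using K(1) by (intro exI[of _ "K * exp 2"]) auto
qed

text \<open>The difference of \<open>\<zeta>^(l)\<close> and its partial sum of length about \<open>T\<^sup>2\<close>, multiplied by the kernel centred at
\<open>s = \<sigma> + i t\<close>, is integrated over a rectangle between the lines \<open>Re = \<sigma>\<close> and \<open>Re = 2\<close>. On the horizontal
sides the Gaussian factor is tiny, and on \<open>Re = 2\<close> the difference is. So on the line \<open>Re = \<sigma>\<close> the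
function \<open>\<zeta>^(l)\<close> may be replaced by a finite sum, although the Dirichlet series diverges there. In
the convolution of this sum with the kernel the window around \<open>\<omega>\<close> gives the left-hand side of the
claim; the windows around \<open>0\<close> and \<open>- \<omega>\<close> contribute at most an absolutely convergent sum.\<close>

lemma smoothing:
  "\<exists>C>0. \<forall>\<^sub>F T in at_top. \<forall>\<sigma> \<omega> t S. \<sigma> \<in> {1/2..1} \<longrightarrow> \<omega> \<in> {0..ln T / 100} \<longrightarrow>
     t \<in> {2 * sqrt T..T / 2} \<longrightarrow> line_bound l T \<sigma> S \<longrightarrow>
     (\<Sum>n<nat \<lceil>T\<^sup>2\<rceil>. window_coeff l \<sigma> \<omega> n * cos (t * ln (real (Suc n)))) \<le> C * (S + 1)"
  (is "\<exists>C>0. \<forall>\<^sub>F T in at_top. ?Q C T")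
proof -
  obtain C1 where C1: "C1 > 0" "\<And>s. Re s \<ge> 1/2 \<Longrightarrow> Im s \<ge> 2 \<Longrightarrow> norm ((deriv ^^ l) zeta s) \<le> C1 * norm s"
    using zeta_deriv_linear_growth by blast
  obtain C2 where C2: "C2 > 0" "\<And>X z. X \<ge> 1 \<Longrightarrow> Re z = 2 \<Longrightarrow>
     norm ((deriv ^^ l) zeta z - zeta_deriv_partial l X z) \<le> C2 * real X powr (-1/2)"
    using zeta_deriv_tail[of l] unfolding zeta_deriv_partial_def by blast
  obtain K where K: "K > 0" "\<And>X z. Re z \<ge> 1/2 \<Longrightarrow> norm (zeta_deriv_partial l X z) \<le> K * real X"
    using norm_zeta_deriv_partial by blast
  obtain K' where K': "K' > 0" "\<And>\<sigma> \<omega> n. 1/2 \<le> \<sigma> \<Longrightarrow>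
     window_coeff l \<sigma> \<omega> n \<le> K' * real (Suc n) powr (-2) * exp (2 * \<omega>)"
    using window_coeff_le[of l] by blast
  define C3 where "C3 = (\<Sum>n. K' * real (Suc n) powr (-2))"
  have sm3: "summable (\<lambda>n. K' * real (Suc n) powr (-2))" by (intro summable_mult summable_Suc_powr) auto
  have C3: "C3 > 0" unfolding C3_def using sm3 K'(1) by (intro suminf_pos) auto
  define C where "C = 12 + 4 * C3"
  have ev1: "\<forall>\<^sub>F T in at_top. 3 * ((C1 * (2 * T) + K * (2 * T\<^sup>2)) * (8 * T powr (1/50) * exp (- T / 2)))
      + C2 * T powr -1 * (8 * T powr (1/50)) * (2 * sqrt T) \<le> 1" using C1(1) C2(1) K(1) by real_asymp
  have ev2: "\<forall>\<^sub>F T in at_top. K * (2 * T\<^sup>2) * 2 * (4 * exp (- T / 4)) \<le> 1" using K(1) by real_asymp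
  have ev3: "\<forall>\<^sub>F T::real in at_top. T \<ge> 16" by (rule eventually_ge_at_top)
  show ?thesis
  proof (intro exI[of _ C] conjI)
    show "C > 0" using C3 by (simp add: C_def)
    show "\<forall>\<^sub>F T in at_top. ?Q C T"
      using ev1 ev2 ev3
    proof eventually_elim
      case (elim T)
      show ?case
      proof (intro allI impI)
        fix \<sigma> \<omega> t S :: real
        assume "\<sigma> \<in> {1/2..1}" "\<omega> \<in> {0..ln T / 100}" "t \<in> {2 * sqrt T..T / 2}" "line_bound l T \<sigma> S"
        hence \<sigma>: "1/2 \<le> \<sigma>" "\<sigma> \<le> 1" and \<omega>: "0 \<le> \<omega>" "\<omega> \<le> ln T / 100" and t: "2 * sqrt T \<le> t" "t \<le> T / 2"
          and S: "0 \<le> S" and bound: "\<forall>y\<in>{sqrt T..T}. Re ((deriv ^^ l) zeta (Complex \<sigma> y)) \<le> S"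
          by (auto simp: line_bound_def)
        define X where "X = nat \<lceil>T\<^sup>2\<rceil>"
        define U where "U = sqrt T"
        define e :: real where "e = (-1) ^ l"
        define s where "s = Complex \<sigma> t"
        define D where "D = (\<lambda>z. (deriv ^^ l) zeta z - zeta_deriv_partial l X z)"
        define H where "H = (\<lambda>w. D (s + w) * modulated_gaussian e \<omega> w)"
        define k where "k = (\<lambda>u. exp (- u\<^sup>2 / 2) * (1 + e * cos (\<omega> * u)))"
        define P where "P = (\<lambda>u. Re (zeta_deriv_partial l X (Complex \<sigma> (t + u))))"
        have T: "T \<ge> 16" by fact
        have U: "U \<ge> 4" "U\<^sup>2 = T" "U \<le> T / 4"
        proof -
          show "U \<ge> 4" unfolding U_def using T by (simp add: real_le_rsqrt)
          show "U\<^sup>2 = T" unfolding U_def using T by simp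
          have "4 * U \<le> U * U" using \<open>U \<ge> 4\<close> by (intro mult_right_mono) auto
          thus "U \<le> T / 4" using \<open>U\<^sup>2 = T\<close> by (simp add: power2_eq_square)
        qed
        have X: "T\<^sup>2 \<le> real X" "real X \<le> 2 * T\<^sup>2" "X \<ge> 1"
        proof -
          have "T\<^sup>2 \<ge> 1" using T by (simp add: one_le_power)
          thus "T\<^sup>2 \<le> real X" "real X \<le> 2 * T\<^sup>2" "X \<ge> 1" unfolding X_def by linarith+
        qed
        have e: "e = 1 \<or> e = -1" unfolding e_def by (cases "even l") auto
        hence e': "\<bar>e\<bar> \<le> 1" "e * e = 1" by auto
        have Tw: "exp (3/2 * \<omega>) \<le> T powr (1/50)"
        proof -
          have "3/2 * \<omega> \<le> 1/50 * ln T" using \<omega> T by simp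
          thus ?thesis using T by (simp add: powr_def)
        qed
        have osc: "0 \<le> 1 + e * cos (\<omega> * u)" "1 + e * cos (\<omega> * u) \<le> 2" for u
        proof -
          have "e * cos (\<omega> * u) = cos (\<omega> * u) \<or> e * cos (\<omega> * u) = - cos (\<omega> * u)" using e by auto
          thus "0 \<le> 1 + e * cos (\<omega> * u)" "1 + e * cos (\<omega> * u) \<le> 2"
            using cos_le_one[of "\<omega> * u"] cos_ge_minus_one[of "\<omega> * u"] by linarith+
        qed
        have kpos: "k u \<ge> 0" for u
          unfolding k_def using osc[of u] by (intro mult_nonneg_nonneg) auto
        have kle: "k u \<le> 2 * exp (- u\<^sup>2 / 2)" for u
          unfolding k_def using mult_left_mono[OF osc(2)[of u], of "exp (- u\<^sup>2 / 2)"] by simp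

        \<comment> \<open>The vertical sides have half-length \<open>\<surd>T\<close>: the rectangle stays above the pole at \<open>1\<close>, and its left
          side stays in the range where \<open>Re \<zeta>^(l) \<le> S\<close> is known.\<close>
        have Dnorm: "norm (D (s + Complex x y)) \<le> C1 * (2 * T) + K * (2 * T\<^sup>2)" if "0 \<le> x" "x \<le> 2 - \<sigma>" "\<bar>y\<bar> \<le> U" for x y
        proof -
          have im: "Im (s + Complex x y) \<ge> 2" "Im (s + Complex x y) \<le> T"
            using that t U by (auto simp: s_def U_def)
          have re: "Re (s + Complex x y) \<ge> 1/2" "Re (s + Complex x y) \<le> 2" using that \<sigma> by (auto simp: s_def)
          have "norm (s + Complex x y) \<le> \<bar>Re (s + Complex x y)\<bar> + \<bar>Im (s + Complex x y)\<bar>" by (rule cmod_le)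
          also have "\<dots> \<le> 2 * T" using im re T by linarith
          finally have n: "norm (s + Complex x y) \<le> 2 * T" .
          have "norm (D (s + Complex x y)) \<le> norm ((deriv ^^ l) zeta (s + Complex x y)) + norm (zeta_deriv_partial l X (s + Complex x y))"
            unfolding D_def by (rule norm_triangle_ineq4)
          also have "\<dots> \<le> C1 * norm (s + Complex x y) + K * real X"
            using re im by (intro add_mono C1(2) K(2))
          also have "\<dots> \<le> C1 * (2 * T) + K * (2 * T\<^sup>2)"
            using n X(2) C1(1) K(1) by (intro add_mono mult_left_mono) auto
          finally show ?thesis .
        qed
        have Hhol: "H holomorphic_on cbox (Complex 0 (-U)) (Complex (2 - \<sigma>) U)"
        proof -
          have "(\<lambda>w. (deriv ^^ l) zeta (s + w)) holomorphic_on cbox (Complex 0 (-U)) (Complex (2 - \<sigma>) U)"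
          proof (rule holomorphic_on_compose_gen[of "\<lambda>w. s + w" _ "(deriv ^^ l) zeta", unfolded o_def, OF _ zeta_derivs_holomorphic])
            show "(+) s ` cbox (Complex 0 (- U)) (Complex (2 - \<sigma>) U) \<subseteq> - {1}"
            proof safe
              fix w assume "w \<in> cbox (Complex 0 (- U)) (Complex (2 - \<sigma>) U)" "s + w = 1"
              hence "Im w \<ge> - U" "t + Im w = 0" by (auto simp: in_cbox_complex_iff s_def complex_eq_iff)
              thus False using t U by (auto simp: U_def)
            qed
          qed (intro holomorphic_intros)
          moreover have "(\<lambda>w. zeta_deriv_partial l X (s + w)) holomorphic_on cbox (Complex 0 (-U)) (Complex (2 - \<sigma>) U)"
            by (rule holomorphic_on_compose_gen[of "\<lambda>w. s + w" _ "zeta_deriv_partial l X", unfolded o_def, OF _ zeta_deriv_partial_holomorphic[of l X UNIV]])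
               (auto intro!: holomorphic_intros)
          ultimately show ?thesis
            unfolding H_def D_def modulated_gaussian_def by (intro holomorphic_intros) auto
        qed
        have hor: "norm (H (Complex x y)) \<le> (C1 * (2 * T) + K * (2 * T\<^sup>2)) * (8 * T powr (1/50) * exp (- T / 2))"
          if "x \<in> {0..2 - \<sigma>}" "\<bar>y\<bar> = U" for x y
        proof -
          have "y\<^sup>2 = T" using that(2) U(2) by (metis power2_abs)
          have "norm (modulated_gaussian e \<omega> (Complex x y)) \<le> 8 * exp (3/2 * \<omega>) * exp (- y\<^sup>2 / 2)"
            using that \<sigma> e' \<omega> by (intro norm_modulated_gaussian) auto
          also have "\<dots> \<le> 8 * T powr (1/50) * exp (- T / 2)"
            unfolding \<open>y\<^sup>2 = T\<close> using Tw by (intro mult_mono) auto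
          finally show ?thesis
            unfolding H_def norm_mult using that C1(1) K(1) T by (intro mult_mono Dnorm) auto
        qed
        have vert: "norm (H (Complex (2 - \<sigma>) y)) \<le> C2 * T powr -1 * (8 * T powr (1/50))" if "y \<in> {-U..U}" for y
        proof -
          have "norm (modulated_gaussian e \<omega> (Complex (2 - \<sigma>) y)) \<le> 8 * exp (3/2 * \<omega>) * exp (- y\<^sup>2 / 2)"
            using that \<sigma> e' \<omega> by (intro norm_modulated_gaussian) auto
          also have "\<dots> \<le> 8 * T powr (1/50) * 1"
            using Tw by (intro mult_mono) auto
          finally have 1: "norm (modulated_gaussian e \<omega> (Complex (2 - \<sigma>) y)) \<le> 8 * T powr (1/50)" by simp
          have "norm (D (s + Complex (2 - \<sigma>) y)) \<le> C2 * real X powr (-1/2)"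
            unfolding D_def using X by (intro C2(2)) (auto simp: s_def)
          also have "\<dots> \<le> C2 * (T\<^sup>2) powr (-1/2)"
            using C2(1) X T by (intro mult_left_mono powr_mono2') auto
          also have "(T\<^sup>2) powr (-1/2) = T powr -1" using T by (simp add: powr_powr flip: powr_numeral)
          finally show ?thesis unfolding H_def norm_mult using 1 C2(1) by (intro mult_mono) auto
        qed
        have "norm (integral {-U..U} (\<lambda>y. H (Complex 0 y))) \<le>
            2 * ((C1 * (2 * T) + K * (2 * T\<^sup>2)) * (8 * T powr (1/50) * exp (- T / 2))) * (2 - \<sigma> - 0) +
            C2 * T powr -1 * (8 * T powr (1/50)) * (U - (- U))"
          using \<sigma> U by (intro left_edge_bound[OF _ _ Hhol] hor vert) auto
        also have "\<dots> \<le> 2 * ((C1 * (2 * T) + K * (2 * T\<^sup>2)) * (8 * T powr (1/50) * exp (- T / 2))) * (3/2) +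
            C2 * T powr -1 * (8 * T powr (1/50)) * (U - (- U))"
          using \<sigma> C1(1) K(1) T by (intro add_right_mono mult_left_mono) auto
        also have "\<dots> \<le> 1" using elim(1) unfolding U_def by (simp add: algebra_simps)
        finally have "norm (integral {-U..U} (\<lambda>y. H (Complex 0 y))) \<le> 1" .
        hence shift: "Re (integral {-U..U} (\<lambda>y. H (Complex 0 y))) \<ge> - 1"
          using abs_Re_le_cmod[of "integral {-U..U} (\<lambda>y. H (Complex 0 y))"] by linarith

        \<comment> \<open>On the left side the kernel is real and nonnegative, so the bound on \<open>Re \<zeta>^(l)\<close> can be integrated.\<close>
        have contH: "continuous_on {-U..U} (\<lambda>y. H (Complex 0 y))"
          by (rule continuous_on_compose2[OF holomorphic_on_imp_continuous_on[OF Hhol]])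
             (use \<sigma> U in \<open>auto intro!: continuous_intros simp: in_cbox_complex_iff complex_eq_iff continuous_on_Complex\<close>)
        have ReH: "Re (H (Complex 0 y)) = (Re ((deriv ^^ l) zeta (Complex \<sigma> (t + y))) - P y) * k y" for y
        proof -
          have "s + Complex 0 y = Complex \<sigma> (t + y)" by (simp add: s_def complex_eq_iff)
          thus ?thesis by (simp add: H_def D_def P_def k_def modulated_gaussian_imaginary)
        qed
        have "Re (integral {-U..U} (\<lambda>y. H (Complex 0 y))) = integral {-U..U} (\<lambda>y. Re (H (Complex 0 y)))"
          using integral_linear[OF integrable_continuous_interval[OF contH] bounded_linear_Re] by (simp add: o_def)
        also have "\<dots> = (LINT y:{-U..U}|lborel. Re (H (Complex 0 y)))"
          by (rule set_borel_integral_eq_integral(2)[symmetric], rule borel_integrable_atLeastAtMost')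
             (intro continuous_intros contH)
        finally have ReI: "(LINT y:{-U..U}|lborel. Re (H (Complex 0 y))) \<ge> - 1" using shift by simp

        have Pint: "has_bochner_integral lborel (\<lambda>u. P u * k u) (e * (\<Sum>n<X. ln (real (Suc n)) ^ l * real (Suc n) powr (-\<sigma>) *
            (sqrt (2 * pi) * cos (t * ln (real (Suc n))) * (exp (- (ln (real (Suc n)))\<^sup>2 / 2) + e / 2 * (exp (- (ln (real (Suc n)) - \<omega>)\<^sup>2 / 2) + exp (- (ln (real (Suc n)) + \<omega>)\<^sup>2 / 2))))))"
        proof -
          have eq: "P u * k u = e * (\<Sum>n<X. ln (real (Suc n)) ^ l * real (Suc n) powr (-\<sigma>) *
              (cos ((t + u) * ln (real (Suc n))) * (exp (- u\<^sup>2 / 2) * (1 + e * cos (\<omega> * u)))))" for u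
            unfolding P_def Re_zeta_deriv_partial e_def k_def by (simp only: sum_distrib_left sum_distrib_right mult_ac)
          show ?thesis unfolding eq
            by (intro has_bochner_integral_mult_right has_bochner_integral_sum modulated_kernel_fourier)
        qed
        have Pbd: "\<bar>P u * k u\<bar> \<le> (K * (2 * T\<^sup>2) * 2) * exp (- u\<^sup>2 / (2 * 1\<^sup>2))" for u
        proof -
          have "\<bar>P u\<bar> \<le> norm (zeta_deriv_partial l X (Complex \<sigma> (t + u)))" unfolding P_def by (rule abs_Re_le_cmod)
          also have "\<dots> \<le> K * real X" using \<sigma> by (intro K(2)) auto
          also have "\<dots> \<le> K * (2 * T\<^sup>2)" using X K(1) by (intro mult_left_mono) auto
          finally have "\<bar>P u\<bar> * k u \<le> (K * (2 * T\<^sup>2)) * (2 * exp (- u\<^sup>2 / 2))"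
            using kpos kle K(1) by (intro mult_mono) auto
          thus ?thesis using kpos[of u] by (simp add: abs_mult mult_ac)
        qed
        have "\<bar>(\<integral>u. P u * k u \<partial>lborel) - (LINT u:{-U..U}|lborel. P u * k u)\<bar> \<le> (K * (2 * T\<^sup>2) * 2) * (4 * 1 * exp (- U\<^sup>2 / (4 * 1\<^sup>2)))"
          using Pint U Pbd by (intro gaussian_majorant_split) (auto simp: has_bochner_integral_iff)
        also have "\<dots> \<le> 1" using elim(2) unfolding U(2) by simp
        finally have split: "(\<integral>u. P u * k u \<partial>lborel) \<le> (LINT u:{-U..U}|lborel. P u * k u) + 1" by linarith

        have ik: "integrable lborel (\<lambda>u::real. 2 * exp (- u\<^sup>2 / 2) :: real)" and vk: "(\<integral>u. 2 * exp (- u\<^sup>2 / 2) \<partial>lborel) \<le> (6::real)"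
        proof -
          show "integrable lborel (\<lambda>u::real. 2 * exp (- u\<^sup>2 / 2) :: real)" using gaussian_cos(1)[of 1 0] by simp
          have "(\<integral>u. 2 * exp (- u\<^sup>2 / 2) \<partial>lborel) = 2 * sqrt (2 * pi)" using gaussian_cos[of 1 0] by simp
          also have "sqrt (2 * pi) \<le> sqrt 9" using pi_less_4 by (intro real_sqrt_le_mono) linarith
          finally show "(\<integral>u. 2 * exp (- u\<^sup>2 / 2) \<partial>lborel) \<le> (6::real)" by simp
        qed
        have "(LINT u:{-U..U}|lborel. P u * k u) \<le> 1 + S * 6"
        proof -
          have iPk: "set_integrable lborel {-U..U} (\<lambda>u. P u * k u)"
            unfolding set_integrable_def using Pint by (intro integrable_mult_indicator) (auto simp: has_bochner_integral_iff)
          have iH: "set_integrable lborel {-U..U} (\<lambda>y. Re (H (Complex 0 y)))"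
            by (rule borel_integrable_atLeastAtMost') (intro continuous_intros contH)
          have "(LINT u:{-U..U}|lborel. P u * k u) + (LINT y:{-U..U}|lborel. Re (H (Complex 0 y))) =
            (LINT y:{-U..U}|lborel. P y * k y + Re (H (Complex 0 y)))"
            using iPk iH by (simp add: set_integral_add)
          also have "\<dots> \<le> (\<integral>u. S * (2 * exp (- u\<^sup>2 / 2)) \<partial>lborel)"
            unfolding set_lebesgue_integral_def
          proof (rule integral_mono)
            show "integrable lborel (\<lambda>x. indicat_real {- U..U} x *\<^sub>R (P x * k x + Re (H (Complex 0 x))))"
              using set_integral_add(1)[OF iPk iH] unfolding set_integrable_def .
            show "integrable lborel (\<lambda>u. S * (2 * exp (- u\<^sup>2 / 2)))" using ik by simp
            fix u
            have "P u * k u + Re (H (Complex 0 u)) \<le> S * (2 * exp (- u\<^sup>2 / 2))" if "u \<in> {-U..U}"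
            proof -
              have "t + u \<in> {sqrt T..T}" using that t U(3) unfolding U_def by auto
              hence "Re ((deriv ^^ l) zeta (Complex \<sigma> (t + u))) \<le> S" using bound by blast
              hence "Re ((deriv ^^ l) zeta (Complex \<sigma> (t + u))) * k u \<le> S * k u" using kpos by (intro mult_right_mono)
              also have "\<dots> \<le> S * (2 * exp (- u\<^sup>2 / 2))" using kle S by (intro mult_left_mono)
              finally show ?thesis unfolding ReH by (simp add: algebra_simps)
            qed
            thus "indicat_real {- U..U} u *\<^sub>R (P u * k u + Re (H (Complex 0 u))) \<le> S * (2 * exp (- u\<^sup>2 / 2))"
              using S by (auto simp: indicator_def)
          qed
          also have "\<dots> = S * (\<integral>u. 2 * exp (- u\<^sup>2 / 2) \<partial>lborel)" using ik by simp
          also have "\<dots> \<le> S * 6" using vk S by (intro mult_left_mono)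
          finally show ?thesis using ReI by linarith
        qed
        hence main: "(\<integral>u. P u * k u \<partial>lborel) \<le> 2 + 6 * S" using split by linarith

        define b where "b = (\<lambda>n. ln (real (Suc n)) ^ l * real (Suc n) powr (-\<sigma>))"
        define y where "y = (\<lambda>n. ln (real (Suc n)))"
        define g where "g = (\<lambda>x::real. exp (- x\<^sup>2 / 2))"
        \<comment> \<open>\<open>A h\<close> is the contribution of the window \<open>h\<close> to the convolution.\<close>
        define A where "A = (\<lambda>h. \<Sum>n<X. b n * cos (t * y n) * h (y n))"
        have y0: "y n \<ge> 0" for n by (simp add: y_def)
        have b0: "b n \<ge> 0" for n by (simp add: b_def)
        have "(\<integral>u. P u * k u \<partial>lborel) = e * (\<Sum>n<X. b n * (sqrt (2 * pi) * cos (t * y n) * (g (y n) + e / 2 * (g (y n - \<omega>) + g (y n + \<omega>)))))"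
          using Pint by (simp add: has_bochner_integral_iff b_def y_def g_def)
        also have "\<dots> = sqrt (2 * pi) * (e * A g + e * e / 2 * (A (\<lambda>x. g (x - \<omega>)) + A (\<lambda>x. g (x + \<omega>))))"
          unfolding A_def by (simp add: sum_distrib_left sum.distrib[symmetric] algebra_simps)
        finally have main2: "sqrt (2 * pi) * (e * A g + 1 / 2 * (A (\<lambda>x. g (x - \<omega>)) + A (\<lambda>x. g (x + \<omega>)))) \<le> 2 + 6 * S"
          using main e' by simp
        have q1: "sqrt (2 * pi) \<ge> 1" using pi_ge_two by (simp add: real_le_rsqrt)
        have scale: "x \<le> r" if "q * x \<le> r" "q \<ge> 1" "r \<ge> 0" for q x r :: real
        proof (cases "x \<ge> 0")
          case True
          hence "1 * x \<le> q * x" using that by (intro mult_right_mono)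
          thus ?thesis using that by linarith
        qed (use that in linarith)
        have V: "e * A g + 1 / 2 * (A (\<lambda>x. g (x - \<omega>)) + A (\<lambda>x. g (x + \<omega>))) \<le> 2 + 6 * S"
          by (rule scale[OF main2 q1]) (use S in linarith)
        have Abd: "\<bar>A h\<bar> \<le> C3" if h: "\<And>x. x \<ge> 0 \<Longrightarrow> 0 \<le> h x \<and> h x \<le> g x" for h
        proof -
          have "\<bar>A h\<bar> \<le> (\<Sum>n<X. K' * real (Suc n) powr (-2))"
            unfolding A_def
          proof (rule order_trans[OF sum_abs], rule sum_mono)
            fix n
            have "\<bar>b n * cos (t * y n) * h (y n)\<bar> = b n * \<bar>cos (t * y n)\<bar> * h (y n)"
              using b0 h[OF y0] by (simp add: abs_mult)
            also have "\<dots> \<le> b n * 1 * g (y n)" using b0 h[OF y0] by (intro mult_mono) auto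
            also have "\<dots> = window_coeff l \<sigma> 0 n" by (simp add: b_def g_def y_def window_coeff_def)
            also have "\<dots> \<le> K' * real (Suc n) powr (-2)" using K'(2)[OF \<sigma>(1), of 0 n] by simp
            finally show "\<bar>b n * cos (t * y n) * h (y n)\<bar> \<le> K' * real (Suc n) powr (-2)" .
          qed
          also have "\<dots> \<le> C3" unfolding C3_def using sm3 K'(1) by (intro sum_le_suminf) auto
          finally show ?thesis .
        qed
        have "\<bar>A g\<bar> \<le> C3" by (rule Abd) (auto simp: g_def)
        moreover have "\<bar>A (\<lambda>x. g (x + \<omega>))\<bar> \<le> C3"
          by (rule Abd) (use \<omega> in \<open>auto simp: g_def intro!: power_mono\<close>)
        moreover have "- \<bar>A g\<bar> \<le> e * A g" using e by auto
        ultimately have "A (\<lambda>x. g (x - \<omega>)) \<le> 4 + 12 * S + 4 * C3"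
          using V C3 unfolding distrib_left by linarith
        also have "\<dots> \<le> C * (S + 1)" using C3 S by (simp add: C_def algebra_simps)
        finally show "(\<Sum>n<nat \<lceil>T\<^sup>2\<rceil>. window_coeff l \<sigma> \<omega> n * cos (t * ln (real (Suc n)))) \<le> C * (S + 1)"
          unfolding A_def b_def y_def g_def X_def[symmetric] window_coeff_def by (simp add: mult_ac del: of_nat_Suc)
      qed
    qed
  qed
qed

section \<open>Resonators supported on close frequencies\<close>

lemma sum_int_gaussian_le:
  assumes "finite (A :: int set)"
  shows "(\<Sum>k\<in>A. exp (- (real_of_int k)\<^sup>2 / 2)) \<le> 2 / (1 - exp (- 1 / 2))"
proof -
  define q :: real where "q = exp (- 1 / 2)"
  have q: "0 < q" "q < 1" by (auto simp: q_def)
  have le: "exp (- (real_of_int k)\<^sup>2 / 2) \<le> q ^ nat \<bar>k\<bar>" for k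
  proof -
    have "\<bar>real_of_int k\<bar> \<le> (real_of_int k)\<^sup>2"
    proof (cases "k = 0")
      case False
      hence "1 \<le> \<bar>real_of_int k\<bar>" by linarith
      hence "\<bar>real_of_int k\<bar> * 1 \<le> \<bar>real_of_int k\<bar> * \<bar>real_of_int k\<bar>" by (intro mult_left_mono) auto
      thus ?thesis by (simp add: power2_eq_square)
    qed auto
    hence "exp (- (real_of_int k)\<^sup>2 / 2) \<le> exp (real (nat \<bar>k\<bar>) * (- 1 / 2))" by simp
    also have "\<dots> = q ^ nat \<bar>k\<bar>" unfolding q_def by (rule exp_of_nat_mult)
    finally show ?thesis .
  qed
  have half: "(\<Sum>k\<in>B. q ^ nat \<bar>k\<bar>) \<le> 1 / (1 - q)" if "finite B" "inj_on (\<lambda>k. nat \<bar>k\<bar>) B" for B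
  proof -
    have "(\<Sum>k\<in>B. q ^ nat \<bar>k\<bar>) = (\<Sum>n\<in>(\<lambda>k. nat \<bar>k\<bar>) ` B. q ^ n)" by (simp add: sum.reindex[OF that(2)])
    also have "\<dots> \<le> (\<Sum>n. q ^ n)" using q that by (intro sum_le_suminf summable_geometric) auto
    also have "\<dots> = 1 / (1 - q)" using q by (intro suminf_geometric) auto
    finally show ?thesis .
  qed
  have "(\<Sum>k\<in>A. exp (- (real_of_int k)\<^sup>2 / 2)) \<le> (\<Sum>k\<in>A. q ^ nat \<bar>k\<bar>)" by (intro sum_mono le)
  also have "\<dots> = (\<Sum>k\<in>{k\<in>A. k \<ge> 0}. q ^ nat \<bar>k\<bar>) + (\<Sum>k\<in>{k\<in>A. k < 0}. q ^ nat \<bar>k\<bar>)"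
  proof -
    have "{k\<in>A. k \<ge> 0} \<union> {k\<in>A. k < 0} = A" by auto
    moreover have "{k\<in>A. k \<ge> 0} \<inter> {k\<in>A. k < 0} = {}" by auto
    ultimately show ?thesis
      using sum.union_disjoint[of "{k\<in>A. k \<ge> 0}" "{k\<in>A. k < 0}" "\<lambda>k. q ^ nat \<bar>k\<bar>"] assms by simp
  qed
  also have "\<dots> \<le> 1 / (1 - q) + 1 / (1 - q)"
    using assms by (intro add_mono half) (auto simp: inj_on_def)
  finally show ?thesis by (simp add: q_def)
qed

text \<open>Schur's test for the matrix \<open>exp (- (i - j)\<^sup>2 / 2)\<close>.\<close>

lemma sum_mult_gaussian_le:
  fixes r :: "int \<Rightarrow> real"
  assumes "finite J"
  shows "(\<Sum>i\<in>J. \<Sum>j\<in>J. r i * r j * exp (- (real_of_int (i - j))\<^sup>2 / 2)) \<le> 2 / (1 - exp (- 1 / 2)) * (\<Sum>j\<in>J. (r j)\<^sup>2)"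
proof -
  define g where "g = (\<lambda>k::int. exp (- (real_of_int k)\<^sup>2 / 2))"
  define C :: real where "C = 2 / (1 - exp (- 1 / 2))"
  have row: "(\<Sum>j\<in>J. g (i - j)) \<le> C" for i
  proof -
    have "(\<Sum>j\<in>J. g (i - j)) = (\<Sum>k\<in>(\<lambda>j. i - j) ` J. g k)"
      by (subst sum.reindex) (auto simp: inj_on_def)
    also have "\<dots> \<le> C" unfolding g_def C_def using assms by (intro sum_int_gaussian_le) auto
    finally show ?thesis .
  qed
  have g_sym: "g (i - j) = g (j - i)" for i j by (simp add: g_def power2_commute)
  have "(\<Sum>i\<in>J. \<Sum>j\<in>J. r i * r j * g (i - j)) \<le> (\<Sum>i\<in>J. \<Sum>j\<in>J. ((r i)\<^sup>2 / 2 + (r j)\<^sup>2 / 2) * g (i - j))"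
  proof (intro sum_mono mult_right_mono)
    fix i j
    have "0 \<le> (r i - r j)\<^sup>2" by simp
    thus "r i * r j \<le> (r i)\<^sup>2 / 2 + (r j)\<^sup>2 / 2" by (simp add: power2_eq_square algebra_simps)
  qed (auto simp: g_def)
  also have "\<dots> = (\<Sum>i\<in>J. \<Sum>j\<in>J. (r i)\<^sup>2 / 2 * g (i - j)) + (\<Sum>i\<in>J. \<Sum>j\<in>J. (r j)\<^sup>2 / 2 * g (i - j))"
    by (simp add: distrib_right sum.distrib)
  also have "(\<Sum>i\<in>J. \<Sum>j\<in>J. (r j)\<^sup>2 / 2 * g (i - j)) = (\<Sum>i\<in>J. \<Sum>j\<in>J. (r i)\<^sup>2 / 2 * g (i - j))"
    by (subst sum.swap) (simp add: g_sym)
  also have "(\<Sum>i\<in>J. \<Sum>j\<in>J. (r i)\<^sup>2 / 2 * g (i - j)) + (\<Sum>i\<in>J. \<Sum>j\<in>J. (r i)\<^sup>2 / 2 * g (i - j)) = (\<Sum>i\<in>J. (r i)\<^sup>2 * (\<Sum>j\<in>J. g (i - j)))"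
    by (simp add: sum_distrib_left sum.distrib[symmetric] mult_ac)
  also have "\<dots> \<le> (\<Sum>i\<in>J. (r i)\<^sup>2 * C)" by (intro sum_mono mult_left_mono row) auto
  also have "\<dots> = C * (\<Sum>j\<in>J. (r j)\<^sup>2)" by (simp only: sum_distrib_left mult.commute)
  finally show ?thesis unfolding g_def C_def .
qed

text \<open>The weight \<open>W\<close> is \<open>|\<Sum> r(j) exp (- i t j / \<tau>)|\<^sup>2\<close>, where \<open>j\<close> runs through the cells \<open>\<lfloor>\<tau> L(m)\<rfloor>\<close> and
\<open>r(j)\<^sup>2\<close> is the sum of the \<open>F(m)\<^sup>2\<close> over the cell. The frequencies are integer multiples of \<open>1 / \<tau>\<close>, so
the weighted integral of \<open>W\<close> is comparable to the sum of the \<open>F(m)\<^sup>2\<close>, no matter how close the \<open>L(m)\<close> are. If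
\<open>L(m') = L(m) + \<nu>\<close>, then the cells of \<open>m'\<close> and \<open>m\<close> differ by \<open>\<tau> \<nu>\<close> up to \<open>1\<close>, and by the Cauchy-Schwarz
inequality the products \<open>F(m) F(m')\<close> of all such pairs in two given cells add up to at most the
product of the two coefficients.\<close>

lemma resonator:
  fixes F L :: "'a \<Rightarrow> real" and \<tau> :: real
  assumes fin: "finite M" and F0: "\<And>m. m \<in> M \<Longrightarrow> F m \<ge> 0" and \<tau>: "\<tau> > 0"
  obtains W :: "real \<Rightarrow> real" where
    "\<And>t. 0 \<le> W t" "\<And>t. W t \<le> real (card M) * (\<Sum>m\<in>M. (F m)\<^sup>2)"
    "\<And>\<nu>. integrable lborel (\<lambda>t. cos (t * \<nu>) * (W t * exp (- t\<^sup>2 / (2 * \<tau>\<^sup>2))))"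
    "(\<integral>t. W t * exp (- t\<^sup>2 / (2 * \<tau>\<^sup>2)) \<partial>lborel) \<le> 18 * \<tau> * (\<Sum>m\<in>M. (F m)\<^sup>2)"
    "\<And>\<nu> E. E \<subseteq> M \<times> M \<Longrightarrow> inj_on fst E \<Longrightarrow> inj_on snd E \<Longrightarrow> (\<And>m m'. (m, m') \<in> E \<Longrightarrow> L m' = L m + \<nu>) \<Longrightarrow>
       \<tau> * (\<Sum>(m, m')\<in>E. F m * F m') \<le> (\<integral>t. cos (t * \<nu>) * (W t * exp (- t\<^sup>2 / (2 * \<tau>\<^sup>2))) \<partial>lborel)"
proof -
  define cell where "cell = (\<lambda>m. \<lfloor>\<tau> * L m\<rfloor>)"
  define J where "J = cell ` M"
  define r where "r = (\<lambda>j. L2_set F {m\<in>M. cell m = j})"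
  define W where "W = (\<lambda>t. (\<Sum>j\<in>J. r j * cos (t * (j / \<tau>)))\<^sup>2 + (\<Sum>j\<in>J. r j * sin (t * (j / \<tau>)))\<^sup>2)"
  define \<Phi> where "\<Phi> = (\<lambda>t. exp (- t\<^sup>2 / (2 * \<tau>\<^sup>2)))"
  define G where "G = (\<lambda>\<nu>. \<Sum>i\<in>J. \<Sum>j\<in>J. r i * r j * exp (- (\<tau> * \<nu> - real_of_int (i - j))\<^sup>2 / 2))"
  have J: "finite J" using fin by (simp add: J_def)
  have r0: "r j \<ge> 0" for j unfolding r_def by (rule L2_set_nonneg)
  have r2: "(\<Sum>j\<in>J. (r j)\<^sup>2) = (\<Sum>m\<in>M. (F m)\<^sup>2)"
  proof -
    have "(r j)\<^sup>2 = (\<Sum>m\<in>{m\<in>M. cell m = j}. (F m)\<^sup>2)" for j unfolding r_def L2_set_def by (simp add: sum_nonneg)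
    thus ?thesis using sum.group[of M J cell "\<lambda>m. (F m)\<^sup>2"] fin J by (simp add: J_def)
  qed
  have W0: "W t \<ge> 0" for t by (simp add: W_def)
  have Wle: "W t \<le> real (card M) * (\<Sum>m\<in>M. (F m)\<^sup>2)" for t
  proof -
    have "W t \<le> (\<Sum>j\<in>J. (r j)\<^sup>2) * (\<Sum>j\<in>J. (cos (t * (j / \<tau>)))\<^sup>2) + (\<Sum>j\<in>J. (r j)\<^sup>2) * (\<Sum>j\<in>J. (sin (t * (j / \<tau>)))\<^sup>2)"
      unfolding W_def by (intro add_mono Cauchy_Schwarz_ineq_sum)
    also have "\<dots> = (\<Sum>j\<in>J. (r j)\<^sup>2) * (\<Sum>j\<in>J. (cos (t * (j / \<tau>)))\<^sup>2 + (sin (t * (j / \<tau>)))\<^sup>2)"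
      by (simp only: sum.distrib distrib_left)
    also have "\<dots> = real (card J) * (\<Sum>m\<in>M. (F m)\<^sup>2)" by (simp add: r2)
    also have "\<dots> \<le> real (card M) * (\<Sum>m\<in>M. (F m)\<^sup>2)"
      using fin card_image_le[of M cell] by (intro mult_right_mono) (auto simp: J_def sum_nonneg)
    finally show ?thesis .
  qed
  have Wcos: "cos (t * \<nu>) * W t = (\<Sum>i\<in>J. \<Sum>j\<in>J. r i * r j * (cos (t * (\<nu> - (i - j) / \<tau>)) / 2 + cos (t * (\<nu> + (i - j) / \<tau>)) / 2))" for t \<nu>
  proof -
    have "W t = (\<Sum>i\<in>J. \<Sum>j\<in>J. r i * r j * cos (t * ((i - j) / \<tau>)))"
      unfolding W_def power2_eq_square sum_product sum.distrib[symmetric]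
      by (intro sum.cong refl) (simp add: cos_diff algebra_simps diff_divide_distrib)
    also have "cos (t * \<nu>) * \<dots> = (\<Sum>i\<in>J. \<Sum>j\<in>J. r i * r j * (cos (t * \<nu>) * cos (t * ((i - j) / \<tau>))))"
      by (simp only: sum_distrib_left mult_ac)
    also have "\<dots> = (\<Sum>i\<in>J. \<Sum>j\<in>J. r i * r j * (cos (t * (\<nu> - (i - j) / \<tau>)) / 2 + cos (t * (\<nu> + (i - j) / \<tau>)) / 2))"
      by (intro sum.cong refl) (simp add: cos_times_cos algebra_simps add_divide_distrib)
    finally show ?thesis .
  qed
  have bochner: "has_bochner_integral lborel (\<lambda>t. cos (t * \<nu>) * (W t * \<Phi> t)) (sqrt (2 * pi) * \<tau> * G \<nu>)" for \<nu>
  proof -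
    have g: "has_bochner_integral lborel (\<lambda>t. \<Phi> t * cos (t * y)) (sqrt (2 * pi) * \<tau> * exp (- (\<tau> * y)\<^sup>2 / 2))" for y
      using gaussian_cos[OF \<tau>, of y] by (simp add: has_bochner_integral_iff \<Phi>_def)
    have "has_bochner_integral lborel (\<lambda>t. \<Sum>i\<in>J. \<Sum>j\<in>J. r i * r j * (\<Phi> t * cos (t * (\<nu> - (i - j) / \<tau>)) / 2 + \<Phi> t * cos (t * (\<nu> + (i - j) / \<tau>)) / 2))
       (\<Sum>i\<in>J. \<Sum>j\<in>J. r i * r j * (sqrt (2 * pi) * \<tau> * exp (- (\<tau> * (\<nu> - (i - j) / \<tau>))\<^sup>2 / 2) / 2 +
            sqrt (2 * pi) * \<tau> * exp (- (\<tau> * (\<nu> + (i - j) / \<tau>))\<^sup>2 / 2) / 2))"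
      by (intro has_bochner_integral_sum has_bochner_integral_mult_right has_bochner_integral_add has_bochner_integral_divide_zero g)
    also have "(\<lambda>t. \<Sum>i\<in>J. \<Sum>j\<in>J. r i * r j * (\<Phi> t * cos (t * (\<nu> - (i - j) / \<tau>)) / 2 + \<Phi> t * cos (t * (\<nu> + (i - j) / \<tau>)) / 2))
       = (\<lambda>t. cos (t * \<nu>) * (W t * \<Phi> t))"
    proof
      fix t
      have "cos (t * \<nu>) * (W t * \<Phi> t) = \<Phi> t * (cos (t * \<nu>) * W t)" by (simp add: mult_ac)
      also have "\<dots> = (\<Sum>i\<in>J. \<Sum>j\<in>J. \<Phi> t * (r i * r j * (cos (t * (\<nu> - (i - j) / \<tau>)) / 2 + cos (t * (\<nu> + (i - j) / \<tau>)) / 2)))"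
        unfolding Wcos by (simp only: sum_distrib_left)
      also have "\<dots> = (\<Sum>i\<in>J. \<Sum>j\<in>J. r i * r j * (\<Phi> t * cos (t * (\<nu> - (i - j) / \<tau>)) / 2 + \<Phi> t * cos (t * (\<nu> + (i - j) / \<tau>)) / 2))"
        by (intro sum.cong refl) (simp add: algebra_simps)
      finally show "(\<Sum>i\<in>J. \<Sum>j\<in>J. r i * r j * (\<Phi> t * cos (t * (\<nu> - (i - j) / \<tau>)) / 2 + \<Phi> t * cos (t * (\<nu> + (i - j) / \<tau>)) / 2))
       = cos (t * \<nu>) * (W t * \<Phi> t)" by simp
    qed
    also have "(\<Sum>i\<in>J. \<Sum>j\<in>J. r i * r j * (sqrt (2 * pi) * \<tau> * exp (- (\<tau> * (\<nu> - (i - j) / \<tau>))\<^sup>2 / 2) / 2 +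
            sqrt (2 * pi) * \<tau> * exp (- (\<tau> * (\<nu> + (i - j) / \<tau>))\<^sup>2 / 2) / 2))
        = sqrt (2 * pi) * \<tau> * (G \<nu> / 2 + (\<Sum>i\<in>J. \<Sum>j\<in>J. r i * r j * exp (- (\<tau> * \<nu> - real_of_int (j - i))\<^sup>2 / 2)) / 2)"
    proof -
      have e: "\<tau> * (\<nu> - (i - j) / \<tau>) = \<tau> * \<nu> - real_of_int (i - j)" "\<tau> * (\<nu> + (i - j) / \<tau>) = \<tau> * \<nu> - real_of_int (j - i)" for i j :: int
        using \<tau> by (simp_all add: field_simps)
      show ?thesis unfolding G_def e sum_divide_distrib sum.distrib[symmetric] sum_distrib_left
        by (intro sum.cong refl) (simp add: algebra_simps)
    qed
    also have "(\<Sum>i\<in>J. \<Sum>j\<in>J. r i * r j * exp (- (\<tau> * \<nu> - real_of_int (j - i))\<^sup>2 / 2)) = G \<nu>"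
      unfolding G_def by (subst sum.swap) (simp add: mult_ac)
    finally show ?thesis by simp
  qed
  have s1: "1 * exp (1 / 2) \<le> sqrt (2 * pi)"
  proof -
    have "exp (1 / 2) \<le> (1 + 1/2 + (1/2)\<^sup>2 :: real)" by (rule exp_bound) auto
    also have "\<dots> \<le> sqrt (2 * pi)" using pi_gt3 by (intro real_le_rsqrt) (simp add: power2_eq_square)
    finally show ?thesis by simp
  qed
  show ?thesis
  proof (rule that[of W])
    show "integrable lborel (\<lambda>t. cos (t * \<nu>) * (W t * exp (- t\<^sup>2 / (2 * \<tau>\<^sup>2))))" for \<nu>
      using bochner[of \<nu>] by (simp add: has_bochner_integral_iff \<Phi>_def)
    have "(\<integral>t. W t * exp (- t\<^sup>2 / (2 * \<tau>\<^sup>2)) \<partial>lborel) = sqrt (2 * pi) * \<tau> * G 0"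
      using bochner[of 0] by (simp add: has_bochner_integral_iff \<Phi>_def)
    also have "G 0 \<le> 2 / (1 - exp (- 1 / 2)) * (\<Sum>m\<in>M. (F m)\<^sup>2)"
      unfolding G_def r2[symmetric] using sum_mult_gaussian_le[OF J, of r] by (simp add: power2_commute)
    also have "2 / (1 - exp (- 1 / 2)) \<le> (6::real)"
    proof -
      have "1 + 1/2 \<le> exp (1/2::real)" by (rule exp_ge_add_one_self)
      hence "exp (- 1 / 2) \<le> (2/3 :: real)" by (simp add: exp_minus field_simps)
      thus ?thesis by (simp add: field_simps)
    qed
    also have "sqrt (2 * pi) \<le> 3" using pi_less_4 by (intro real_le_lsqrt) (simp_all add: power2_eq_square)
    finally show "(\<integral>t. W t * exp (- t\<^sup>2 / (2 * \<tau>\<^sup>2)) \<partial>lborel) \<le> 18 * \<tau> * (\<Sum>m\<in>M. (F m)\<^sup>2)"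
      using \<tau> by (simp add: mult_left_mono mult_right_mono sum_nonneg)
  next
    fix \<nu> E
    assume E: "E \<subseteq> M \<times> M" "inj_on fst E" "inj_on snd E" "\<And>m m'. (m, m') \<in> E \<Longrightarrow> L m' = L m + \<nu>"
    have finE: "finite E" by (rule finite_subset[OF E(1)]) (use fin in auto)
    define S where "S = (\<lambda>i j. {x\<in>E. cell (snd x) = i \<and> cell (fst x) = j})"
    \<comment> \<open>If some pair has its cells in \<open>i\<close> and \<open>j\<close>, then \<open>\<tau> \<nu>\<close> and \<open>i - j\<close> differ by at most \<open>1\<close>.\<close>
    have part: "(\<Sum>(m, m')\<in>S i j. F m * F m') \<le> r i * r j * (exp (1/2) * exp (- (\<tau> * \<nu> - real_of_int (i - j))\<^sup>2 / 2))" for i j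
    proof (cases "S i j = {}")
      case False
      then obtain m m' where m: "(m, m') \<in> E" "cell m' = i" "cell m = j" by (auto simp: S_def)
      have "\<bar>\<tau> * \<nu> - real_of_int (i - j)\<bar> \<le> 1"
        using E(4)[OF m(1)] m(2,3) unfolding cell_def by (simp add: algebra_simps) linarith
      hence "(\<tau> * \<nu> - real_of_int (i - j))\<^sup>2 \<le> 1" by (simp add: abs_square_le_1)
      hence one: "1 \<le> exp (1/2) * exp (- (\<tau> * \<nu> - real_of_int (i - j))\<^sup>2 / 2)" by (simp add: exp_add[symmetric])
      have SS: "S i j \<subseteq> E" by (auto simp: S_def)
      hence finS: "finite (S i j)" using finE finite_subset by blast
      \<comment> \<open>The coordinates are injective on \<open>E\<close>, so each member of a cell occurs at most once.\<close>
      have l1: "L2_set (\<lambda>x. F (fst x)) (S i j) \<le> r j"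
      proof -
        have "(\<Sum>x\<in>S i j. (F (fst x))\<^sup>2) = (\<Sum>m\<in>fst ` S i j. (F m)\<^sup>2)"
          using inj_on_subset[OF E(2) SS] by (simp add: sum.reindex)
        also have "\<dots> \<le> (\<Sum>m\<in>{m\<in>M. cell m = j}. (F m)\<^sup>2)"
          using E(1) fin by (intro sum_mono2) (auto simp: S_def)
        finally show ?thesis unfolding r_def L2_set_def by simp
      qed
      have l2: "L2_set (\<lambda>x. F (snd x)) (S i j) \<le> r i"
      proof -
        have "(\<Sum>x\<in>S i j. (F (snd x))\<^sup>2) = (\<Sum>m\<in>snd ` S i j. (F m)\<^sup>2)"
          using inj_on_subset[OF E(3) SS] by (simp add: sum.reindex)
        also have "\<dots> \<le> (\<Sum>m\<in>{m\<in>M. cell m = i}. (F m)\<^sup>2)"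
          using E(1) fin by (intro sum_mono2) (auto simp: S_def)
        finally show ?thesis unfolding r_def L2_set_def by simp
      qed
      have "(\<Sum>(m, m')\<in>S i j. F m * F m') \<le> (\<Sum>x\<in>S i j. \<bar>F (fst x)\<bar> * \<bar>F (snd x)\<bar>)"
        by (intro sum_mono) (auto simp: abs_mult[symmetric])
      also have "\<dots> \<le> L2_set (\<lambda>x. F (fst x)) (S i j) * L2_set (\<lambda>x. F (snd x)) (S i j)" by (rule L2_set_mult_ineq)
      also have "\<dots> \<le> r j * r i" by (intro mult_mono l1 l2 r0 L2_set_nonneg)
      also have "\<dots> \<le> r i * r j * (exp (1/2) * exp (- (\<tau> * \<nu> - real_of_int (i - j))\<^sup>2 / 2))"
        using mult_left_mono[OF one, of "r i * r j"] r0 by (simp add: mult.commute)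
      finally show ?thesis .
    qed (auto intro!: mult_nonneg_nonneg r0)
    have "(\<Sum>(m, m')\<in>E. F m * F m') = (\<Sum>p\<in>J \<times> J. \<Sum>(m, m')\<in>{x\<in>E. (cell (snd x), cell (fst x)) = p}. F m * F m')"
      using E(1) J finE by (intro sum.group[symmetric]) (auto simp: J_def)
    also have "\<dots> = (\<Sum>p\<in>J \<times> J. \<Sum>(m, m')\<in>S (fst p) (snd p). F m * F m')"
      unfolding S_def by (intro sum.cong) auto
    also have "\<dots> \<le> (\<Sum>p\<in>J \<times> J. r (fst p) * r (snd p) * (exp (1/2) * exp (- (\<tau> * \<nu> - real_of_int (fst p - snd p))\<^sup>2 / 2)))"
      by (intro sum_mono part)
    also have "\<dots> = exp (1/2) * G \<nu>"
      unfolding G_def sum.cartesian_product by (simp add: sum_distrib_left case_prod_unfold mult_ac)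
    finally have "\<tau> * (\<Sum>(m, m')\<in>E. F m * F m') \<le> \<tau> * (exp (1/2) * G \<nu>)" using \<tau> by (intro mult_left_mono) auto
    also have "\<dots> = exp (1/2) * (\<tau> * G \<nu>)" by simp
    also have "\<dots> \<le> sqrt (2 * pi) * (\<tau> * G \<nu>)"
      using s1 \<tau> unfolding G_def by (intro mult_right_mono mult_nonneg_nonneg sum_nonneg r0) auto
    also have "\<dots> = (\<integral>t. cos (t * \<nu>) * (W t * exp (- t\<^sup>2 / (2 * \<tau>\<^sup>2))) \<partial>lborel)"
      using bochner[of \<nu>] by (simp add: has_bochner_integral_iff \<Phi>_def)
    finally show "\<tau> * (\<Sum>(m, m')\<in>E. F m * F m') \<le> (\<integral>t. cos (t * \<nu>) * (W t * exp (- t\<^sup>2 / (2 * \<tau>\<^sup>2))) \<partial>lborel)" .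
  qed (use W0 Wle in auto)
qed

section \<open>The resonance inequality\<close>

text \<open>The set \<open>E n\<close> is the graph of a partial injection that multiplies by \<open>n + 1\<close>. Injectivity on both sides
is what the Cauchy-Schwarz inequality in \<open>resonator\<close> requires.\<close>

definition log_shift_relations :: "'a set \<Rightarrow> ('a \<Rightarrow> real) \<Rightarrow> (nat \<Rightarrow> ('a \<times> 'a) set) \<Rightarrow> bool" where
  "log_shift_relations M L E \<longleftrightarrow> (\<forall>n. E n \<subseteq> M \<times> M \<and> inj_on fst (E n) \<and> inj_on snd (E n) \<and>
     (\<forall>(m, m')\<in>E n. L m' = L m + ln (real (Suc n))))"

text \<open>The smoothed polynomial, which is an even function of \<open>t\<close>, is integrated against the weight of the
resonator. Its bound by \<open>S + 1\<close> is available for \<open>2 \<surd>T \<le> |t| \<le> T / 2\<close>. For smaller \<open>|t|\<close> the trivial bounds give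
a constant multiple of \<open>T^(1/50) T^(9/20) \<surd>T\<close> times the sum of the \<open>F(m)\<^sup>2\<close>, which is less than \<open>\<tau>\<close> times
that sum, and for
larger \<open>|t|\<close> the Gaussian factor is negligible because \<open>\<tau> = T / log T\<close>.\<close>

lemma resonance_bound:
  "\<exists>C>0. \<forall>\<^sub>F T in at_top. \<forall>\<sigma> \<omega> S (M :: 'a set) F L E. \<sigma> \<in> {1/2..1} \<longrightarrow>
     \<omega> \<in> {0..ln T / 100} \<longrightarrow> line_bound l T \<sigma> S \<longrightarrow>
     finite M \<longrightarrow> real (card M) \<le> T powr (9/20) \<longrightarrow> (\<forall>m\<in>M. 0 \<le> F m) \<longrightarrow> log_shift_relations M L E \<longrightarrow>
     (\<Sum>n<nat \<lceil>T\<^sup>2\<rceil>. window_coeff l \<sigma> \<omega> n * (\<Sum>(m, m')\<in>E n. F m * F m')) \<le> C * (S + 1) * (\<Sum>m\<in>M. (F m)\<^sup>2)"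
  (is "\<exists>C>0. \<forall>\<^sub>F T in at_top. ?Q C T")
proof -
  obtain C where C: "C > 0" "\<forall>\<^sub>F T in at_top. \<forall>\<sigma> \<omega> t S. \<sigma> \<in> {1/2..1} \<longrightarrow> \<omega> \<in> {0..ln T / 100} \<longrightarrow>
     t \<in> {2 * sqrt T..T / 2} \<longrightarrow> line_bound l T \<sigma> S \<longrightarrow>
     (\<Sum>n<nat \<lceil>T\<^sup>2\<rceil>. window_coeff l \<sigma> \<omega> n * cos (t * ln (real (Suc n)))) \<le> C * (S + 1)"
    using smoothing[of l] by blast
  obtain K where K: "K > 0" "\<And>\<sigma> \<omega> n. 1/2 \<le> \<sigma> \<Longrightarrow>
     window_coeff l \<sigma> \<omega> n \<le> K * real (Suc n) powr (-2) * exp (2 * \<omega>)"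
    using window_coeff_le[of l] by blast
  define C4 where "C4 = (\<Sum>n. K * real (Suc n) powr (-2))"
  have sm4: "summable (\<lambda>n. K * real (Suc n) powr (-2))" by (intro summable_mult summable_Suc_powr) auto
  have C4: "C4 > 0" unfolding C4_def using sm4 K(1) by (intro suminf_pos) auto
  have ev1: "\<forall>\<^sub>F T in at_top. (C4 * T powr (1/50)) * T powr (9/20) * (4 * sqrt T + 4 * (T / ln T) * exp (- (T / 2)\<^sup>2 / (4 * (T / ln T)\<^sup>2))) \<le> T / ln T"
    using C4 by real_asymp
  have ev2: "\<forall>\<^sub>F T::real in at_top. T \<ge> 16" by (rule eventually_ge_at_top)
  show ?thesis
  proof (intro exI[of _ "18 * C + 1"] conjI)
    show "18 * C + 1 > 0" using C(1) by simp
    show "\<forall>\<^sub>F T in at_top. ?Q (18 * C + 1) T"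
      using C(2) ev1 ev2
    proof eventually_elim
      case (elim T)
      show ?case
      proof (intro allI impI)
        fix \<sigma> \<omega> S :: real and M :: "'a set" and F L :: "'a \<Rightarrow> real" and E :: "nat \<Rightarrow> ('a \<times> 'a) set"
        assume "\<sigma> \<in> {1/2..1}" "\<omega> \<in> {0..ln T / 100}"
          and bound: "line_bound l T \<sigma> S"
          and M: "finite M" "real (card M) \<le> T powr (9/20)" "\<forall>m\<in>M. 0 \<le> F m"
          and E: "log_shift_relations M L E"
        hence \<sigma>: "1/2 \<le> \<sigma>" "\<sigma> \<le> 1" and \<omega>: "0 \<le> \<omega>" "\<omega> \<le> ln T / 100" and S: "0 \<le> S"
          by (auto simp: line_bound_def)
        define X where "X = nat \<lceil>T\<^sup>2\<rceil>"
        define y where "y = (\<lambda>n. ln (real (Suc n)))"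
        define \<alpha> where "\<alpha> = window_coeff l \<sigma> \<omega>"
        define D where "D = (\<lambda>t. \<Sum>n<X. \<alpha> n * cos (t * y n))"
        define \<tau> where "\<tau> = T / ln T"
        define Q where "Q = (\<Sum>m\<in>M. (F m)\<^sup>2)"
        define \<Phi> where "\<Phi> = (\<lambda>t. exp (- t\<^sup>2 / (2 * \<tau>\<^sup>2)))"
        have T: "T \<ge> 16" by fact
        have \<tau>: "\<tau> > 0" using T by (simp add: \<tau>_def)
        have Q: "Q \<ge> 0" by (simp add: Q_def sum_nonneg)
        have \<alpha>0: "\<alpha> n \<ge> 0" for n unfolding \<alpha>_def by (rule window_coeff_nonneg)
        have Dle: "\<bar>D t\<bar> \<le> C4 * T powr (1/50)" for t
        proof -
          have "\<bar>D t\<bar> \<le> (\<Sum>n<X. K * real (Suc n) powr (-2) * T powr (1/50))"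
            unfolding D_def
          proof (rule order_trans[OF sum_abs], rule sum_mono)
            fix n
            have "\<bar>\<alpha> n * cos (t * y n)\<bar> \<le> \<alpha> n" using \<alpha>0[of n] by (simp add: abs_mult mult_left_le)
            also have "\<dots> \<le> K * real (Suc n) powr (-2) * exp (2 * \<omega>)" unfolding \<alpha>_def by (rule K(2)[OF \<sigma>(1)])
            also have "\<dots> \<le> K * real (Suc n) powr (-2) * T powr (1/50)"
              using \<omega> T K(1) by (intro mult_left_mono) (auto simp: powr_def)
            finally show "\<bar>\<alpha> n * cos (t * y n)\<bar> \<le> K * real (Suc n) powr (-2) * T powr (1/50)" .
          qed
          also have "\<dots> = (\<Sum>n<X. K * real (Suc n) powr (-2)) * T powr (1/50)" by (simp only: sum_distrib_right)
          also have "\<dots> \<le> C4 * T powr (1/50)"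
            unfolding C4_def using sm4 K(1) by (intro mult_right_mono sum_le_suminf) auto
          finally show ?thesis .
        qed
        have F0: "\<And>m. m \<in> M \<Longrightarrow> 0 \<le> F m" using M(3) by blast
        obtain W where W': "\<And>t. 0 \<le> W t" "\<And>t. W t \<le> real (card M) * (\<Sum>m\<in>M. (F m)\<^sup>2)"
          "\<And>\<nu>. integrable lborel (\<lambda>t. cos (t * \<nu>) * (W t * exp (- t\<^sup>2 / (2 * \<tau>\<^sup>2))))"
          "(\<integral>t. W t * exp (- t\<^sup>2 / (2 * \<tau>\<^sup>2)) \<partial>lborel) \<le> 18 * \<tau> * (\<Sum>m\<in>M. (F m)\<^sup>2)"
          "\<And>\<nu> E. E \<subseteq> M \<times> M \<Longrightarrow> inj_on fst E \<Longrightarrow> inj_on snd E \<Longrightarrow> (\<And>m m'. (m, m') \<in> E \<Longrightarrow> L m' = L m + \<nu>) \<Longrightarrow>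
             \<tau> * (\<Sum>(m, m')\<in>E. F m * F m') \<le> (\<integral>t. cos (t * \<nu>) * (W t * exp (- t\<^sup>2 / (2 * \<tau>\<^sup>2))) \<partial>lborel)"
        proof (rule resonator[OF M(1) F0 \<tau>, where L = L])
          fix W
          assume a: "\<And>t. 0 \<le> W t" "\<And>t. W t \<le> real (card M) * (\<Sum>m\<in>M. (F m)\<^sup>2)"
          "\<And>\<nu>. integrable lborel (\<lambda>t. cos (t * \<nu>) * (W t * exp (- t\<^sup>2 / (2 * \<tau>\<^sup>2))))"
          "(\<integral>t. W t * exp (- t\<^sup>2 / (2 * \<tau>\<^sup>2)) \<partial>lborel) \<le> 18 * \<tau> * (\<Sum>m\<in>M. (F m)\<^sup>2)"
          "\<And>\<nu> E. E \<subseteq> M \<times> M \<Longrightarrow> inj_on fst E \<Longrightarrow> inj_on snd E \<Longrightarrow> (\<And>m m'. (m, m') \<in> E \<Longrightarrow> L m' = L m + \<nu>) \<Longrightarrow>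
             \<tau> * (\<Sum>(m, m')\<in>E. F m * F m') \<le> (\<integral>t. cos (t * \<nu>) * (W t * exp (- t\<^sup>2 / (2 * \<tau>\<^sup>2))) \<partial>lborel)"
          show thesis by (rule that[OF a])
        qed
        have \<Phi>_eq: "exp (- t\<^sup>2 / (2 * \<tau>\<^sup>2)) = \<Phi> t" for t by (simp add: \<Phi>_def)
        note W = W'[folded Q_def, unfolded \<Phi>_eq]
        define V where "V = (C4 * T powr (1/50)) * (T powr (9/20) * Q)"
        have V: "V \<ge> 0" unfolding V_def using C4 Q by simp
        have WV: "\<bar>D t\<bar> * W t \<le> V" for t
        proof -
          have "W t \<le> T powr (9/20) * Q" using W(2)[of t] mult_right_mono[OF M(2) Q] by linarith
          thus ?thesis unfolding V_def using Dle[of t] W(1)[of t] C4 by (intro mult_mono) auto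
        qed
        have \<Phi>01: "0 \<le> \<Phi> t" "\<Phi> t \<le> 1" for t by (auto simp: \<Phi>_def)
        have iW: "integrable lborel (\<lambda>t. W t * \<Phi> t)" using W(3)[of 0] by simp
        have eqD: "D t * (W t * \<Phi> t) = (\<Sum>n<X. \<alpha> n * (cos (t * y n) * (W t * \<Phi> t)))" for t
          unfolding D_def sum_distrib_right by (simp only: mult.assoc)
        have iD: "integrable lborel (\<lambda>t. D t * (W t * \<Phi> t))" unfolding eqD using W(3) by (intro Bochner_Integration.integrable_sum integrable_mult_right) auto
        have vD: "(\<integral>t. D t * (W t * \<Phi> t) \<partial>lborel) = (\<Sum>n<X. \<alpha> n * (\<integral>t. cos (t * y n) * (W t * \<Phi> t) \<partial>lborel))"
          unfolding eqD using W(3) by (subst Bochner_Integration.integral_sum) auto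
        have "\<tau> * (\<Sum>n<X. \<alpha> n * (\<Sum>(m, m')\<in>E n. F m * F m')) = (\<Sum>n<X. \<alpha> n * (\<tau> * (\<Sum>(m, m')\<in>E n. F m * F m')))"
          by (simp only: sum_distrib_left mult_ac)
        also have "\<dots> \<le> (\<Sum>n<X. \<alpha> n * (\<integral>t. cos (t * y n) * (W t * \<Phi> t) \<partial>lborel))"
          using E \<alpha>0 by (intro sum_mono mult_left_mono W(5)) (auto simp: log_shift_relations_def y_def)
        also have "\<dots> = (\<integral>t. D t * (W t * \<Phi> t) \<partial>lborel)" by (rule vD[symmetric])
        finally have low: "\<tau> * (\<Sum>n<X. \<alpha> n * (\<Sum>(m, m')\<in>E n. F m * F m')) \<le> (\<integral>t. D t * (W t * \<Phi> t) \<partial>lborel)" .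

        define a where "a = 2 * sqrt T"
        define b where "b = T / 2"
        have ab: "a \<ge> 0" "b \<ge> 0" using T by (auto simp: a_def b_def)
        have i1: "integrable lborel (\<lambda>t. V * indicat_real {-a..a} t)"
          by (intro integrable_mult_right integrable_real_indicator) (auto simp: emeasure_lborel_Icc_eq)
        have i2: "integrable lborel (\<lambda>t. indicat_real {t. \<bar>t\<bar> > b} t * \<Phi> t)"
          using gaussian_tail(1)[OF \<tau> ab(2)] unfolding set_integrable_def \<Phi>_def by simp
        have "(\<integral>t. D t * (W t * \<Phi> t) \<partial>lborel) \<le>
           (\<integral>t. C * (S + 1) * (W t * \<Phi> t) + (V * indicat_real {-a..a} t + V * (indicat_real {t. \<bar>t\<bar> > b} t * \<Phi> t)) \<partial>lborel)"
        proof (rule integral_mono[OF iD])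
          show "integrable lborel (\<lambda>t. C * (S + 1) * (W t * \<Phi> t) + (V * indicat_real {-a..a} t + V * (indicat_real {t. \<bar>t\<bar> > b} t * \<Phi> t)))"
            using iW i1 i2 by (intro Bochner_Integration.integrable_add integrable_mult_right) auto
          fix t
          have n1: "0 \<le> C * (S + 1) * (W t * \<Phi> t)" using C(1) S W(1) \<Phi>01 by simp
          have n2: "D t * (W t * \<Phi> t) \<le> V * \<Phi> t"
          proof -
            have "D t * (W t * \<Phi> t) \<le> \<bar>D t\<bar> * (W t * \<Phi> t)" using W(1)[of t] \<Phi>01[of t] by (intro mult_right_mono) auto
            also have "\<dots> = (\<bar>D t\<bar> * W t) * \<Phi> t" by simp
            also have "\<dots> \<le> V * \<Phi> t" using WV \<Phi>01 by (intro mult_right_mono) auto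
            finally show ?thesis .
          qed
          consider "\<bar>t\<bar> \<le> a" | "\<bar>t\<bar> > b" | "a \<le> \<bar>t\<bar>" "\<bar>t\<bar> \<le> b" by linarith
          thus "D t * (W t * \<Phi> t) \<le> C * (S + 1) * (W t * \<Phi> t) + (V * indicat_real {-a..a} t + V * (indicat_real {t. \<bar>t\<bar> > b} t * \<Phi> t))"
          proof cases
            case 1
            have "V * \<Phi> t \<le> V" using mult_left_mono[OF \<Phi>01(2) V, of t] by simp
            moreover have "V * indicat_real {-a..a} t = V" using 1 by (simp add: indicator_def abs_le_iff)
            moreover have "V * (indicat_real {t. \<bar>t\<bar> > b} t * \<Phi> t) \<ge> 0" using V \<Phi>01 by simp
            ultimately show ?thesis using n1 n2 by linarith
          next
            case 2
            hence "V * (indicat_real {t. \<bar>t\<bar> > b} t * \<Phi> t) = V * \<Phi> t" by simp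
            moreover have "V * indicat_real {-a..a} t \<ge> 0" using V by simp
            ultimately show ?thesis using n1 n2 by linarith
          next
            case 3
            have "D t = D \<bar>t\<bar>" unfolding D_def by (intro sum.cong refl) (cases "t \<ge> 0"; simp)
            also have "\<dots> \<le> C * (S + 1)"
              using elim(1)[rule_format, of \<sigma> \<omega> "\<bar>t\<bar>" S] \<sigma> \<omega> bound 3
              unfolding D_def \<alpha>_def y_def X_def a_def b_def by simp
            finally have "D t * (W t * \<Phi> t) \<le> C * (S + 1) * (W t * \<Phi> t)"
              using W(1) \<Phi>01 by (intro mult_right_mono) auto
            moreover have "V * (indicat_real {t. \<bar>t\<bar> > b} t * \<Phi> t) \<ge> 0" using V \<Phi>01 by simp
            moreover have "V * indicat_real {-a..a} t \<ge> 0" using V by simp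
            ultimately show ?thesis by linarith
          qed
        qed
        also have "\<dots> = C * (S + 1) * (\<integral>t. W t * \<Phi> t \<partial>lborel) + (V * (2 * a) + V * (LINT t:{t. \<bar>t\<bar> > b}|lborel. \<Phi> t))"
          using iW i1 i2 ab by (simp add: set_lebesgue_integral_def)
        also have "\<dots> \<le> C * (S + 1) * (18 * \<tau> * Q) + (V * (2 * a) + V * (4 * \<tau> * exp (- b\<^sup>2 / (4 * \<tau>\<^sup>2))))"
          using W(4) C(1) S V gaussian_tail(2)[OF \<tau> ab(2)] unfolding \<Phi>_def
          by (intro add_mono mult_left_mono) auto
        also have "V * (2 * a) + V * (4 * \<tau> * exp (- b\<^sup>2 / (4 * \<tau>\<^sup>2))) = Q * ((C4 * T powr (1/50)) * T powr (9/20) * (4 * sqrt T + 4 * (T / ln T) * exp (- (T / 2)\<^sup>2 / (4 * (T / ln T)\<^sup>2))))"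
          unfolding V_def a_def b_def \<tau>_def by (simp only: distrib_left mult_ac)
        also have "\<dots> \<le> Q * \<tau>" unfolding \<tau>_def using elim(2) Q by (intro mult_left_mono) auto
        also have "C * (S + 1) * (18 * \<tau> * Q) + Q * \<tau> \<le> \<tau> * ((18 * C + 1) * (S + 1) * Q)"
        proof -
          have "\<tau> * Q * 1 \<le> \<tau> * Q * (S + 1)" using \<tau> Q S by (intro mult_left_mono) auto
          thus ?thesis by (simp add: algebra_simps)
        qed
        finally have "\<tau> * (\<Sum>n<X. \<alpha> n * (\<Sum>(m, m')\<in>E n. F m * F m')) \<le> \<tau> * ((18 * C + 1) * (S + 1) * Q)"
          using low by linarith
        hence "(\<Sum>n<X. \<alpha> n * (\<Sum>(m, m')\<in>E n. F m * F m')) \<le> (18 * C + 1) * (S + 1) * Q"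
          using \<tau> by (simp only: mult_le_cancel_left_pos)
        thus "(\<Sum>n<nat \<lceil>T\<^sup>2\<rceil>. window_coeff l \<sigma> \<omega> n * (\<Sum>(m, m')\<in>E n. F m * F m')) \<le>
            (18 * C + 1) * (S + 1) * (\<Sum>m\<in>M. (F m)\<^sup>2)"
          unfolding \<alpha>_def X_def Q_def .
      qed
    qed
  qed
qed

section \<open>Mertens' first theorem and a sum over primes\<close>

lemma multiplicity_fact_Suc:
  assumes "prime (p::nat)"
  shows "multiplicity p (fact (Suc n)) = multiplicity p (Suc n) + multiplicity p (fact n)"
  using assms by (simp only: fact_Suc of_nat_id) (intro prime_elem_multiplicity_mult_distrib, auto)

text \<open>Exactly the multiples of \<open>p\<close> contribute to the multiplicity, and dividing them by \<open>p\<close> leaves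
\<open>1, \<dots>, n div p\<close>.\<close>

lemma legendre_recursion:
  assumes "prime (p::nat)"
  shows "multiplicity p (fact n) = n div p + multiplicity p (fact (n div p))"
proof (induction n)
  case 0
  thus ?case by simp
next
  case (Suc n)
  show ?case
  proof (cases "p dvd Suc n")
    case True
    then obtain q where q: "Suc n = p * q" by auto
    have p0: "p > 0" using assms by (simp add: prime_gt_0_nat)
    have "q > 0" using q by (cases q) auto
    have d: "Suc n div p = q" using q p0 by simp
    have "Suc n div p = Suc (n div p)" using True p0 by (subst div_Suc) (auto simp: dvd_eq_mod_eq_0)
    hence q': "q = Suc (n div p)" using d by simp
    have "multiplicity p (Suc n) = Suc (multiplicity p q)"
      unfolding q using assms \<open>q > 0\<close> by (intro multiplicity_times_same) auto
    thus ?thesis using Suc.IH multiplicity_fact_Suc[OF assms, of n] multiplicity_fact_Suc[OF assms, of "n div p"]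
      unfolding d by (simp add: q' del: fact_Suc)
  next
    case False
    hence "Suc n div p = n div p" by (subst div_Suc) (auto simp: dvd_eq_mod_eq_0)
    thus ?thesis using Suc.IH False multiplicity_fact_Suc[OF assms, of n]
      by (simp add: not_dvd_imp_multiplicity_0 del: fact_Suc)
  qed
qed

lemma multiplicity_fact_le:
  assumes "prime (p::nat)"
  shows "real (multiplicity p (fact n)) \<le> real n / (real p - 1)"
proof (induction n rule: less_induct)
  case (less n)
  have p: "real p \<ge> 2" using prime_ge_2_nat[OF assms] by simp
  show ?case
  proof (cases "n = 0")
    case False
    hence "n div p < n" using prime_ge_2_nat[OF assms] by (intro div_less_dividend) auto
    have d: "real (n div p) \<le> real n / real p" by (rule of_nat_div_le_of_nat)
    have "real (multiplicity p (fact n)) = real (n div p) + real (multiplicity p (fact (n div p)))"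
      using legendre_recursion[OF assms, of n] by simp
    also have "\<dots> \<le> real (n div p) + real (n div p) / (real p - 1)" using less[OF \<open>n div p < n\<close>] by simp
    also have "\<dots> \<le> real n / real p + (real n / real p) / (real p - 1)"
      using d p by (intro add_mono divide_right_mono) auto
    also have "\<dots> = real n / (real p - 1)" using p by (simp add: field_simps)
    finally show ?thesis .
  qed auto
qed

lemma ln_eq_sum_multiplicity:
  assumes "n > 0"
  shows "ln (real n) = (\<Sum>p\<in>prime_factors n. real (multiplicity p n) * ln (real p))"
proof -
  have "real n = real (\<Prod>p\<in>prime_factors n. p ^ multiplicity p n)"
    using prime_factorization_nat[OF assms] by simp
  hence "ln (real n) = ln (\<Prod>p\<in>prime_factors n. real p ^ multiplicity p n)" by simp
  also have "\<dots> = (\<Sum>p\<in>prime_factors n. ln (real p ^ multiplicity p n))"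
    by (intro ln_prod) (auto simp: in_prime_factors_iff prime_gt_0_nat)
  also have "\<dots> = (\<Sum>p\<in>prime_factors n. real (multiplicity p n) * ln (real p))"
    by (intro sum.cong refl ln_realpow)
  finally show ?thesis .
qed

lemma ln_fact_eq:
  "ln (fact n) = (\<Sum>p\<in>{p. prime p \<and> p \<le> n}. real (multiplicity p (fact n)) * ln (real p))"
proof -
  have "prime_factors (fact n :: nat) = {p. prime p \<and> p \<le> n}"
    by (auto simp: in_prime_factors_iff prime_dvd_fact_iff)
  thus ?thesis using ln_eq_sum_multiplicity[of "fact n"] by simp
qed

lemma sum_ln_prime_divisors_le:
  assumes "n > 0" "finite A" "\<And>p. p \<in> A \<Longrightarrow> prime p \<and> p dvd n"
  shows "(\<Sum>p\<in>A. ln (real p)) \<le> ln (real n)"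
proof -
  have "(\<Sum>p\<in>A. ln (real p)) \<le> (\<Sum>p\<in>A. real (multiplicity p n) * ln (real p))"
  proof (rule sum_mono)
    fix p assume "p \<in> A"
    hence p: "prime p" "p dvd n" using assms by auto
    hence "multiplicity p n \<ge> 1" using assms(1) by (metis One_nat_def Suc_leI neq0_conv not_prime_unit multiplicity_gt_zero_iff prime_def)
    hence "1 * ln (real p) \<le> real (multiplicity p n) * ln (real p)"
      using prime_ge_2_nat[OF p(1)] by (intro mult_right_mono) auto
    thus "ln (real p) \<le> real (multiplicity p n) * ln (real p)" by simp
  qed
  also have "\<dots> \<le> (\<Sum>p\<in>prime_factors n. real (multiplicity p n) * ln (real p))"
    using assms by (intro sum_mono2) (auto simp: in_prime_factors_iff prime_ge_1_nat intro!: mult_nonneg_nonneg ln_ge_zero)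
  finally show ?thesis using ln_eq_sum_multiplicity[OF assms(1)] by simp
qed

text \<open>All primes in \<open>(n, 2 n]\<close> divide the central binomial coefficient, which is at most \<open>4^n\<close>; iterate along
powers of two.\<close>

lemma chebyshev_theta_le:
  "(\<Sum>p\<in>{p. prime p \<and> p \<le> n}. ln (real p)) \<le> 4 * real n"
proof (cases "n = 0")
  case False
  define \<theta> where "\<theta> = (\<lambda>n. \<Sum>p\<in>{p::nat. prime p \<and> p \<le> n}. ln (real p))"
  have fin: "finite {p::nat. prime p \<and> p \<le> n}" for n by (rule finite_subset[of _ "{..n}"]) auto
  have mono: "\<theta> m \<le> \<theta> n" if "m \<le> n" for m n
    unfolding \<theta>_def using that fin by (intro sum_mono2) (auto simp: prime_ge_1_nat intro!: ln_ge_zero)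
  have double: "\<theta> (2 * n) \<le> \<theta> n + 2 * real n * ln 2" for n
  proof -
    have "{p::nat. prime p \<and> p \<le> 2 * n} = {p. prime p \<and> p \<le> n} \<union> {p. prime p \<and> n < p \<and> p \<le> 2 * n}" by auto
    hence "\<theta> (2 * n) = \<theta> n + (\<Sum>p\<in>{p. prime p \<and> n < p \<and> p \<le> 2 * n}. ln (real p))"
      unfolding \<theta>_def using fin by (simp only:) (intro sum.union_disjoint, auto intro: finite_subset[OF _ fin[of "2 * n"]])
    also have "(\<Sum>p\<in>{p. prime p \<and> n < p \<and> p \<le> 2 * n}. ln (real p)) \<le> ln (real ((2 * n) choose n))"
    proof (rule sum_ln_prime_divisors_le)
      fix p assume p: "p \<in> {p. prime p \<and> n < p \<and> p \<le> 2 * n}"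
      have "fact n * fact n * ((2 * n) choose n) = (fact (2 * n) :: nat)"
        using binomial_fact_lemma[of n "2 * n"] by simp
      moreover have "p dvd fact (2 * n)" using p by (simp add: prime_dvd_fact_iff)
      ultimately have "p dvd fact n * fact n * ((2 * n) choose n)" by (simp only:)
      moreover have "\<not> p dvd fact n" using p by (simp add: prime_dvd_fact_iff)
      moreover have "prime p" using p by simp
      ultimately have "p dvd (2 * n choose n)" by (simp only: prime_dvd_mult_iff) blast
      thus "prime p \<and> p dvd (2 * n choose n)" using p by simp
    qed (auto intro: finite_subset[OF _ fin[of "2 * n"]])
    also have "\<dots> \<le> ln (real (2 ^ (2 * n)))"
      using binomial_le_pow2[of "2 * n" n] by (subst ln_le_cancel_iff) (auto simp del: of_nat_power)
    also have "\<dots> = 2 * real n * ln 2" by (simp add: ln_realpow)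
    finally show ?thesis by simp
  qed
  have pow: "\<theta> (2 ^ k) \<le> 2 * 2 ^ k * ln 2" for k
  proof (induction k)
    case 0
    have e: "{p::nat. prime p \<and> p \<le> 2 ^ 0} = {}" by (auto dest: prime_ge_2_nat)
    show ?case unfolding \<theta>_def e by simp
  next
    case (Suc k)
    show ?case using double[of "2 ^ k"] Suc by (simp add: algebra_simps)
  qed
  obtain k where k: "2 ^ k \<le> n" "n < 2 ^ (k + 1)" using ex_power_ivl1[of 2 n] False by auto
  have "\<theta> n \<le> \<theta> (2 ^ (k + 1))" using k by (intro mono) auto
  also have "\<dots> \<le> 2 * 2 ^ (k + 1) * ln 2" by (rule pow)
  also have "\<dots> \<le> 2 * 2 ^ (k + 1) * 1" using ln_2_less_1 by (intro mult_left_mono) auto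
  also have "\<dots> = 4 * real (2 ^ k)" by simp
  also have "\<dots> \<le> 4 * real n" using k(1) by (intro mult_left_mono of_nat_mono) auto
  finally show ?thesis by (simp add: \<theta>_def)
qed auto

lemma ln_fact_bounds:
  assumes "n \<ge> 1"
  shows "real n * ln (real n) - real n \<le> ln (fact n)" "ln (fact n) \<le> real n * ln (real n)"
proof -
  show "real n * ln (real n) - real n \<le> ln (fact n)"
    using assms
  proof (induction n rule: dec_induct)
    case base
    thus ?case by simp
  next
    case (step n)
    have n: "n > 0" using step by simp
    have "ln (1 + 1 / real n) \<le> 1 / real n" by (rule ln_add_one_self_le_self) simp
    moreover have "ln (1 + 1 / real n) = ln (real (Suc n)) - ln (real n)"
    proof -
      have "1 + 1 / real n = real (Suc n) / real n" using n by (simp add: field_simps)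
      thus ?thesis using n by (simp only:) (subst ln_div, auto)
    qed
    ultimately have "real n * (ln (real (Suc n)) - ln (real n)) \<le> real n * (1 / real n)" using n by (intro mult_left_mono) auto
    hence "real n * ln (real (Suc n)) - real n * ln (real n) \<le> 1" using n by (simp add: algebra_simps)
    moreover have "ln (fact (Suc n)) = ln (real (Suc n)) + ln (fact n)"
      unfolding fact_Suc by (subst ln_mult) auto
    moreover have "real (Suc n) * ln (real (Suc n)) = real n * ln (real (Suc n)) + ln (real (Suc n))" by (simp add: algebra_simps)
    ultimately show ?case using step.IH by (simp del: fact_Suc)
  qed
  have "fact n \<le> (real n) ^ n" using fact_le_power[of n, where ?'a = real] by simp
  hence "ln (fact n) \<le> ln (real n ^ n)" using assms by (subst ln_le_cancel_iff) auto
  thus "ln (fact n) \<le> real n * ln (real n)" using assms by (simp add: ln_realpow)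
qed

text \<open>Compare Stirling's estimate of \<open>log n!\<close> with its factorization: the multiplicity of \<open>p\<close> in \<open>n!\<close> lies
between \<open>n / p - 1\<close> and \<open>n / p + n / (p (p - 1))\<close>. The error in the lower bound for the multiplicity is
summed by Chebyshev's estimate, the error in the upper bound by a convergent series.\<close>

lemma mertens_nat:
  "\<exists>B>0. \<forall>n\<ge>1. \<bar>(\<Sum>p\<in>{p. prime p \<and> p \<le> n}. ln (real p) / real p) - ln (real n)\<bar> \<le> B"
proof -
  define h where "h = (\<lambda>k. ln (real k) / (real k * (real k - 1)))"
  have h_le: "h k \<le> 4 * real k powr (-3/2)" if "k \<ge> 2" for k
  proof -
    have k: "real k \<ge> 2" using that by simp
    have "ln (real k) \<le> real k powr (1/2) / (1/2)" using k by (intro ln_powr_bound) auto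
    hence "h k \<le> (2 * real k powr (1/2)) / (real k * (real k - 1))" unfolding h_def using k by (intro divide_right_mono) auto
    also have "\<dots> \<le> (2 * real k powr (1/2)) / (real k * (real k / 2))" using k by (intro divide_left_mono mult_left_mono) auto
    also have "\<dots> = 4 * (real k powr (1/2) / real k powr 2)" using k by (simp add: power2_eq_square)
    also have "real k powr (1/2) / real k powr 2 = real k powr (1/2 - 2)" by (rule powr_diff[symmetric])
    finally show ?thesis by simp
  qed
  define C where "C = (\<Sum>k. 4 * real k powr (-3/2))"
  have sm: "summable (\<lambda>k. 4 * real k powr (-3/2))" by (intro summable_mult) (simp add: summable_real_powr_iff)
  have C: "C \<ge> 0" unfolding C_def using sm by (intro suminf_nonneg) auto
  have "\<bar>(\<Sum>p\<in>{p. prime p \<and> p \<le> n}. ln (real p) / real p) - ln (real n)\<bar> \<le> C + 5" if n: "n \<ge> 1" for n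
  proof -
    define A where "A = {p. prime p \<and> p \<le> n}"
    define m where "m = (\<Sum>p\<in>A. ln (real p) / real p)"
    have fin: "finite A" unfolding A_def by (rule finite_subset[of _ "{..n}"]) auto
    have p2: "real p \<ge> 2" if "p \<in> A" for p using that prime_ge_2_nat[of p] by (auto simp: A_def)
    have n0: "real n > 0" using n by simp
    have up: "m \<le> ln (real n) + 4"
    proof -
      have "real n * m - 4 * real n \<le> (\<Sum>p\<in>A. (real n / real p - 1) * ln (real p))"
      proof -
        have "(\<Sum>p\<in>A. (real n / real p - 1) * ln (real p)) = real n * m - (\<Sum>p\<in>A. ln (real p))"
          unfolding m_def by (simp add: sum_distrib_left sum_subtractf[symmetric] algebra_simps)
        thus ?thesis using chebyshev_theta_le[of n] by (simp add: A_def)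
      qed
      also have "\<dots> \<le> (\<Sum>p\<in>A. real (multiplicity p (fact n)) * ln (real p))"
      proof (intro sum_mono mult_right_mono)
        fix p assume p: "p \<in> A"
        have "real n / real p - 1 \<le> real (n div p)"
        proof -
          have "real n = real (n div p) * real p + real (n mod p)"
            by (metis div_mult_mod_eq of_nat_add of_nat_mult)
          moreover have "real (n mod p) \<le> real p" using p2[OF p] by (intro of_nat_mono less_imp_le mod_less_divisor) auto
          ultimately have "real n \<le> (real (n div p) + 1) * real p" by (simp add: algebra_simps)
          hence "real n / real p \<le> real (n div p) + 1" using p2[OF p] by (simp add: divide_le_eq)
          thus ?thesis by linarith
        qed
        also have "\<dots> \<le> real (multiplicity p (fact n))" using legendre_recursion[of p n] p by (simp add: A_def)
        finally show "real n / real p - 1 \<le> real (multiplicity p (fact n))" .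
        show "0 \<le> ln (real p)" using p2[OF p] by simp
      qed
      also have "\<dots> = ln (fact n)" unfolding A_def by (rule ln_fact_eq[symmetric])
      also have "\<dots> \<le> real n * ln (real n)" by (rule ln_fact_bounds(2)[OF n])
      finally have "real n * m \<le> real n * (ln (real n) + 4)" by (simp add: algebra_simps)
      thus ?thesis using n0 by simp
    qed
    have low: "ln (real n) - 1 - C \<le> m"
    proof -
      have "real n * ln (real n) - real n \<le> ln (fact n)" by (rule ln_fact_bounds(1)[OF n])
      also have "\<dots> = (\<Sum>p\<in>A. real (multiplicity p (fact n)) * ln (real p))" unfolding A_def by (rule ln_fact_eq)
      also have "\<dots> \<le> (\<Sum>p\<in>A. real n / (real p - 1) * ln (real p))"
        using p2 by (intro sum_mono mult_right_mono multiplicity_fact_le) (auto simp: A_def Suc_le_eq prime_gt_0_nat intro!: ln_ge_zero)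
      also have "\<dots> = (\<Sum>p\<in>A. real n * (ln (real p) / real p) + real n * h p)"
      proof (intro sum.cong refl)
        fix p assume "p \<in> A"
        from p2[OF this] have "1 / (real p - 1) = 1 / real p + 1 / (real p * (real p - 1))" by (simp add: field_simps)
        hence "real n * ln (real p) * (1 / (real p - 1)) = real n * ln (real p) * (1 / real p + 1 / (real p * (real p - 1)))" by simp
        thus "real n / (real p - 1) * ln (real p) = real n * (ln (real p) / real p) + real n * h p"
          unfolding h_def by (simp add: algebra_simps)
      qed
      also have "\<dots> = real n * (m + (\<Sum>p\<in>A. h p))" by (simp add: m_def sum.distrib sum_distrib_left distrib_left)
      also have "(\<Sum>p\<in>A. h p) \<le> (\<Sum>p\<in>A. 4 * real p powr (-3/2))" using p2 by (intro sum_mono h_le) auto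
      also have "\<dots> \<le> C" unfolding C_def using sm fin by (intro sum_le_suminf) auto
      finally have "real n * ln (real n) - real n \<le> real n * (m + C)" using n0 by simp
      hence "real n * (ln (real n) - 1) \<le> real n * (m + C)" by (simp add: algebra_simps)
      thus ?thesis using n0 by simp
    qed
    show ?thesis using up low C unfolding m_def A_def by linarith
  qed
  thus ?thesis using C by (intro exI[of _ "C + 5"]) auto
qed

lemma mertens_interval:
  "\<exists>B>0. \<forall>x y::real. 1 \<le> x \<longrightarrow> x \<le> y \<longrightarrow>
     \<bar>(\<Sum>p\<in>{p. prime p \<and> x < real p \<and> real p \<le> y}. ln (real p) / real p) - (ln y - ln x)\<bar> \<le> B"
proof -
  obtain B where B: "B > 0" "\<And>n. n \<ge> 1 \<Longrightarrow> \<bar>(\<Sum>p\<in>{p. prime p \<and> p \<le> n}. ln (real p) / real p) - ln (real n)\<bar> \<le> B"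
    using mertens_nat by blast
  define m where "m = (\<lambda>x. \<Sum>p\<in>{p::nat. prime p \<and> real p \<le> x}. ln (real p) / real p)"
  have fin: "finite {p::nat. prime p \<and> real p \<le> x}" for x :: real
    by (rule finite_subset[of _ "{..nat \<lfloor>x\<rfloor>}"]) (auto simp: le_nat_floor)
  have mx: "\<bar>m x - ln x\<bar> \<le> B + 1" if "x \<ge> 1" for x
  proof -
    define n where "n = nat \<lfloor>x\<rfloor>"
    have f: "1 \<le> \<lfloor>x\<rfloor>" using that by (simp add: le_floor_iff)
    hence rn: "real n = real_of_int \<lfloor>x\<rfloor>" by (simp add: n_def)
    have f': "1 \<le> real_of_int \<lfloor>x\<rfloor>" using f by simp
    have n: "n \<ge> 1" "real n \<le> x" "x \<le> 2 * real n"
      using f' real_of_int_floor_add_one_gt[of x] of_int_floor_le[of x] unfolding rn[symmetric] by linarith+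
    have "{p::nat. prime p \<and> real p \<le> x} = {p. prime p \<and> p \<le> n}"
      using that unfolding n_def by (auto simp: le_nat_iff le_floor_iff)
    hence "\<bar>m x - ln (real n)\<bar> \<le> B" using B(2)[OF n(1)] by (simp add: m_def)
    moreover have "ln (real n) \<le> ln x" using n by simp
    moreover have "ln x \<le> ln (2 * real n)" using n that by simp
    moreover have "ln (2 * real n) \<le> 1 + ln (real n)" using n ln_2_less_1 by (simp add: ln_mult)
    ultimately show ?thesis by linarith
  qed
  have "\<bar>(\<Sum>p\<in>{p. prime p \<and> x < real p \<and> real p \<le> y}. ln (real p) / real p) - (ln y - ln x)\<bar> \<le> 2 * (B + 1)"
    if "1 \<le> x" "x \<le> y" for x y :: real
  proof -
    have "{p::nat. prime p \<and> real p \<le> y} = {p. prime p \<and> real p \<le> x} \<union> {p. prime p \<and> x < real p \<and> real p \<le> y}"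
      using that by auto
    moreover define s where "s = (\<Sum>p\<in>{p::nat. prime p \<and> x < real p \<and> real p \<le> y}. ln (real p) / real p)"
    ultimately have "m y = m x + s"
      unfolding m_def s_def using fin by (simp only:) (intro sum.union_disjoint, auto intro: finite_subset[OF _ fin[of y]])
    moreover have "\<bar>m x - ln x\<bar> \<le> B + 1" "\<bar>m y - ln y\<bar> \<le> B + 1" using mx that by auto
    moreover have "s - (ln y - ln x) = (m y - ln y) - (m x - ln x)" using \<open>m y = m x + s\<close> by simp
    ultimately have "\<bar>s - (ln y - ln x)\<bar> \<le> 2 * (B + 1)"
      using abs_triangle_ineq4[of "m y - ln y" "m x - ln x"] by (smt (verit))
    thus ?thesis by (simp add: s_def)
  qed
  thus ?thesis using B(1) by (intro exI[of _ "2 * (B + 1)"]) auto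
qed

text \<open>Partial summation in integral form: \<open>1 / u = 1 / x1 + \<integral> dv / v\<^sup>2\<close> over \<open>u \<le> v \<le> x1\<close>, so the sum is at least
what one obtains from replacing the counting function of the weights \<open>log p / p\<close> by \<open>v - x0 - B\<close>.\<close>

lemma sum_primes_inverse_log_shift:
  fixes a x0 x1 B :: real
  assumes mertens: "\<And>v. x0 \<le> v \<Longrightarrow> v \<le> x1 \<Longrightarrow>
      v - x0 - B \<le> (\<Sum>p\<in>{p::nat. prime p \<and> x0 < ln (real p) - a \<and> ln (real p) - a \<le> v}. ln (real p) / real p)"
    and x: "0 < x0" "x0 \<le> x1"
  shows "ln (x1 / x0) - B / x0 \<le> (\<Sum>p\<in>{p::nat. prime p \<and> x0 < ln (real p) - a \<and> ln (real p) - a \<le> x1}.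
            ln (real p) / (real p * (ln (real p) - a)))"
proof -
  define A where "A = {p::nat. prime p \<and> x0 < ln (real p) - a \<and> ln (real p) - a \<le> x1}"
  define u where "u = (\<lambda>p::nat. ln (real p) - a)"
  define c where "c = (\<lambda>p::nat. ln (real p) / real p)"
  have fin: "finite A"
  proof (rule finite_subset)
    show "A \<subseteq> {..nat \<lfloor>exp (a + x1)\<rfloor>}"
    proof
      fix p assume "p \<in> A"
      hence "ln (real p) \<le> a + x1" "p > 0" by (auto simp: A_def prime_gt_0_nat)
      hence "real p \<le> exp (a + x1)" by (metis exp_le_cancel_iff exp_ln of_nat_0_less_iff)
      thus "p \<in> {..nat \<lfloor>exp (a + x1)\<rfloor>}" by (simp add: le_nat_floor)
    qed
  qed auto
  have uA: "x0 < u p" "u p \<le> x1" if "p \<in> A" for p using that by (auto simp: A_def u_def)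
  have int1: "((\<lambda>v. if v \<in> {u p..x1} then c p * (1 / v\<^sup>2) else 0) has_integral (c p * (1 / u p - 1 / x1))) {x0..x1}" if "p \<in> A" for p
  proof -
    have "((\<lambda>v. 1 / v\<^sup>2) has_integral ((- 1 / x1) - (- 1 / u p))) {u p..x1}"
    proof (rule fundamental_theorem_of_calculus)
      fix v assume "v \<in> {u p..x1}"
      hence "v > 0" using uA[OF that] x by auto
      thus "((\<lambda>v. - 1 / v) has_vector_derivative 1 / v\<^sup>2) (at v within {u p..x1})"
        unfolding has_real_derivative_iff_has_vector_derivative[symmetric]
        by (auto intro!: derivative_eq_intros simp: power2_eq_square)
    qed (use uA[OF that] in auto)
    hence "((\<lambda>v. c p * (1 / v\<^sup>2)) has_integral (c p * (1 / u p - 1 / x1))) {u p..x1}"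
      by (intro has_integral_mult_right) simp
    moreover have "{u p..x1} \<subseteq> {x0..x1}" using uA[OF that] by auto
    ultimately show ?thesis by (simp only: has_integral_restrict)
  qed
  have int2: "((\<lambda>v. \<Sum>p\<in>A. if v \<in> {u p..x1} then c p * (1 / v\<^sup>2) else 0) has_integral (\<Sum>p\<in>A. c p * (1 / u p - 1 / x1))) {x0..x1}"
    using fin int1 by (intro has_integral_sum) auto
  have int3: "((\<lambda>v. (v - x0 - B) / v\<^sup>2) has_integral ((ln x1 + (x0 + B) / x1) - (ln x0 + (x0 + B) / x0))) {x0..x1}"
  proof (rule fundamental_theorem_of_calculus)
    fix v assume "v \<in> {x0..x1}"
    hence "v > 0" using x by auto
    thus "((\<lambda>v. ln v + (x0 + B) / v) has_vector_derivative (v - x0 - B) / v\<^sup>2) (at v within {x0..x1})"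
      unfolding has_real_derivative_iff_has_vector_derivative[symmetric]
      by (auto intro!: derivative_eq_intros simp: power2_eq_square field_simps)
  qed (use x in auto)
  have "(ln x1 + (x0 + B) / x1) - (ln x0 + (x0 + B) / x0) \<le> (\<Sum>p\<in>A. c p * (1 / u p - 1 / x1))"
  proof (rule has_integral_le[OF int3 int2])
    fix v assume v: "v \<in> {x0..x1}"
    have eq: "{p\<in>A. u p \<le> v} = {p::nat. prime p \<and> x0 < ln (real p) - a \<and> ln (real p) - a \<le> v}"
      using v by (auto simp: A_def u_def)
    have "(\<Sum>p\<in>A. if v \<in> {u p..x1} then c p * (1 / v\<^sup>2) else 0) = (\<Sum>p\<in>{p\<in>A. u p \<le> v}. c p * (1 / v\<^sup>2))"
      using fin v by (simp add: sum.If_cases Int_def)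
    also have "\<dots> = (\<Sum>p\<in>{p\<in>A. u p \<le> v}. c p) / v\<^sup>2" by (simp add: sum_divide_distrib)
    also have "\<dots> \<ge> (v - x0 - B) / v\<^sup>2"
      unfolding eq c_def using v by (intro divide_right_mono mertens) auto
    finally show "(v - x0 - B) / v\<^sup>2 \<le> (\<Sum>p\<in>A. if v \<in> {u p..x1} then c p * (1 / v\<^sup>2) else 0)" .
  qed
  also have "\<dots> = (\<Sum>p\<in>A. c p / u p) - (\<Sum>p\<in>A. c p) / x1"
    by (simp add: right_diff_distrib sum_subtractf sum_divide_distrib)
  finally have "(ln x1 + (x0 + B) / x1) - (ln x0 + (x0 + B) / x0) + (\<Sum>p\<in>A. c p) / x1 \<le> (\<Sum>p\<in>A. c p / u p)" by linarith
  moreover have "(x1 - x0 - B) / x1 \<le> (\<Sum>p\<in>A. c p) / x1"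
    unfolding c_def A_def using x by (intro divide_right_mono mertens) auto
  moreover have "(ln x1 + (x0 + B) / x1) - (ln x0 + (x0 + B) / x0) + (x1 - x0 - B) / x1 = ln (x1 / x0) - B / x0"
    using x by (simp add: ln_div field_simps)
  moreover have "(\<Sum>p\<in>A. c p / u p) = (\<Sum>p\<in>A. ln (real p) / (real p * (ln (real p) - a)))"
    by (simp add: c_def u_def)
  ultimately show ?thesis unfolding A_def by linarith
qed

section \<open>Correlations of multiplicative weights on vectors of prime exponents\<close>

text \<open>The exponent vectors of the rational numbers used by the resonator. The linear cost constraint takes
the place of a direct bound on their number.\<close>

definition bounded_cost :: "nat set \<Rightarrow> (nat \<Rightarrow> real) \<Rightarrow> real \<Rightarrow> (nat \<Rightarrow> int) set" where
  "bounded_cost P c Z = {e \<in> PiE P (\<lambda>_. {-1, 0, 1}). (\<Sum>p\<in>P. c p * \<bar>real_of_int (e p)\<bar>) \<le> Z}"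

definition weight :: "nat set \<Rightarrow> (nat \<Rightarrow> real) \<Rightarrow> (nat \<Rightarrow> int) \<Rightarrow> real" where
  "weight P f e = (\<Prod>p\<in>P. f p ^ nat \<bar>e p\<bar>)"

text \<open>Pairs of vectors whose rational numbers differ by the factor \<open>\<Prod>Q\<close>.\<close>

definition shift_pairs :: "nat set \<Rightarrow> (nat \<Rightarrow> int) set \<Rightarrow> nat set \<Rightarrow> ((nat \<Rightarrow> int) \<times> (nat \<Rightarrow> int)) set" where
  "shift_pairs P M Q = {(e, e'). e \<in> M \<and> e' \<in> M \<and> (\<forall>p\<in>P. e' p = e p + of_bool (p \<in> Q))}"

lemma bounded_cost_extensional: "e \<in> bounded_cost P c Z \<Longrightarrow> e \<in> extensional P"
  by (auto simp: bounded_cost_def PiE_def)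

lemma finite_bounded_cost:
  assumes "finite P"
  shows "finite (bounded_cost P c Z)"
  by (rule finite_subset[of _ "PiE P (\<lambda>_. {-1, 0, 1})"]) (use assms in \<open>auto simp: bounded_cost_def intro!: finite_PiE\<close>)

lemma shift_pairs_injective:
  assumes "M \<subseteq> extensional P"
  shows "inj_on fst (shift_pairs P M Q)" "inj_on snd (shift_pairs P M Q)"
proof -
  have ext: "x = y" if "x \<in> M" "y \<in> M" "\<And>p. p \<in> P \<Longrightarrow> x p = y p" for x y
    using that assms by (intro extensionalityI[of _ P]) auto
  show "inj_on fst (shift_pairs P M Q)"
    by (rule inj_onI) (auto simp: shift_pairs_def intro!: ext)
  show "inj_on snd (shift_pairs P M Q)"
  proof (rule inj_onI)
    fix x y assume xy: "x \<in> shift_pairs P M Q" "y \<in> shift_pairs P M Q" "snd x = snd y"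
    have "fst x p = fst y p" if "p \<in> P" for p
    proof -
      have "snd x p = fst x p + of_bool (p \<in> Q)" "snd y p = fst y p + of_bool (p \<in> Q)"
        using xy that by (auto simp: shift_pairs_def)
      thus ?thesis using xy(3) by simp
    qed
    hence "fst x = fst y" using xy by (intro ext) (auto simp: shift_pairs_def)
    thus "x = y" using xy(3) by (simp add: prod_eq_iff)
  qed
qed

text \<open>Rankin's trick: every admissible vector satisfies \<open>1 \<le> exp (Z - cost)\<close>, and the sum of the right-hand side over all vectors is a product over the primes.\<close>

lemma card_bounded_cost_le:
  assumes "finite P"
  shows "real (card (bounded_cost P c Z)) \<le> exp (Z + 2 * (\<Sum>p\<in>P. exp (- c p)))"
proof -
  let ?E = "PiE P (\<lambda>_. {-1, 0, 1::int})"
  have finE: "finite ?E" using assms by (intro finite_PiE) auto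
  have "real (card (bounded_cost P c Z)) = (\<Sum>e\<in>bounded_cost P c Z. 1)" by simp
  also have "\<dots> \<le> (\<Sum>e\<in>bounded_cost P c Z. exp Z * (\<Prod>p\<in>P. exp (- (c p * \<bar>real_of_int (e p)\<bar>))))"
  proof (rule sum_mono)
    fix e assume "e \<in> bounded_cost P c Z"
    hence "0 \<le> Z - (\<Sum>p\<in>P. c p * \<bar>real_of_int (e p)\<bar>)" by (simp add: bounded_cost_def)
    hence "1 \<le> exp (Z + (\<Sum>p\<in>P. - (c p * \<bar>real_of_int (e p)\<bar>)))" by (simp add: sum_negf)
    thus "1 \<le> exp Z * (\<Prod>p\<in>P. exp (- (c p * \<bar>real_of_int (e p)\<bar>)))" using assms by (simp only: exp_add exp_sum)
  qed
  also have "\<dots> \<le> (\<Sum>e\<in>?E. exp Z * (\<Prod>p\<in>P. exp (- (c p * \<bar>real_of_int (e p)\<bar>))))"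
    using finE by (intro sum_mono2) (auto simp: bounded_cost_def intro!: mult_nonneg_nonneg prod_nonneg)
  also have "\<dots> = exp Z * (\<Prod>p\<in>P. \<Sum>x\<in>{-1, 0, 1::int}. exp (- (c p * \<bar>real_of_int x\<bar>)))"
    using assms by (simp only: sum_distrib_left[symmetric]) (subst prod_sum_PiE, auto)
  also have "\<dots> \<le> exp Z * (\<Prod>p\<in>P. exp (2 * exp (- c p)))"
  proof (intro mult_left_mono prod_mono conjI)
    fix p
    have "(\<Sum>x\<in>{-1, 0, 1::int}. exp (- (c p * \<bar>real_of_int x\<bar>))) = 1 + 2 * exp (- c p)" by simp
    also have "\<dots> \<le> exp (2 * exp (- c p))" by (rule exp_ge_add_one_self)
    finally show "(\<Sum>x\<in>{-1, 0, 1::int}. exp (- (c p * \<bar>real_of_int x\<bar>))) \<le> exp (2 * exp (- c p))" .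
  qed (auto intro!: sum_nonneg)
  also have "\<dots> = exp (Z + 2 * (\<Sum>p\<in>P. exp (- c p)))" using assms by (simp add: exp_add exp_sum sum_distrib_left)
  finally show ?thesis .
qed

lemma sum_weight_square_le:
  assumes "finite P"
  shows "(\<Sum>e\<in>bounded_cost P c Z. (weight P f e)\<^sup>2) \<le> (\<Prod>p\<in>P. 1 + 2 * (f p)\<^sup>2)"
proof -
  let ?E = "PiE P (\<lambda>_. {-1, 0, 1::int})"
  have finE: "finite ?E" using assms by (intro finite_PiE) auto
  have "(\<Sum>e\<in>bounded_cost P c Z. (weight P f e)\<^sup>2) \<le> (\<Sum>e\<in>?E. (weight P f e)\<^sup>2)"
    using finE by (intro sum_mono2) (auto simp: bounded_cost_def)
  also have "\<dots> = (\<Sum>e\<in>?E. \<Prod>p\<in>P. (f p ^ nat \<bar>e p\<bar>)\<^sup>2)" by (simp add: weight_def prod_power_distrib)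
  also have "\<dots> = (\<Prod>p\<in>P. \<Sum>x\<in>{-1, 0, 1::int}. (f p ^ nat \<bar>x\<bar>)\<^sup>2)"
    using assms by (subst prod_sum_PiE) auto
  also have "\<dots> = (\<Prod>p\<in>P. 1 + 2 * (f p)\<^sup>2)" by (intro prod.cong) auto
  finally show ?thesis .
qed

text \<open>The possible behaviour at one prime of a pair of vectors that differ by multiplication with a
squarefree number: the exponent of the first vector and the increment.\<close>

definition moves :: "(int \<times> int) set" where
  "moves = {(0, 0), (1, 0), (-1, 0), (0, 1), (-1, 1)}"

text \<open>The mean of a sum of local functions under a product measure, unnormalized. As all local masses are at
least \<open>1\<close>, the total mass may be completed at the prime that carries the local function.\<close>

lemma sum_linear_functional_PiE:
  fixes \<omega> h :: "'a \<Rightarrow> 'b \<Rightarrow> real"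
  assumes P: "finite P" and B: "finite B" and \<omega>: "\<And>p x. p \<in> P \<Longrightarrow> x \<in> B \<Longrightarrow> 0 \<le> \<omega> p x"
    and h: "\<And>p x. p \<in> P \<Longrightarrow> x \<in> B \<Longrightarrow> 0 \<le> h p x"
    and one: "\<And>p. p \<in> P \<Longrightarrow> 1 \<le> (\<Sum>x\<in>B. \<omega> p x)"
  shows "(\<Sum>s\<in>PiE P (\<lambda>_. B). (\<Sum>p\<in>P. h p (s p)) * (\<Prod>p\<in>P. \<omega> p (s p)))
      \<le> (\<Sum>p\<in>P. \<Sum>x\<in>B. h p x * \<omega> p x) * (\<Prod>p\<in>P. \<Sum>x\<in>B. \<omega> p x)"
proof -
  have "(\<Sum>s\<in>PiE P (\<lambda>_. B). (\<Sum>p\<in>P. h p (s p)) * (\<Prod>p\<in>P. \<omega> p (s p)))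
      = (\<Sum>p\<in>P. \<Sum>s\<in>PiE P (\<lambda>_. B). h p (s p) * (\<Prod>q\<in>P. \<omega> q (s q)))"
    by (simp only: sum_distrib_right) (rule sum.swap)
  also have "\<dots> \<le> (\<Sum>p\<in>P. (\<Sum>x\<in>B. h p x * \<omega> p x) * (\<Prod>q\<in>P. \<Sum>x\<in>B. \<omega> q x))"
  proof (rule sum_mono)
    fix p assume p: "p \<in> P"
    define \<omega>' where "\<omega>' = (\<lambda>q x. if q = p then h p x * \<omega> p x else \<omega> q x)"
    have rm: "(\<Prod>q\<in>P. k q) = k p * (\<Prod>q\<in>P-{p}. k q)" for k :: "'a \<Rightarrow> real" using P p by (rule prod.remove)
    have "(\<Sum>s\<in>PiE P (\<lambda>_. B). h p (s p) * (\<Prod>q\<in>P. \<omega> q (s q))) = (\<Sum>s\<in>PiE P (\<lambda>_. B). \<Prod>q\<in>P. \<omega>' q (s q))"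
    proof (intro sum.cong refl)
      fix s
      have "(\<Prod>q\<in>P-{p}. \<omega>' q (s q)) = (\<Prod>q\<in>P-{p}. \<omega> q (s q))" by (intro prod.cong) (auto simp: \<omega>'_def)
      thus "h p (s p) * (\<Prod>q\<in>P. \<omega> q (s q)) = (\<Prod>q\<in>P. \<omega>' q (s q))"
        unfolding rm by (simp add: \<omega>'_def mult_ac)
    qed
    also have "\<dots> = (\<Prod>q\<in>P. \<Sum>x\<in>B. \<omega>' q x)" using P B by (subst prod_sum_PiE) auto
    also have "\<dots> = (\<Sum>x\<in>B. \<omega>' p x) * (\<Prod>q\<in>P-{p}. \<Sum>x\<in>B. \<omega>' q x)" by (rule rm)
    also have "(\<Prod>q\<in>P-{p}. \<Sum>x\<in>B. \<omega>' q x) = (\<Prod>q\<in>P-{p}. \<Sum>x\<in>B. \<omega> q x)" by (intro prod.cong) (auto simp: \<omega>'_def)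
    also have "(\<Sum>x\<in>B. \<omega>' p x) = (\<Sum>x\<in>B. h p x * \<omega> p x)" by (simp add: \<omega>'_def)
    also have "(\<Sum>x\<in>B. h p x * \<omega> p x) * (\<Prod>q\<in>P-{p}. \<Sum>x\<in>B. \<omega> q x) \<le> (\<Sum>x\<in>B. h p x * \<omega> p x) * (\<Prod>q\<in>P. \<Sum>x\<in>B. \<omega> q x)"
    proof (rule mult_left_mono)
      have "0 \<le> (\<Prod>q\<in>P-{p}. \<Sum>x\<in>B. \<omega> q x)" using \<omega> by (intro prod_nonneg sum_nonneg) auto
      from mult_right_mono[OF one[OF p] this]
      show "(\<Prod>q\<in>P-{p}. \<Sum>x\<in>B. \<omega> q x) \<le> (\<Prod>q\<in>P. \<Sum>x\<in>B. \<omega> q x)" unfolding rm by simp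
      show "0 \<le> (\<Sum>x\<in>B. h p x * \<omega> p x)" using p \<omega> h by (intro sum_nonneg mult_nonneg_nonneg) auto
    qed
    finally show "(\<Sum>s\<in>PiE P (\<lambda>_. B). h p (s p) * (\<Prod>q\<in>P. \<omega> q (s q))) \<le> (\<Sum>x\<in>B. h p x * \<omega> p x) * (\<Prod>q\<in>P. \<Sum>x\<in>B. \<omega> q x)" .
  qed
  finally show ?thesis by (simp add: sum_distrib_right)
qed

text \<open>Without constraints the correlation sum is the sum over all assignments of a move to each prime, and
it factors. Markov's inequality is applied to the cost of the pair in units of \<open>Z\<close> plus the logarithm
of the shift in units of \<open>Y\<close>: its mean under the product measure is at most \<open>B\<close>, and where it is at most
\<open>1\<close> both vectors have cost at most \<open>Z\<close> and the shift is at most \<open>exp Y\<close>.\<close>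

lemma shift_correlation_ge:
  fixes P :: "nat set" and f c w :: "nat \<Rightarrow> real"
  assumes P: "finite P" and pos: "\<And>p. p \<in> P \<Longrightarrow> 0 \<le> f p \<and> 0 \<le> c p \<and> 0 \<le> w p \<and> 1 \<le> p" and ZY: "Z > 0" "Y > 0"
  defines "M \<equiv> bounded_cost P c Z"
  defines "B \<equiv> (\<Sum>p\<in>P. c p * (2 * (f p)\<^sup>2 + 2 * f p * w p) / Z + 2 * f p * w p * ln (real p) / Y)"
  shows "(1 - B) * (\<Prod>p\<in>P. 1 + 2 * (f p)\<^sup>2 + 2 * f p * w p) \<le>
     (\<Sum>Q\<in>{Q \<in> Pow P. (\<Sum>p\<in>Q. ln (real p)) \<le> Y}. (\<Prod>p\<in>Q. w p) * (\<Sum>(e, e')\<in>shift_pairs P M Q. weight P f e * weight P f e'))"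
proof -
  define \<omega> where "\<omega> = (\<lambda>p (x :: int \<times> int). f p ^ nat \<bar>fst x\<bar> * f p ^ nat \<bar>fst x + snd x\<bar> * w p ^ nat (snd x))"
  define h where "h = (\<lambda>p (x :: int \<times> int). (if x = (0, 0) then 0 else c p) / Z + real_of_int (snd x) * ln (real p) / Y)"
  define S where "S = PiE P (\<lambda>_. moves)"
  define g where "g = (\<lambda>s. \<Sum>p\<in>P. h p (s p))"
  define wt where "wt = (\<lambda>s. \<Prod>p\<in>P. \<omega> p (s p))"
  define good where "good = {s\<in>S. g s \<le> 1}"
  define W where "W = (\<Prod>p\<in>P. \<Sum>x\<in>moves. \<omega> p x)"
  define \<Q> where "\<Q> = {Q \<in> Pow P. (\<Sum>p\<in>Q. ln (real p)) \<le> Y}"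
  have fm: "finite moves" by (simp add: moves_def)
  have finS: "finite S" unfolding S_def using P fm by (intro finite_PiE) auto
  have s\<omega>: "(\<Sum>x\<in>moves. \<omega> p x) = 1 + 2 * (f p)\<^sup>2 + 2 * f p * w p" for p
    by (simp add: moves_def \<omega>_def power2_eq_square)
  have sh: "(\<Sum>x\<in>moves. h p x * \<omega> p x) = c p * (2 * (f p)\<^sup>2 + 2 * f p * w p) / Z + 2 * f p * w p * ln (real p) / Y" for p
    by (simp add: moves_def \<omega>_def h_def power2_eq_square add_divide_distrib algebra_simps)
  have \<omega>0: "0 \<le> \<omega> p x" if "p \<in> P" for p x using pos[OF that] by (auto simp: \<omega>_def)
  have h0: "0 \<le> h p x" if "p \<in> P" "x \<in> moves" for p x
    using pos[OF that(1)] that(2) ZY by (auto simp: h_def moves_def)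
  have wt0: "0 \<le> wt s" for s unfolding wt_def by (intro prod_nonneg) (auto intro: \<omega>0)
  have finP: "finite \<Q>" using P by (auto simp: \<Q>_def)
  have finSP: "finite (shift_pairs P M Q)" for Q
    by (rule finite_subset[of _ "M \<times> M"]) (auto simp: shift_pairs_def M_def finite_bounded_cost[OF P])
  have "(\<Sum>s\<in>S. g s * wt s) \<le> B * W"
    unfolding S_def g_def wt_def W_def B_def sh[symmetric]
  proof (rule sum_linear_functional_PiE[OF P fm])
    show "1 \<le> (\<Sum>x\<in>moves. \<omega> p x)" if "p \<in> P" for p unfolding s\<omega> using pos[OF that] by simp
  qed (auto intro: \<omega>0 h0)
  moreover have "(\<Sum>s\<in>S. wt s) = W" unfolding S_def wt_def W_def using P fm by (subst prod_sum_PiE) auto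
  ultimately have "(1 - B) * W \<le> (\<Sum>s\<in>S. (1 - g s) * wt s)" by (simp add: left_diff_distrib sum_subtractf)
  also have "\<dots> \<le> (\<Sum>s\<in>S. if s \<in> good then wt s else 0)"
  proof (rule sum_mono)
    fix s assume s: "s \<in> S"
    have "g s \<ge> 0" unfolding g_def using s by (intro sum_nonneg h0) (auto simp: S_def)
    hence "(1 - g s) * wt s \<le> 1 * wt s" using wt0 by (intro mult_right_mono) auto
    moreover have "(1 - g s) * wt s \<le> 0" if "s \<notin> good"
      using that s wt0[of s] by (auto simp: good_def intro!: mult_nonpos_nonneg)
    ultimately show "(1 - g s) * wt s \<le> (if s \<in> good then wt s else 0)" by auto
  qed
  also have "\<dots> = (\<Sum>s\<in>good. wt s)" using finS by (simp add: sum.If_cases good_def Int_def)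
  also have "\<dots> \<le> (\<Sum>(Q, e, e')\<in>Sigma \<Q> (shift_pairs P M). (\<Prod>p\<in>Q. w p) * (weight P f e * weight P f e'))"
  proof -
    \<comment> \<open>The map \<open>\<phi>\<close> reads off the shift and the pair of vectors from an assignment of moves.\<close>
    define \<phi> where "\<phi> = (\<lambda>s :: nat \<Rightarrow> int \<times> int. ({p\<in>P. snd (s p) = 1}, (\<lambda>p\<in>P. fst (s p)), (\<lambda>p\<in>P. fst (s p) + snd (s p))))"
    have inj: "inj_on \<phi> good"
    proof (rule inj_onI)
      fix s t assume st: "s \<in> good" "t \<in> good" "\<phi> s = \<phi> t"
      have 1: "fst (s p) = fst (t p)" if "p \<in> P" for p
      proof -
        have "(\<lambda>p\<in>P. fst (s p)) p = (\<lambda>p\<in>P. fst (t p)) p" using st(3) by (simp add: \<phi>_def)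
        thus ?thesis using that by simp
      qed
      have 2: "fst (s p) + snd (s p) = fst (t p) + snd (t p)" if "p \<in> P" for p
      proof -
        have "(\<lambda>p\<in>P. fst (s p) + snd (s p)) p = (\<lambda>p\<in>P. fst (t p) + snd (t p)) p" using st(3) by (simp add: \<phi>_def)
        thus ?thesis using that by simp
      qed
      show "s = t"
      proof (rule PiE_ext[of s P "\<lambda>_. moves" t])
        show "s p = t p" if "p \<in> P" for p using 1[OF that] 2[OF that] by (simp add: prod_eq_iff)
      qed (use st in \<open>auto simp: good_def S_def\<close>)
    qed
    have cases_s: "s p \<in> moves" if "s \<in> good" "p \<in> P" for s p using that by (auto simp: good_def S_def)
    have b01: "snd (s p) = 0 \<or> snd (s p) = 1" if "s \<in> good" "p \<in> P" for s p
      using cases_s[OF that] by (auto simp: moves_def)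
    have into: "\<phi> s \<in> Sigma \<Q> (shift_pairs P M)" if s: "s \<in> good" for s
    proof -
      have g1: "(\<Sum>p\<in>P. (if s p = (0, 0) then 0 else c p) / Z) + (\<Sum>p\<in>P. real_of_int (snd (s p)) * ln (real p) / Y) \<le> 1"
        using s by (simp add: good_def g_def h_def sum.distrib)
      have n1: "0 \<le> (\<Sum>p\<in>P. (if s p = (0, 0) then 0 else c p) / Z)" using pos ZY by (intro sum_nonneg) auto
      have n2: "0 \<le> (\<Sum>p\<in>P. real_of_int (snd (s p)) * ln (real p) / Y)"
        using pos ZY cases_s[OF s] by (intro sum_nonneg divide_nonneg_pos mult_nonneg_nonneg) (force simp: moves_def)+
      have cost: "(\<Sum>p\<in>P. if s p = (0, 0) then 0 else c p) \<le> Z"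
      proof -
        have "(\<Sum>p\<in>P. (if s p = (0, 0) then 0 else c p) / Z) \<le> 1" using g1 n2 by linarith
        thus ?thesis using ZY by (simp add: sum_divide_distrib[symmetric] divide_le_eq)
      qed
      have inM: "(\<lambda>p\<in>P. k (s p)) \<in> M" if k: "\<And>x. x \<in> moves \<Longrightarrow> k x \<in> {-1, 0, 1} \<and> (x = (0, 0) \<longrightarrow> k x = 0)" for k
        unfolding M_def bounded_cost_def
      proof (intro CollectI conjI)
        show "(\<lambda>p\<in>P. k (s p)) \<in> P \<rightarrow>\<^sub>E {-1, 0, 1}" using k cases_s[OF s] by (intro restrict_PiE_iff[THEN iffD2]) auto
        have "(\<Sum>p\<in>P. c p * \<bar>real_of_int ((\<lambda>p\<in>P. k (s p)) p)\<bar>) \<le> (\<Sum>p\<in>P. if s p = (0, 0) then 0 else c p)"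
        proof (rule sum_mono)
          fix p assume p: "p \<in> P"
          thus "c p * \<bar>real_of_int ((\<lambda>p\<in>P. k (s p)) p)\<bar> \<le> (if s p = (0, 0) then 0 else c p)"
            using k[OF cases_s[OF s p]] pos[OF p] by auto
        qed
        thus "(\<Sum>p\<in>P. c p * \<bar>real_of_int ((\<lambda>p\<in>P. k (s p)) p)\<bar>) \<le> Z" using cost by linarith
      qed
      have "(\<lambda>p\<in>P. fst (s p)) \<in> M" by (rule inM) (auto simp: moves_def)
      moreover have "(\<lambda>p\<in>P. fst (s p) + snd (s p)) \<in> M" by (rule inM[of "\<lambda>x. fst x + snd x"]) (auto simp: moves_def)
      moreover have "snd (s p) = of_bool (p \<in> {p\<in>P. snd (s p) = 1})" if "p \<in> P" for p
        using cases_s[OF s that] that by (auto simp: moves_def)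
      moreover have "{p\<in>P. snd (s p) = 1} \<in> \<Q>"
      proof -
        have "(\<Sum>p\<in>{p\<in>P. snd (s p) = 1}. ln (real p)) = (\<Sum>p\<in>P. real_of_int (snd (s p)) * ln (real p))"
          using P by (intro sum.mono_neutral_cong_left) (auto dest: b01[OF s])
        also have "\<dots> \<le> Y"
        proof -
          have "(\<Sum>p\<in>P. real_of_int (snd (s p)) * ln (real p) / Y) \<le> 1" using g1 n1 by linarith
          thus ?thesis using ZY by (simp add: sum_divide_distrib[symmetric] divide_le_eq)
        qed
        finally show ?thesis by (simp add: \<Q>_def)
      qed
      ultimately show ?thesis by (auto simp: \<phi>_def shift_pairs_def)
    qed
    have val: "wt s = (case \<phi> s of (Q, e, e') \<Rightarrow> (\<Prod>p\<in>Q. w p) * (weight P f e * weight P f e'))" if s: "s \<in> good" for s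
    proof -
      have "(\<Prod>p\<in>{p\<in>P. snd (s p) = 1}. w p) = (\<Prod>p\<in>P. w p ^ nat (snd (s p)))"
        using P by (intro prod.mono_neutral_cong_left) (auto dest: b01[OF s])
      thus ?thesis unfolding wt_def \<phi>_def \<omega>_def weight_def by (simp add: prod.distrib mult_ac cong: prod.cong)
    qed
    have w0: "0 \<le> weight P f e" for e unfolding weight_def using pos by (intro prod_nonneg) auto
    have "(\<Sum>s\<in>good. wt s) = (\<Sum>x\<in>\<phi> ` good. case x of (Q, e, e') \<Rightarrow> (\<Prod>p\<in>Q. w p) * (weight P f e * weight P f e'))"
      by (subst sum.reindex[OF inj]) (simp add: val)
    also have "\<dots> \<le> (\<Sum>x\<in>Sigma \<Q> (shift_pairs P M). case x of (Q, e, e') \<Rightarrow> (\<Prod>p\<in>Q. w p) * (weight P f e * weight P f e'))"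
    proof (rule sum_mono2)
      show "finite (Sigma \<Q> (shift_pairs P M))" using finP finSP by blast
      show "\<phi> ` good \<subseteq> Sigma \<Q> (shift_pairs P M)" using into by blast
      fix x assume "x \<in> Sigma \<Q> (shift_pairs P M) - \<phi> ` good"
      thus "0 \<le> (case x of (Q, e, e') \<Rightarrow> (\<Prod>p\<in>Q. w p) * (weight P f e * weight P f e'))"
        using pos w0 by (auto simp: \<Q>_def intro!: mult_nonneg_nonneg prod_nonneg)
    qed
    finally show ?thesis .
  qed
  also have "\<dots> = (\<Sum>Q\<in>\<Q>. \<Sum>(e, e')\<in>shift_pairs P M Q. (\<Prod>p\<in>Q. w p) * (weight P f e * weight P f e'))"
  proof (subst sum.Sigma)
    show "finite \<Q>" by (rule finP)
    show "\<forall>Q\<in>\<Q>. finite (shift_pairs P M Q)" using finSP by blast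
  qed (simp add: case_prod_unfold)
  also have "\<dots> = (\<Sum>Q\<in>\<Q>. (\<Prod>p\<in>Q. w p) * (\<Sum>(e, e')\<in>shift_pairs P M Q. weight P f e * weight P f e'))"
    by (simp add: sum_distrib_left case_prod_unfold)
  finally show ?thesis unfolding W_def s\<omega> \<Q>_def .
qed

section \<open>Choice of the weights\<close>

text \<open>In the notation of the proof, \<open>P\<close> consists of the primes with \<open>2 log log log T < u(p) \<le> (log log T)^(9/10)\<close>. The
upper limit keeps \<open>log p\<close> asymptotic to \<open>log log T\<close>, so that \<open>p^(-A / log log T)\<close> is nearly \<open>e^(-A)\<close> and the sum \<open>R\<close> of
the \<open>1 / p\<close> tends to \<open>0\<close>; it costs the factor \<open>9/10\<close> in \<open>H\<close>. The lower limit makes \<open>f(p)\<close> uniformly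
small, so that \<open>log (1 + x) \<approx> x\<close> applies to the local factors. The constant \<open>c0\<close> is chosen so that the mean
cost \<open>2 c0\<^sup>2 L H\<close> equals \<open>43/100 L\<close>, slightly below \<open>Z = 44/100 L\<close>, and \<open>Z\<close> in turn is slightly below the
\<open>9/20 L\<close> allowed for \<open>log |M|\<close>. All other contributions to the Markov sum tend to \<open>0\<close>.\<close>

lemma resonator_parameters:
  fixes A :: real
  assumes A: "A > 0"
  shows "\<forall>\<^sub>F T in at_top. \<exists>P f c. finite P \<and>
     (\<forall>p\<in>P. prime p \<and> 1 \<le> ln (real p) \<and> 0 \<le> f p \<and> 0 \<le> c p) \<and>
     44/100 * ln T + 2 * (\<Sum>p\<in>P. exp (- c p)) \<le> 9/20 * ln T \<and>
     (\<Sum>p\<in>P. c p * (2 * (f p)\<^sup>2 + 2 * f p * real p powr - (1/2 + A / ln (ln T))) / (44/100 * ln T) +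
        2 * f p * real p powr - (1/2 + A / ln (ln T)) * ln (real p) / (ln T / 100)) \<le> 99/100 \<and>
     exp (4/5 * exp (- A) * sqrt (ln T * ln (ln (ln T)) / ln (ln T))) * (\<Prod>p\<in>P. 1 + 2 * (f p)\<^sup>2) \<le>
       (\<Prod>p\<in>P. 1 + 2 * (f p)\<^sup>2 + 2 * f p * real p powr - (1/2 + A / ln (ln T)))"
proof -
  obtain B where B: "B > 0" "\<And>x y::real. 1 \<le> x \<Longrightarrow> x \<le> y \<Longrightarrow>
     \<bar>(\<Sum>p\<in>{p. prime p \<and> x < real p \<and> real p \<le> y}. ln (real p) / real p) - (ln y - ln x)\<bar> \<le> B"
    using mertens_interval by blast
  have ev1: "\<forall>\<^sub>F T in at_top. ln (ln (ln T)) \<ge> (1::real)" by real_asymp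
  have ev2: "\<forall>\<^sub>F T in at_top. ln (ln T) \<ge> (16::real)" by real_asymp
  have ev3: "\<forall>\<^sub>F T in at_top. ln T \<ge> (1::real)" by real_asymp
  have ev4: "\<forall>\<^sub>F T in at_top. 2 * ln (ln (ln T)) \<le> ln (ln T) powr (9/10 :: real)" by real_asymp
  have ev5: "\<forall>\<^sub>F T in at_top. 85/100 * ln (ln (ln T)) / ln (ln T) \<le>
      (ln (ln (ln T) powr (9/10) / (2 * ln (ln (ln T)))) - B / (2 * ln (ln (ln T)))) / (ln (ln T) + ln (ln T) powr (9/10 :: real))"
    using B(1) by real_asymp
  have ev6: "\<forall>\<^sub>F T in at_top. (ln (ln T) powr (9/10) + B) / ln (ln T) \<le> 1/200"
    using B(1) by real_asymp
  have ev7: "\<forall>\<^sub>F T in at_top. 2 * sqrt (ln (ln T)) * sqrt (ln T) / (44/100 * ln T) +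
      2 * (ln (ln T) + ln (ln T) powr (9/10)) * sqrt (ln T) / (ln T / 100) \<le> (1/100 :: real)" by real_asymp
  have "((\<lambda>T. (1 - 2 / ln (ln T)) * (1 - 2 / sqrt (ln (ln T))) * exp (- A * (ln (ln T) powr (9/10) / ln (ln T)))) \<longlongrightarrow> 1) at_top"
    by real_asymp
  hence ev8: "\<forall>\<^sub>F T in at_top. 94/100 < (1 - 2 / ln (ln T)) * (1 - 2 / sqrt (ln (ln T))) * exp (- A * (ln (ln T) powr (9/10) / ln (ln T)))"
    by (rule order_tendstoD) simp
  show ?thesis
    using ev1 ev2 ev3 ev4 ev5 ev6 ev7 ev8
  proof eventually_elim
    case (elim T)
    define L where "L = ln T"
    define l2 where "l2 = ln L"
    define l3 where "l3 = ln l2"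
    define x0 where "x0 = 2 * l3"
    define x1 where "x1 = l2 powr (9/10)"
    define u where "u = (\<lambda>p::nat. ln (real p) - l2)"
    define P where "P = {p::nat. prime p \<and> x0 < u p \<and> u p \<le> x1}"
    define H where "H = (\<Sum>p\<in>P. 1 / (real p * u p))"
    define R where "R = (\<Sum>p\<in>P. 1 / real p)"
    define c0 where "c0 = sqrt (215/1000 / H)"
    define f where "f = (\<lambda>p. c0 * sqrt (L / real p) / u p)"
    define w where "w = (\<lambda>p::nat. real p powr - (1/2 + A / l2))"
    define \<theta> where "\<theta> = exp (- A * (l2 + x1) / l2)"
    have "l2 \<ge> 16" using elim(2) by (simp only: L_def l2_def)
    hence x1pos: "x1 > 0" unfolding x1_def by simp
    have c: "l3 \<ge> 1" "l2 \<ge> 16" "L \<ge> 1" "x0 \<le> x1" "x0 \<ge> 2" "x1 > 0"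
      "85/100 * l3 / l2 \<le> (ln (x1 / x0) - B / x0) / (l2 + x1)"
      "(x1 + B) / l2 \<le> 1/200"
      "2 * sqrt l2 * sqrt L / (44/100 * L) + 2 * (l2 + x1) * sqrt L / (L / 100) \<le> 1/100"
      "94/100 < (1 - 2 / l2) * (1 - 2 / sqrt l2) * exp (- A * (x1 / l2))"
      using elim x1pos by (simp_all only: L_def l2_def l3_def x0_def x1_def)
    have expl2: "exp l2 = L" using c by (simp add: l2_def)
    have pP: "prime p" "real p > 0" "u p > x0" "u p \<le> x1" "ln (real p) = l2 + u p" "u p \<ge> 2" if "p \<in> P" for p
      using that c by (auto simp: P_def u_def prime_gt_0_nat)
    have pge: "ln (real p) \<ge> l2" "ln (real p) \<le> l2 + x1" if "p \<in> P" for p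
      using pP[OF that] c by linarith+
    have Lp: "L / real p = exp (- u p)" if "p \<in> P" for p
    proof -
      have "exp (- u p) = exp (l2 - ln (real p))" by (simp add: u_def)
      also have "\<dots> = exp l2 / exp (ln (real p))" by (rule exp_diff)
      also have "\<dots> = L / real p" using pP(2)[OF that] expl2 by simp
      finally show ?thesis ..
    qed
    have set_eq: "{p::nat. prime p \<and> x0 < ln (real p) - l2 \<and> ln (real p) - l2 \<le> v} =
        {p. prime p \<and> exp (l2 + x0) < real p \<and> real p \<le> exp (l2 + v)}" for v
    proof (rule Collect_cong, rule conj_cong[OF refl])
      fix p :: nat assume "prime p"
      hence "real p > 0" by (simp add: prime_gt_0_nat)
      hence "ln (real p) > l2 + x0 \<longleftrightarrow> exp (l2 + x0) < real p" "ln (real p) \<le> l2 + v \<longleftrightarrow> real p \<le> exp (l2 + v)"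
        by (metis exp_less_cancel_iff exp_ln, metis exp_le_cancel_iff exp_ln)
      thus "(x0 < ln (real p) - l2 \<and> ln (real p) - l2 \<le> v) \<longleftrightarrow> (exp (l2 + x0) < real p \<and> real p \<le> exp (l2 + v))"
        by (auto simp: algebra_simps)
    qed
    have mert: "\<bar>(\<Sum>p\<in>{p::nat. prime p \<and> x0 < ln (real p) - l2 \<and> ln (real p) - l2 \<le> v}. ln (real p) / real p) - (v - x0)\<bar> \<le> B"
      if "x0 \<le> v" for v
    proof -
      have "1 \<le> exp (l2 + x0)" "exp (l2 + x0) \<le> exp (l2 + v)" using c that by simp_all
      from B(2)[OF this] show ?thesis unfolding set_eq by simp
    qed
    have P_eq: "P = {p::nat. prime p \<and> x0 < ln (real p) - l2 \<and> ln (real p) - l2 \<le> x1}" by (simp add: P_def u_def)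
    have fin: "finite P"
    proof (rule finite_subset)
      show "P \<subseteq> {..nat \<lfloor>exp (l2 + x1)\<rfloor>}" unfolding P_eq set_eq by (auto simp: le_nat_floor)
    qed auto
    \<comment> \<open>The lower bound for \<open>H\<close>: on \<open>P\<close> the factor \<open>log p\<close> is at most \<open>l2 + x1\<close>, which is asymptotic to \<open>l2\<close>.\<close>
    have "ln (x1 / x0) - B / x0 \<le> (\<Sum>p\<in>P. ln (real p) / (real p * u p))"
      unfolding P_eq u_def
    proof (rule sum_primes_inverse_log_shift)
      fix v assume "x0 \<le> v" "v \<le> x1"
      thus "v - x0 - B \<le> (\<Sum>p\<in>{p::nat. prime p \<and> x0 < ln (real p) - l2 \<and> ln (real p) - l2 \<le> v}. ln (real p) / real p)"
        using abs_le_D2[OF mert[of v]] by simp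
    qed (use c in auto)
    also have "\<dots> \<le> (\<Sum>p\<in>P. (l2 + x1) * (1 / (real p * u p)))"
    proof (rule sum_mono)
      fix p assume p: "p \<in> P"
      have "ln (real p) * (1 / (real p * u p)) \<le> (l2 + x1) * (1 / (real p * u p))"
        using pge[OF p] pP[OF p] by (intro mult_right_mono) auto
      thus "ln (real p) / (real p * u p) \<le> (l2 + x1) * (1 / (real p * u p))" by simp
    qed
    also have "\<dots> = (l2 + x1) * H" unfolding H_def by (rule sum_distrib_left[symmetric])
    finally have "(ln (x1 / x0) - B / x0) / (l2 + x1) \<le> H" using c by (simp add: divide_le_eq mult.commute)
    hence Hlow: "85/100 * l3 / l2 \<le> H" using c by linarith
    have Hpos: "H > 0"
    proof -
      have "85/100 * l3 / l2 > 0" using c by simp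
      thus ?thesis using Hlow by linarith
    qed
    have Rle: "R \<le> 1/200"
    proof -
      have "l2 * R = (\<Sum>p\<in>P. l2 * (1 / real p))" unfolding R_def by (rule sum_distrib_left)
      also have "\<dots> \<le> (\<Sum>p\<in>P. ln (real p) / real p)"
      proof (rule sum_mono)
        fix p assume p: "p \<in> P"
        show "l2 * (1 / real p) \<le> ln (real p) / real p" using pge[OF p] pP[OF p] by (simp add: divide_right_mono)
      qed
      also have "\<dots> \<le> x1 - x0 + B" using abs_le_D1[OF mert[of x1]] c unfolding P_eq by simp
      also have "\<dots> \<le> x1 + B" using c by simp
      finally have "R \<le> (x1 + B) / l2" using c by (simp add: le_divide_eq mult.commute)
      thus ?thesis using c by linarith
    qed
    have R0: "R \<ge> 0" unfolding R_def by (intro sum_nonneg) auto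
    have HR: "H \<le> R" unfolding H_def R_def
    proof (rule sum_mono)
      fix p assume p: "p \<in> P"
      show "1 / (real p * u p) \<le> 1 / real p" using pP[OF p] by (intro divide_left_mono) auto
    qed
    have c02: "c0\<^sup>2 = 215/1000 / H" "c0 > 0" using Hpos by (auto simp: c0_def)
    have c0H: "c0\<^sup>2 * H = 215/1000" using c02 Hpos by simp
    have c0le: "c0\<^sup>2 \<le> l2"
    proof -
      have "85/100 / l2 \<le> 85/100 * l3 / l2" using c by (intro divide_right_mono) auto
      hence "85/100 / l2 \<le> H" using Hlow by linarith
      hence "215/1000 / H \<le> 215/1000 / (85/100 / l2)" using c Hpos by (intro divide_left_mono) auto
      also have "\<dots> \<le> l2" using c by simp
      finally show ?thesis using c02 by simp
    qed
    have c0le': "c0 \<le> sqrt l2" using c0le c02(2) by (intro real_le_rsqrt)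
    have f0: "f p \<ge> 0" if "p \<in> P" for p using pP[OF that] c02 c by (auto simp: f_def)
    have f2: "(f p)\<^sup>2 = c0\<^sup>2 * L * (1 / (real p * u p)) / u p" if "p \<in> P" for p
      using pP[OF that] c by (simp add: f_def power_mult_distrib power_divide power2_eq_square[of "u p"])
    have f2le: "(f p)\<^sup>2 \<le> 1 / l2" if "p \<in> P" for p
    proof -
      have "(f p)\<^sup>2 = c0\<^sup>2 * exp (- u p) / (u p)\<^sup>2"
        using pP[OF that] c Lp[OF that] by (simp add: f_def power_mult_distrib power_divide)
      also have "\<dots> \<le> c0\<^sup>2 * exp (- u p) / 1"
        using pP[OF that] by (intro divide_left_mono mult_nonneg_nonneg) auto
      also have "\<dots> \<le> l2 * exp (- x0)" using c0le pP[OF that] c by (simp, intro mult_mono) auto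
      also have "exp (- x0) = 1 / l2\<^sup>2"
      proof -
        have "exp (- x0) = exp (- l3) * exp (- l3)" by (simp add: x0_def exp_add[symmetric])
        thus ?thesis using c by (simp add: l3_def exp_minus power2_eq_square field_simps)
      qed
      also have "l2 * (1 / l2\<^sup>2) = 1 / l2" using c by (simp add: power2_eq_square)
      finally show ?thesis .
    qed
    have fle: "f p \<le> 1 / sqrt l2" if "p \<in> P" for p
    proof -
      have "(f p)\<^sup>2 \<le> (1 / sqrt l2)\<^sup>2" using f2le[OF that] c by (simp add: power_divide)
      thus ?thesis by (rule power2_le_imp_le) (use c in auto)
    qed
    have fw_eq: "f p * w p = c0 * sqrt L * (1 / (real p * u p)) * real p powr - (A / l2)" if "p \<in> P" for p
    proof -
      have 1: "w p = real p powr (- (1/2)) * real p powr - (A / l2)"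
        unfolding w_def by (simp add: powr_add[symmetric])
      have 2: "real p powr (- (1/2)) = 1 / sqrt (real p)"
        using pP[OF that] by (simp add: powr_minus powr_half_sqrt field_simps)
      have 3: "sqrt (L / real p) * (1 / sqrt (real p)) = sqrt L / real p"
        using pP[OF that] by (simp add: real_sqrt_divide)
      have "f p * w p = c0 / u p * (sqrt (L / real p) * (1 / sqrt (real p))) * real p powr - (A / l2)"
        unfolding f_def 1 2 by simp
      thus ?thesis unfolding 3 by (simp add: mult_ac)
    qed
    have pw: "\<theta> \<le> real p powr - (A / l2)" "real p powr - (A / l2) \<le> 1" if "p \<in> P" for p
    proof -
      have e: "real p powr - (A / l2) = exp (- (A / l2 * ln (real p)))" using pP[OF that] by (simp add: powr_def)
      have "A / l2 * ln (real p) \<le> A / l2 * (l2 + x1)" using pge[OF that] A c by (intro mult_left_mono) auto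
      thus "\<theta> \<le> real p powr - (A / l2)" unfolding e \<theta>_def by simp
      have "0 \<le> A / l2 * ln (real p)" using pge[OF that] A c by simp
      thus "real p powr - (A / l2) \<le> 1" unfolding e by simp
    qed
    have fw0: "0 \<le> f p * w p" if "p \<in> P" for p using f0[OF that] by (simp add: w_def)
    have fw_up: "f p * w p \<le> c0 * sqrt L * (1 / (real p * u p))" if "p \<in> P" for p
      unfolding fw_eq[OF that] using pw[OF that] pP[OF that] c02 c
      by (intro mult_right_le_one_le mult_nonneg_nonneg) auto
    have fw_low: "\<theta> * (c0 * sqrt L * (1 / (real p * u p))) \<le> f p * w p" if "p \<in> P" for p
    proof -
      have "\<theta> * (c0 * sqrt L * (1 / (real p * u p))) \<le> real p powr - (A / l2) * (c0 * sqrt L * (1 / (real p * u p)))"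
        using pw[OF that] pP[OF that] c02 c by (intro mult_right_mono mult_nonneg_nonneg) auto
      thus ?thesis unfolding fw_eq[OF that] by (simp add: mult.commute)
    qed
    have w1: "w p \<le> 1" if "p \<in> P" for p
    proof -
      have "ln (real p) > 0" using pge[OF that] c by linarith
      hence "1 \<le> real p" using pP[OF that] by (metis less_imp_le ln_gt_zero_iff)
      moreover have "0 \<le> A / l2" using A c by simp
      ultimately have "w p \<le> real p powr 0" unfolding w_def by (intro powr_mono) auto
      thus ?thesis using pP[OF that] by simp
    qed
    have w0: "w p \<ge> 0" for p by (simp add: w_def)

    have cost: "44/100 * L + 2 * (\<Sum>p\<in>P. exp (- u p)) \<le> 9/20 * L"
    proof -
      have "(\<Sum>p\<in>P. exp (- u p)) = (\<Sum>p\<in>P. L * (1 / real p))" by (intro sum.cong refl) (simp add: Lp[symmetric])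
      also have "\<dots> = L * R" unfolding R_def by (rule sum_distrib_left[symmetric])
      also have "\<dots> \<le> L * (1/200)" using Rle c by (intro mult_left_mono) auto
      finally show ?thesis by simp
    qed

    \<comment> \<open>The squares \<open>f(p)\<^sup>2\<close> contribute \<open>43/44\<close>. The remaining terms only contain \<open>\<surd>L\<close> in place of \<open>L\<close>, up to powers
      of \<open>l2\<close>.\<close>
    have budget: "(\<Sum>p\<in>P. u p * (2 * (f p)\<^sup>2 + 2 * f p * w p) / (44/100 * L) + 2 * f p * w p * ln (real p) / (L / 100)) \<le> 99/100"
    proof -
      have "(\<Sum>p\<in>P. u p * (2 * (f p)\<^sup>2 + 2 * f p * w p) / (44/100 * L) + 2 * f p * w p * ln (real p) / (L / 100))
          \<le> (\<Sum>p\<in>P. 2 * c0\<^sup>2 * L / (44/100 * L) * (1 / (real p * u p)) + 2 * c0 * sqrt L / (44/100 * L) * (1 / real p)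
               + 2 * (l2 + x1) * (c0 * sqrt L) / (L / 100) * (1 / (real p * u p)))"
      proof (rule sum_mono)
        fix p assume p: "p \<in> P"
        have 1: "u p * (2 * (f p)\<^sup>2) = 2 * c0\<^sup>2 * L * (1 / (real p * u p))" unfolding f2[OF p] using pP[OF p] by simp
        have "u p * (f p * w p) \<le> u p * (c0 * sqrt L * (1 / (real p * u p)))"
          using fw_up[OF p] pP[OF p] by (intro mult_left_mono) auto
        also have "\<dots> = c0 * sqrt L * (1 / real p)" using pP[OF p] by simp
        finally have 2: "u p * (f p * w p) \<le> c0 * sqrt L * (1 / real p)" .
        have 3: "(f p * w p) * ln (real p) \<le> (c0 * sqrt L * (1 / (real p * u p))) * (l2 + x1)"
        proof (rule mult_mono[OF fw_up[OF p] pge(2)[OF p]])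
          show "0 \<le> c0 * sqrt L * (1 / (real p * u p))" using pP[OF p] c02 c by simp
          show "0 \<le> ln (real p)" using pge[OF p] c by linarith
        qed
        have "u p * (2 * (f p)\<^sup>2 + 2 * f p * w p) / (44/100 * L) = (u p * (2 * (f p)\<^sup>2) + 2 * (u p * (f p * w p))) / (44/100 * L)"
          by (simp add: algebra_simps)
        also have "\<dots> \<le> (2 * c0\<^sup>2 * L * (1 / (real p * u p)) + 2 * (c0 * sqrt L * (1 / real p))) / (44/100 * L)"
          using 1 2 c by (intro divide_right_mono) auto
        also have "\<dots> = 2 * c0\<^sup>2 * L / (44/100 * L) * (1 / (real p * u p)) + 2 * c0 * sqrt L / (44/100 * L) * (1 / real p)"
          by (simp add: add_divide_distrib mult_ac)
        finally have 4: "u p * (2 * (f p)\<^sup>2 + 2 * f p * w p) / (44/100 * L) \<le> \<dots>" .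
        have "2 * f p * w p * ln (real p) / (L / 100) = 2 * ((f p * w p) * ln (real p)) / (L / 100)" by simp
        also have "\<dots> \<le> 2 * ((c0 * sqrt L * (1 / (real p * u p))) * (l2 + x1)) / (L / 100)"
          using 3 c by (intro divide_right_mono mult_left_mono) auto
        also have "\<dots> = 2 * (l2 + x1) * (c0 * sqrt L) / (L / 100) * (1 / (real p * u p))" by (simp add: mult_ac)
        finally show "u p * (2 * (f p)\<^sup>2 + 2 * f p * w p) / (44/100 * L) + 2 * f p * w p * ln (real p) / (L / 100) \<le>
            2 * c0\<^sup>2 * L / (44/100 * L) * (1 / (real p * u p)) + 2 * c0 * sqrt L / (44/100 * L) * (1 / real p)
               + 2 * (l2 + x1) * (c0 * sqrt L) / (L / 100) * (1 / (real p * u p))" using 4 by (rule add_mono[rotated])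
      qed
      also have "\<dots> = 2 * c0\<^sup>2 * L / (44/100 * L) * H + 2 * c0 * sqrt L / (44/100 * L) * R + 2 * (l2 + x1) * (c0 * sqrt L) / (L / 100) * H"
        unfolding H_def R_def sum_distrib_left by (simp only: sum.distrib)
      finally have le: "(\<Sum>p\<in>P. u p * (2 * (f p)\<^sup>2 + 2 * f p * w p) / (44/100 * L) + 2 * f p * w p * ln (real p) / (L / 100)) \<le>
         2 * c0\<^sup>2 * L / (44/100 * L) * H + 2 * c0 * sqrt L / (44/100 * L) * R + 2 * (l2 + x1) * (c0 * sqrt L) / (L / 100) * H" .
      have t1: "2 * c0\<^sup>2 * L / (44/100 * L) * H = 43/44"
      proof -
        have "2 * c0\<^sup>2 * L / (44/100 * L) * H = 2 * (c0\<^sup>2 * H) / (44/100)" using c by simp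
        thus ?thesis unfolding c0H by simp
      qed
      have t2: "2 * c0 * sqrt L / (44/100 * L) * R \<le> 2 * sqrt l2 * sqrt L / (44/100 * L)"
      proof -
        have "2 * c0 * sqrt L / (44/100 * L) * R \<le> 2 * sqrt l2 * sqrt L / (44/100 * L) * 1"
        proof (rule mult_mono)
          show "2 * c0 * sqrt L / (44/100 * L) \<le> 2 * sqrt l2 * sqrt L / (44/100 * L)"
            using c0le' c by (intro divide_right_mono mult_right_mono) auto
        qed (use R0 Rle c in auto)
        thus ?thesis by simp
      qed
      have t3: "2 * (l2 + x1) * (c0 * sqrt L) / (L / 100) * H \<le> 2 * (l2 + x1) * sqrt L / (L / 100)"
      proof -
        have "(c0 * H)\<^sup>2 = c0\<^sup>2 * H * H" by (simp add: power2_eq_square)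
        also have "\<dots> \<le> 1 * 1" unfolding c0H using HR Rle Hpos by (intro mult_mono) auto
        finally have "c0 * H \<le> 1" by (simp add: abs_square_le_1 abs_le_iff)
        hence "2 * (l2 + x1) * sqrt L / (L / 100) * (c0 * H) \<le> 2 * (l2 + x1) * sqrt L / (L / 100) * 1"
          using c by (intro mult_left_mono) auto
        thus ?thesis by (simp add: mult_ac)
      qed
      show ?thesis using le t1 t2 t3 c(9) by linarith
    qed

    \<comment> \<open>The factor \<open>\<delta>\<close> collects the losses from \<open>1 + 2 f(p)\<^sup>2 \<ge> 1\<close> in the denominator and from
      \<open>log (1 + y) \<ge> y - y\<^sup>2\<close>, and \<open>\<theta>\<close>, which tends to \<open>e^(-A)\<close>, is the smallest value of \<open>p^(-A / l2)\<close>. The numerical loss is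
      the one from \<open>2 \<surd>(0.215 * 0.85) * 0.94\<close> to \<open>4/5\<close>.\<close>
    have gain: "exp (4/5 * exp (- A) * sqrt (L * l3 / l2)) * (\<Prod>p\<in>P. 1 + 2 * (f p)\<^sup>2) \<le> (\<Prod>p\<in>P. 1 + 2 * (f p)\<^sup>2 + 2 * f p * w p)"
    proof -
      define \<delta> where "\<delta> = (1 - 2 / l2) * (1 - 2 / sqrt l2)"
      have s16: "sqrt l2 \<ge> 4" using c by (intro real_le_rsqrt) auto
      have s2: "2 / sqrt l2 \<le> 1" using s16 c(2) by (subst pos_divide_le_eq) auto
      have \<delta>0: "\<delta> \<ge> 0" unfolding \<delta>_def using c s16 by (intro mult_nonneg_nonneg) auto
      have term_low: "\<delta> * (2 * (f p * w p)) \<le> ln (1 + 2 * (f p * w p) / (1 + 2 * (f p)\<^sup>2))" if p: "p \<in> P" for p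
      proof -
        define y where "y = 2 * (f p * w p) / (1 + 2 * (f p)\<^sup>2)"
        have d1: "1 + 2 * (f p)\<^sup>2 \<ge> 1" by simp
        have y0: "y \<ge> 0" unfolding y_def using fw0[OF p] by simp
        have "y \<le> 2 * (f p * w p) / 1" unfolding y_def using fw0[OF p] by (intro divide_left_mono) (auto intro: add_pos_nonneg)
        also have "f p * w p \<le> 1 / sqrt l2 * 1"
          using fle[OF p] w1[OF p] w0[of p] f0[OF p] c by (intro mult_mono) auto
        finally have y1: "y \<le> 2 / sqrt l2" by simp
        hence y1': "y \<le> 1" using s2 by linarith
        have "(1 - 2 / l2) * (1 + 2 * (f p)\<^sup>2) \<le> 1"
        proof -
          have "(1 - 2 / l2) * (1 + 2 * (f p)\<^sup>2) \<le> (1 - 2 / l2) * (1 + 2 * (1 / l2))"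
            using f2le[OF p] c by (intro mult_left_mono) auto
          also have "\<dots> = 1 - (2 / l2) * (2 / l2)" by (simp add: algebra_simps)
          also have "\<dots> \<le> 1" by simp
          finally show ?thesis .
        qed
        hence "(1 - 2 / l2) \<le> 1 / (1 + 2 * (f p)\<^sup>2)"
          by (simp only: pos_le_divide_eq[OF less_le_trans[OF zero_less_one d1]])
        hence "(1 - 2 / l2) * (2 * (f p * w p)) \<le> 1 / (1 + 2 * (f p)\<^sup>2) * (2 * (f p * w p))"
          using fw0[OF p] by (intro mult_right_mono) auto
        hence y2: "(1 - 2 / l2) * (2 * (f p * w p)) \<le> y" by (simp add: y_def)
        have "\<delta> * (2 * (f p * w p)) = (1 - 2 / sqrt l2) * ((1 - 2 / l2) * (2 * (f p * w p)))" by (simp add: \<delta>_def)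
        also have "\<dots> \<le> (1 - 2 / sqrt l2) * y" using y2 s2 by (intro mult_left_mono) auto
        also have "\<dots> \<le> (1 - y) * y" using y0 y1 by (intro mult_right_mono) auto
        also have "\<dots> = y - y\<^sup>2" by (simp add: power2_eq_square algebra_simps)
        also have "\<dots> \<le> ln (1 + y)" using y0 y1' by (intro ln_one_plus_pos_lower_bound)
        finally show ?thesis by (simp add: y_def)
      qed
      have "4/5 * exp (- A) * sqrt (L * l3 / l2) \<le> 2 * \<delta> * \<theta> * (c0 * sqrt L * H)"
      proof -
        have "\<theta> = exp (- A) * exp (- A * (x1 / l2))"
        proof -
          have "- A * (l2 + x1) / l2 = - A + - A * (x1 / l2)" using c(2) by (simp add: field_simps)
          thus ?thesis unfolding \<theta>_def by (simp only: exp_add)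
        qed
        hence "\<delta> * \<theta> = exp (- A) * (\<delta> * exp (- A * (x1 / l2)))" by simp
        also have "\<dots> \<ge> exp (- A) * (94/100)" using c(10) unfolding \<delta>_def by (intro mult_left_mono) auto
        finally have 1: "exp (- A) * (94/100) \<le> \<delta> * \<theta>" .
        have "(c0 * sqrt L * H)\<^sup>2 = (c0\<^sup>2 * H) * (L * H)" using c by (simp add: power_mult_distrib power2_eq_square)
        also have "\<dots> = 215/1000 * (L * H)" unfolding c0H ..
        also have "\<dots> \<ge> 215/1000 * (L * (85/100 * l3 / l2))" using Hlow c by (intro mult_left_mono) auto
        also have "215/1000 * (L * (85/100 * l3 / l2)) = 18275/100000 * (L * l3 / l2)" by simp
        also have "\<dots> \<ge> (427/1000)\<^sup>2 * (L * l3 / l2)" using c by (intro mult_right_mono) (auto simp: power2_eq_square)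
        finally have "(427/1000)\<^sup>2 * (L * l3 / l2) \<le> (c0 * sqrt L * H)\<^sup>2" .
        hence "(427/1000 * sqrt (L * l3 / l2))\<^sup>2 \<le> (c0 * sqrt L * H)\<^sup>2"
        proof -
          have "0 \<le> L * l3 / l2" using c by simp
          hence "(427/1000 * sqrt (L * l3 / l2))\<^sup>2 = (427/1000)\<^sup>2 * (L * l3 / l2)"
            by (simp only: power_mult_distrib real_sqrt_pow2)
          thus ?thesis using \<open>(427/1000)\<^sup>2 * (L * l3 / l2) \<le> (c0 * sqrt L * H)\<^sup>2\<close> by (simp only:)
        qed
        hence 2: "427/1000 * sqrt (L * l3 / l2) \<le> c0 * sqrt L * H"
          by (rule power2_le_imp_le) (use c02 c Hpos in auto)
        have "4/5 * exp (- A) * sqrt (L * l3 / l2) \<le> 2 * (exp (- A) * (94/100)) * (427/1000 * sqrt (L * l3 / l2))"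
          using c by simp
        also have "\<dots> \<le> 2 * (\<delta> * \<theta>) * (c0 * sqrt L * H)"
        proof (rule mult_mono)
          show "2 * (exp (- A) * (94/100)) \<le> 2 * (\<delta> * \<theta>)" using 1 by simp
          show "427/1000 * sqrt (L * l3 / l2) \<le> c0 * sqrt L * H" by (rule 2)
          show "0 \<le> 2 * (\<delta> * \<theta>)" using \<delta>0 by (simp add: \<theta>_def)
          show "0 \<le> 427/1000 * sqrt (L * l3 / l2)" using c by simp
        qed
        finally show ?thesis by (simp only: mult.assoc)
      qed
      also have "\<dots> = (\<Sum>p\<in>P. \<delta> * (2 * (\<theta> * (c0 * sqrt L * (1 / (real p * u p))))))"
        unfolding H_def by (simp add: sum_distrib_left mult_ac)
      also have "\<dots> \<le> (\<Sum>p\<in>P. \<delta> * (2 * (f p * w p)))"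
        using fw_low \<delta>0 by (intro sum_mono mult_left_mono) auto
      also have "\<dots> \<le> (\<Sum>p\<in>P. ln (1 + 2 * (f p * w p) / (1 + 2 * (f p)\<^sup>2)))" by (intro sum_mono term_low)
      finally have "exp (4/5 * exp (- A) * sqrt (L * l3 / l2)) \<le> exp (\<Sum>p\<in>P. ln (1 + 2 * (f p * w p) / (1 + 2 * (f p)\<^sup>2)))" by simp
      also have "\<dots> = (\<Prod>p\<in>P. 1 + 2 * (f p * w p) / (1 + 2 * (f p)\<^sup>2))"
        unfolding exp_sum[OF fin] using fw0 by (intro prod.cong refl exp_ln) (auto intro!: add_pos_nonneg divide_nonneg_pos)
      finally have "exp (4/5 * exp (- A) * sqrt (L * l3 / l2)) * (\<Prod>p\<in>P. 1 + 2 * (f p)\<^sup>2) \<le>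
          (\<Prod>p\<in>P. 1 + 2 * (f p * w p) / (1 + 2 * (f p)\<^sup>2)) * (\<Prod>p\<in>P. 1 + 2 * (f p)\<^sup>2)"
        by (intro mult_right_mono prod_nonneg) auto
      also have "\<dots> = (\<Prod>p\<in>P. 1 + 2 * (f p)\<^sup>2 + 2 * f p * w p)"
        unfolding prod.distrib[symmetric]
      proof (intro prod.cong refl)
        fix p
        have "1 + 2 * (f p)\<^sup>2 > 0" by (intro add_pos_nonneg) auto
        thus "(1 + 2 * (f p * w p) / (1 + 2 * (f p)\<^sup>2)) * (1 + 2 * (f p)\<^sup>2) = 1 + 2 * (f p)\<^sup>2 + 2 * f p * w p"
          by (simp add: field_simps)
      qed
      finally show ?thesis .
    qed
    have base: "\<forall>p\<in>P. prime p \<and> 1 \<le> ln (real p) \<and> 0 \<le> f p \<and> 0 \<le> u p"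
    proof
      fix p assume p: "p \<in> P"
      show "prime p \<and> 1 \<le> ln (real p) \<and> 0 \<le> f p \<and> 0 \<le> u p" using pP[OF p] pge[OF p] f0[OF p] c by auto
    qed
    show ?case
      using fin base cost budget gain unfolding w_def L_def l2_def l3_def
      by (intro exI[of _ P] exI[of _ f] exI[of _ u] conjI)
  qed
qed

section \<open>Large values\<close>

lemma prime_factors_prod_distinct_primes:
  fixes Q :: "nat set"
  assumes "finite Q" "\<And>p. p \<in> Q \<Longrightarrow> prime p"
  shows "prime_factors (\<Prod>Q) = Q"
proof -
  have "prime_factors (prod (\<lambda>p. p) Q) = (\<Union>p\<in>Q. prime_factors p)"
    using assms(1) assms(2)[of 0] by (subst prime_factors_prod) auto
  also have "\<dots> = (\<Union>p\<in>Q. {p})" using assms(2) by (intro SUP_cong refl) (simp add: prime_factorization_prime)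
  finally show ?thesis by simp
qed

lemma shift_pairs_empty_sum_le:
  assumes "finite M" "M \<subseteq> extensional P"
  shows "(\<Sum>(e, e')\<in>shift_pairs P M {}. F e * F e') \<le> (\<Sum>e\<in>M. (F e)\<^sup>2 :: real)"
proof -
  have "shift_pairs P M {} \<subseteq> (\<lambda>e. (e, e)) ` M"
  proof (clarsimp simp: shift_pairs_def)
    fix e e' assume a: "e \<in> M" "e' \<in> M" "\<forall>p\<in>P. e' p = e p"
    have "e = e'" by (rule extensionalityI[of _ P]) (use a assms in auto)
    thus "(e, e') \<in> (\<lambda>e. (e, e)) ` M" using a by auto
  qed
  hence "(\<Sum>(e, e')\<in>shift_pairs P M {}. F e * F e') = (\<Sum>x\<in>shift_pairs P M {}. (F (fst x))\<^sup>2)"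
    by (intro sum.cong) (auto simp: power2_eq_square)
  also have "\<dots> = (\<Sum>e\<in>fst ` shift_pairs P M {}. (F e)\<^sup>2)"
    using shift_pairs_injective(1)[OF assms(2)] by (simp add: sum.reindex)
  also have "\<dots> \<le> (\<Sum>e\<in>M. (F e)\<^sup>2)"
    using assms(1) by (intro sum_mono2) (auto simp: shift_pairs_def)
  finally show ?thesis .
qed

text \<open>Every point lies within distance \<open>1\<close> of an integer, where the window has size at least \<open>1/2\<close>.\<close>

lemma unit_windows:
  fixes x Y :: real
  assumes "0 \<le> x" "x \<le> Y"
  shows "1 \<le> 2 * (\<Sum>j\<le>nat \<lfloor>Y\<rfloor>. exp (- (x - real j)\<^sup>2 / 2))"
proof -
  define k where "k = nat \<lfloor>x\<rfloor>"
  have k: "real k \<le> x" "x < real k + 1" using assms unfolding k_def by linarith+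
  have "\<bar>x - real k\<bar> \<le> 1" using k by linarith
  hence "(x - real k)\<^sup>2 \<le> 1" by (simp add: abs_square_le_1)
  hence "exp (- 1 / 2) \<le> exp (- (x - real k)\<^sup>2 / 2)" by simp
  moreover have "1 / 2 \<le> exp (- 1 / 2 :: real)" using exp_ge_add_one_self[of "- 1 / 2 :: real"] by simp
  moreover have "exp (- (x - real k)\<^sup>2 / 2) \<le> (\<Sum>j\<le>nat \<lfloor>Y\<rfloor>. exp (- (x - real j)\<^sup>2 / 2))"
    using assms by (intro member_le_sum) (auto simp: k_def intro!: nat_mono floor_mono)
  ultimately show ?thesis by linarith
qed

text \<open>The resonance inequality is applied once for each integer \<open>\<omega> \<le> log T / 100\<close>, and the results are added; by
\<open>unit_windows\<close> the windows together cover all shifts that occur. This costs only the factor \<open>log T\<close>. The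
empty shift is removed beforehand, because \<open>(log 1)^l\<close> vanishes for \<open>l > 0\<close>; it accounts for at most the
sum of the \<open>F(m)\<^sup>2\<close>.\<close>

lemma large_value_bound:
  fixes A :: real
  assumes A: "A > 0"
  shows "\<exists>C>0. \<forall>\<^sub>F T in at_top. \<forall>S. line_bound l T (1/2 + A / ln (ln T)) S \<longrightarrow>
     exp (4/5 * exp (- A) * sqrt (ln T * ln (ln (ln T)) / ln (ln T))) \<le> C * ln T * (S + 1)"
  (is "\<exists>C>0. \<forall>\<^sub>F T in at_top. ?Q C T")
proof -
  obtain C where C: "C > 0" and res: "\<forall>\<^sub>F T in at_top. \<forall>\<sigma> \<omega> S (M :: (nat \<Rightarrow> int) set) F L E. \<sigma> \<in> {1/2..1} \<longrightarrow>
     \<omega> \<in> {0..ln T / 100} \<longrightarrow> line_bound l T \<sigma> S \<longrightarrow>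
     finite M \<longrightarrow> real (card M) \<le> T powr (9/20) \<longrightarrow> (\<forall>m\<in>M. 0 \<le> F m) \<longrightarrow> log_shift_relations M L E \<longrightarrow>
     (\<Sum>n<nat \<lceil>T\<^sup>2\<rceil>. window_coeff l \<sigma> \<omega> n * (\<Sum>(m, m')\<in>E n. F m * F m')) \<le> C * (S + 1) * (\<Sum>m\<in>M. (F m)\<^sup>2)"
    using resonance_bound[where 'a = "nat \<Rightarrow> int", of l] by blast
  have ev1: "\<forall>\<^sub>F T in at_top. A / ln (ln T) \<le> 1/2" using A by real_asymp
  have ev1': "\<forall>\<^sub>F T in at_top. A / ln (ln T) \<ge> 0" using A by real_asymp
  have ev2: "\<forall>\<^sub>F T in at_top. ln T \<ge> (100 :: real)" by real_asymp
  have ev3: "\<forall>\<^sub>F T in at_top. T \<ge> (1 :: real)" by real_asymp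
  show ?thesis
  proof (intro exI[of _ "100 * (1 + 4 * C)"] conjI)
    show "100 * (1 + 4 * C) > 0" using C by simp
    show "\<forall>\<^sub>F T in at_top. ?Q (100 * (1 + 4 * C)) T"
      using res resonator_parameters[OF A] ev1 ev1' ev2 ev3
    proof eventually_elim
      case (elim T)
      define \<sigma> where "\<sigma> = 1/2 + A / ln (ln T)"
      define Z where "Z = 44/100 * ln T"
      define Y where "Y = ln T / 100"
      define G where "G = 4/5 * exp (- A) * sqrt (ln T * ln (ln (ln T)) / ln (ln T))"
      have \<sigma>: "1/2 \<le> \<sigma>" "\<sigma> \<le> 1" using elim(3,4) unfolding \<sigma>_def by linarith+
      have ZY: "Z > 0" "Y > 0" using elim(5) by (simp_all add: Z_def Y_def)
      from elim(2) obtain P f c where P: "finite P"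
        and base: "\<And>p. p \<in> P \<Longrightarrow> prime p \<and> 1 \<le> ln (real p) \<and> 0 \<le> f p \<and> 0 \<le> c p"
        and cost: "Z + 2 * (\<Sum>p\<in>P. exp (- c p)) \<le> 9/20 * ln T"
        and budget: "(\<Sum>p\<in>P. c p * (2 * (f p)\<^sup>2 + 2 * f p * real p powr - \<sigma>) / Z + 2 * f p * real p powr - \<sigma> * ln (real p) / Y) \<le> 99/100"
        and gain: "exp G * (\<Prod>p\<in>P. 1 + 2 * (f p)\<^sup>2) \<le> (\<Prod>p\<in>P. 1 + 2 * (f p)\<^sup>2 + 2 * f p * real p powr - \<sigma>)"
        unfolding Z_def Y_def G_def \<sigma>_def by blast
      define M where "M = bounded_cost P c Z"
      define F where "F = weight P f"
      define w where "w = (\<lambda>p::nat. real p powr - \<sigma>)"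
      define corr where "corr = (\<lambda>Q. \<Sum>(e, e')\<in>shift_pairs P M Q. F e * F e')"
      define \<nu> where "\<nu> = (\<lambda>Q. \<Sum>p\<in>Q. ln (real p))"
      define \<Q> where "\<Q> = {Q \<in> Pow P. \<nu> Q \<le> Y}"
      define \<Pi>1 where "\<Pi>1 = (\<Prod>p\<in>P. 1 + 2 * (f p)\<^sup>2)"
      have finM: "finite M" unfolding M_def by (rule finite_bounded_cost[OF P])
      have extM: "M \<subseteq> extensional P" unfolding M_def using bounded_cost_extensional by blast
      have fin\<Q>: "finite \<Q>" using P by (auto simp: \<Q>_def)
      have F0: "F e \<ge> 0" for e unfolding F_def weight_def using base by (intro prod_nonneg) auto
      have corr0: "corr Q \<ge> 0" for Q unfolding corr_def using F0 by (intro sum_nonneg) auto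
      have \<Pi>1: "\<Pi>1 \<ge> 1" unfolding \<Pi>1_def by (intro prod_ge_1) auto
      have FF: "(\<Sum>e\<in>M. (F e)\<^sup>2) \<le> \<Pi>1" unfolding M_def F_def \<Pi>1_def by (rule sum_weight_square_le[OF P])
      have cardM: "real (card M) \<le> T powr (9/20)"
      proof -
        have "real (card M) \<le> exp (Z + 2 * (\<Sum>p\<in>P. exp (- c p)))" unfolding M_def by (rule card_bounded_cost_le[OF P])
        also have "\<dots> \<le> exp (9/20 * ln T)" using cost by simp
        also have "\<dots> = T powr (9/20)" using elim(6) by (simp add: powr_def)
        finally show ?thesis .
      qed
      have lower: "1/100 * (exp G * \<Pi>1) \<le> (\<Sum>Q\<in>\<Q>. (\<Prod>p\<in>Q. w p) * corr Q)"
      proof -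
        define B where "B = (\<Sum>p\<in>P. c p * (2 * (f p)\<^sup>2 + 2 * f p * w p) / Z + 2 * f p * w p * ln (real p) / Y)"
        have "1/100 * (exp G * \<Pi>1) \<le> (1 - B) * (\<Prod>p\<in>P. 1 + 2 * (f p)\<^sup>2 + 2 * f p * w p)"
          using budget gain \<Pi>1 unfolding w_def \<Pi>1_def B_def by (intro mult_mono) auto
        also have "\<dots> \<le> (\<Sum>Q\<in>\<Q>. (\<Prod>p\<in>Q. w p) * corr Q)"
          unfolding B_def \<Q>_def corr_def F_def M_def \<nu>_def
        proof (rule shift_correlation_ge[OF P _ ZY])
          fix p assume "p \<in> P"
          thus "0 \<le> f p \<and> 0 \<le> c p \<and> 0 \<le> w p \<and> 1 \<le> p" using base[of p] prime_ge_1_nat[of p] by (auto simp: w_def)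
        qed
        finally show ?thesis .
      qed
      have Qfacts: "finite Q" "\<And>p. p \<in> Q \<Longrightarrow> prime p" "prime_factors (\<Prod>Q) = Q" "\<Prod>Q \<ge> 1" "ln (real (\<Prod>Q)) = \<nu> Q" "(\<Prod>p\<in>Q. w p) = real (\<Prod>Q) powr - \<sigma>"
        if Q: "Q \<in> Pow P" for Q
      proof -
        show fQ: "finite Q" using Q P by (auto intro: finite_subset)
        show pQ: "\<And>p. p \<in> Q \<Longrightarrow> prime p" using Q base by auto
        show "prime_factors (\<Prod>Q) = Q" by (rule prime_factors_prod_distinct_primes[OF fQ pQ])
        have p0: "p > 0" if "p \<in> Q" for p using pQ[OF that] by (rule prime_gt_0_nat)
        have "\<Prod>Q > 0" using p0 by (intro prod_pos) auto
        thus "\<Prod>Q \<ge> 1" by simp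
        have "ln (real (\<Prod>Q)) = ln (\<Prod>p\<in>Q. real p)" by simp
        also have "\<dots> = \<nu> Q" unfolding \<nu>_def using p0 fQ by (intro ln_prod) auto
        finally show ln: "ln (real (\<Prod>Q)) = \<nu> Q" .
        have "(\<Prod>p\<in>Q. w p) = (\<Prod>p\<in>Q. exp (- \<sigma> * ln (real p)))"
          unfolding w_def using p0 by (intro prod.cong refl) (auto simp: powr_def)
        also have "\<dots> = exp (- \<sigma> * \<nu> Q)" unfolding \<nu>_def using fQ by (simp add: exp_sum[symmetric] sum_distrib_left)
        also have "\<dots> = real (\<Prod>Q) powr - \<sigma>" using \<open>\<Prod>Q > 0\<close> ln by (simp add: powr_def del: of_nat_prod)
        finally show "(\<Prod>p\<in>Q. w p) = real (\<Prod>Q) powr - \<sigma>" .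
      qed
      show ?case
      proof (intro allI impI)
        fix S assume bound: "line_bound l T (1/2 + A / ln (ln T)) S"
        hence S: "0 \<le> S" by (simp add: line_bound_def)
        define \<Q>' where "\<Q>' = \<Q> - {{}}"
        define \<psi> where "\<psi> = (\<lambda>Q::nat set. \<Prod>Q - 1)"
        \<comment> \<open>A shift by \<open>Q\<close> is multiplication with the integer \<open>\<Prod>Q\<close>, which has index \<open>\<psi> Q\<close>; unique factorization
          recovers \<open>Q\<close>.\<close>
        define E where "E = (\<lambda>n. if n \<in> \<psi> ` \<Q>' then shift_pairs P M (prime_factors (Suc n)) else {})"
        define L where "L = (\<lambda>e :: nat \<Rightarrow> int. \<Sum>p\<in>P. real_of_int (e p) * ln (real p))"
        have Q'P: "Q \<in> Pow P" if "Q \<in> \<Q>'" for Q using that by (auto simp: \<Q>'_def \<Q>_def)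
        have Suc\<psi>: "Suc (\<psi> Q) = \<Prod>Q" if "Q \<in> \<Q>'" for Q using Qfacts(4)[OF Q'P[OF that]] by (simp add: \<psi>_def)
        have inj: "inj_on \<psi> \<Q>'"
        proof (rule inj_onI)
          fix Q R assume QR: "Q \<in> \<Q>'" "R \<in> \<Q>'" "\<psi> Q = \<psi> R"
          hence "\<Prod>Q = \<Prod>R" using Suc\<psi> by metis
          thus "Q = R" using Qfacts(3)[OF Q'P] QR by metis
        qed
        have E_eq: "E (\<psi> Q) = shift_pairs P M Q" if "Q \<in> \<Q>'" for Q
          using that Qfacts(3)[OF Q'P[OF that]] Suc\<psi>[OF that] by (simp add: E_def)
        have E1: "E n \<subseteq> M \<times> M" "inj_on fst (E n)" "inj_on snd (E n)" for n
          unfolding E_def using shift_pairs_injective[OF extM] by (auto simp: shift_pairs_def)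
        have E2: "L m' = L m + ln (real (Suc n))" if mm: "(m, m') \<in> E n" for n m m'
        proof -
          obtain Q where Q: "Q \<in> \<Q>'" "n = \<psi> Q" using mm by (auto simp: E_def split: if_splits)
          hence "(m, m') \<in> shift_pairs P M Q" using mm E_eq by simp
          hence "L m' = (\<Sum>p\<in>P. (real_of_int (m p) + of_bool (p \<in> Q)) * ln (real p))"
            unfolding L_def by (intro sum.cong) (auto simp: shift_pairs_def)
          also have "\<dots> = L m + (\<Sum>p\<in>P. of_bool (p \<in> Q) * ln (real p))" by (simp add: L_def distrib_right sum.distrib)
          also have "(\<Sum>p\<in>P. of_bool (p \<in> Q) * ln (real p)) = \<nu> Q"
            unfolding \<nu>_def using P Q'P[OF Q(1)] by (intro sum.mono_neutral_cong_right) auto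
          also have "\<nu> Q = ln (real (Suc n))" using Qfacts(5)[OF Q'P[OF Q(1)]] Suc\<psi>[OF Q(1)] Q(2) by simp
          finally show ?thesis .
        qed
        have rel: "log_shift_relations M L E"
          unfolding log_shift_relations_def using E1 E2 by blast
        have \<nu>1: "1 \<le> \<nu> Q" "\<nu> Q \<le> Y" if "Q \<in> \<Q>'" for Q
        proof -
          obtain p where p: "p \<in> Q" using \<open>Q \<in> \<Q>'\<close> by (auto simp: \<Q>'_def)
          have "1 \<le> ln (real p)" using base p Q'P[OF that] by auto
          also have "\<dots> \<le> \<nu> Q" unfolding \<nu>_def
          proof (rule member_le_sum[OF p])
            fix q assume "q \<in> Q - {p}"
            hence "1 \<le> ln (real q)" using base Q'P[OF that] by auto
            thus "0 \<le> ln (real q)" by simp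
          qed (rule Qfacts(1)[OF Q'P[OF that]])
          finally show "1 \<le> \<nu> Q" .
          show "\<nu> Q \<le> Y" using that by (auto simp: \<Q>'_def \<Q>_def)
        qed
        define X where "X = nat \<lceil>T\<^sup>2\<rceil>"
        have \<psi>X: "\<psi> Q < X" if "Q \<in> \<Q>'" for Q
        proof -
          have "real (\<Prod>Q) = exp (\<nu> Q)" using Qfacts(4,5)[OF Q'P[OF that]] by (metis exp_ln of_nat_0_less_iff less_le_trans zero_less_one)
          also have "\<dots> \<le> exp (2 * ln T)" using \<nu>1[OF that] elim(5) by (simp add: Y_def)
          also have "\<dots> = T\<^sup>2" using elim(6) by (simp add: exp_double)
          finally have "real (\<Prod>Q) \<le> T\<^sup>2" .
          hence "real (Suc (\<psi> Q)) \<le> T\<^sup>2" using Suc\<psi>[OF that] by (simp only:)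
          hence "real (Suc (\<psi> Q)) \<le> real X" unfolding X_def by linarith
          thus ?thesis by linarith
        qed
        \<comment> \<open>As \<open>\<nu> Q \<ge> 1\<close> for a nonempty shift, the factor \<open>(log n)^l\<close> is at least \<open>1\<close>.\<close>
        have window: "(\<Sum>Q\<in>\<Q>'. (\<Prod>p\<in>Q. w p) * corr Q * exp (- (\<nu> Q - real j)\<^sup>2 / 2)) \<le> C * (S + 1) * \<Pi>1"
          if j: "j \<le> nat \<lfloor>Y\<rfloor>" for j
        proof -
          have jY: "real j \<le> ln T / 100" using j ZY unfolding Y_def by linarith
          define a where "a = (\<lambda>n. window_coeff l \<sigma> (real j) n * (\<Sum>(m, m')\<in>E n. F m * F m'))"
          have a0: "a n \<ge> 0" for n unfolding a_def using F0 by (intro mult_nonneg_nonneg sum_nonneg window_coeff_nonneg) auto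
          have "(\<Sum>Q\<in>\<Q>'. (\<Prod>p\<in>Q. w p) * corr Q * exp (- (\<nu> Q - real j)\<^sup>2 / 2)) \<le> (\<Sum>Q\<in>\<Q>'. a (\<psi> Q))"
          proof (rule sum_mono)
            fix Q assume Q: "Q \<in> \<Q>'"
            have "1 \<le> \<nu> Q ^ l" using \<nu>1(1)[OF Q] by (rule one_le_power)
            hence "1 * ((\<Prod>p\<in>Q. w p) * corr Q * exp (- (\<nu> Q - real j)\<^sup>2 / 2)) \<le> \<nu> Q ^ l * ((\<Prod>p\<in>Q. w p) * corr Q * exp (- (\<nu> Q - real j)\<^sup>2 / 2))"
              using corr0 by (intro mult_right_mono mult_nonneg_nonneg prod_nonneg) (auto simp: w_def)
            also have "\<dots> = a (\<psi> Q)"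
              unfolding a_def window_coeff_def E_eq[OF Q] Suc\<psi>[OF Q] Qfacts(5)[OF Q'P[OF Q]] Qfacts(6)[OF Q'P[OF Q]] corr_def by (simp add: mult_ac)
            finally show "(\<Prod>p\<in>Q. w p) * corr Q * exp (- (\<nu> Q - real j)\<^sup>2 / 2) \<le> a (\<psi> Q)" by simp
          qed
          also have "\<dots> = (\<Sum>n\<in>\<psi> ` \<Q>'. a n)" by (simp add: sum.reindex[OF inj])
          also have "\<dots> \<le> (\<Sum>n<X. a n)" using \<psi>X a0 by (intro sum_mono2) auto
          also have "\<dots> \<le> C * (S + 1) * (\<Sum>m\<in>M. (F m)\<^sup>2)"
            unfolding a_def X_def
            by (rule elim(1)[rule_format, where L = L])
               (use \<sigma> jY bound finM cardM F0 rel in \<open>auto simp: \<sigma>_def\<close>)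
          also have "\<dots> \<le> C * (S + 1) * \<Pi>1" using FF C S by (intro mult_left_mono) auto
          finally show ?thesis .
        qed
        have "(\<Sum>Q\<in>\<Q>'. (\<Prod>p\<in>Q. w p) * corr Q) \<le> (\<Sum>Q\<in>\<Q>'. \<Sum>j\<le>nat \<lfloor>Y\<rfloor>. 2 * ((\<Prod>p\<in>Q. w p) * corr Q * exp (- (\<nu> Q - real j)\<^sup>2 / 2)))"
        proof (rule sum_mono)
          fix Q assume Q: "Q \<in> \<Q>'"
          have "(\<Prod>p\<in>Q. w p) * corr Q * 1 \<le> (\<Prod>p\<in>Q. w p) * corr Q * (2 * (\<Sum>j\<le>nat \<lfloor>Y\<rfloor>. exp (- (\<nu> Q - real j)\<^sup>2 / 2)))"
            using \<nu>1[OF Q] corr0 by (intro mult_left_mono unit_windows mult_nonneg_nonneg prod_nonneg) (auto simp: w_def)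
          thus "(\<Prod>p\<in>Q. w p) * corr Q \<le> (\<Sum>j\<le>nat \<lfloor>Y\<rfloor>. 2 * ((\<Prod>p\<in>Q. w p) * corr Q * exp (- (\<nu> Q - real j)\<^sup>2 / 2)))"
            by (simp add: sum_distrib_left mult_ac)
        qed
        also have "\<dots> = (\<Sum>j\<le>nat \<lfloor>Y\<rfloor>. 2 * (\<Sum>Q\<in>\<Q>'. (\<Prod>p\<in>Q. w p) * corr Q * exp (- (\<nu> Q - real j)\<^sup>2 / 2)))"
          by (subst sum.swap) (simp add: sum_distrib_left)
        also have "\<dots> \<le> (\<Sum>j\<le>nat \<lfloor>Y\<rfloor>. 2 * (C * (S + 1) * \<Pi>1))"
          using window by (intro sum_mono mult_left_mono) auto
        also have "\<dots> = real (nat \<lfloor>Y\<rfloor> + 1) * (2 * (C * (S + 1) * \<Pi>1))" by simp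
        also have "\<dots> \<le> (2 * ln T) * (2 * (C * (S + 1) * \<Pi>1))"
        proof (rule mult_right_mono)
          have "real (nat \<lfloor>Y\<rfloor>) \<le> Y" using ZY by simp
          also have "Y \<le> ln T" using elim(5) by (simp add: Y_def)
          finally show "real (nat \<lfloor>Y\<rfloor> + 1) \<le> 2 * ln T" using elim(5) by simp
        qed (use C S \<Pi>1 in auto)
        finally have rest: "(\<Sum>Q\<in>\<Q>'. (\<Prod>p\<in>Q. w p) * corr Q) \<le> 4 * C * ln T * (S + 1) * \<Pi>1" by (simp add: mult_ac)
        have "{} \<in> \<Q>" using ZY by (simp add: \<Q>_def \<nu>_def)
        hence "(\<Sum>Q\<in>\<Q>. (\<Prod>p\<in>Q. w p) * corr Q) = corr {} + (\<Sum>Q\<in>\<Q>'. (\<Prod>p\<in>Q. w p) * corr Q)"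
          unfolding \<Q>'_def using fin\<Q> by (subst sum.remove[of _ "{}"]) auto
        moreover have "corr {} \<le> \<Pi>1"
          unfolding corr_def using shift_pairs_empty_sum_le[OF finM extM, of F] FF by linarith
        ultimately have "1/100 * (exp G * \<Pi>1) \<le> \<Pi>1 + 4 * C * ln T * (S + 1) * \<Pi>1" using lower rest by linarith
        hence "(1/100 * exp G) * \<Pi>1 \<le> (1 + 4 * C * ln T * (S + 1)) * \<Pi>1" by (simp add: algebra_simps)
        hence "1/100 * exp G \<le> 1 + 4 * C * ln T * (S + 1)" using \<Pi>1 by (simp add: mult_le_cancel_right)
        also have "\<dots> \<le> ln T * (S + 1) + 4 * C * ln T * (S + 1)"
          using mult_mono[of 1 "ln T" 1 "S + 1"] elim(5) S by simp
        finally have "exp G \<le> 100 * (1 + 4 * C) * ln T * (S + 1)" by (simp add: algebra_simps)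
        thus "exp (4/5 * exp (- A) * sqrt (ln T * ln (ln (ln T)) / ln (ln T))) \<le> 100 * (1 + 4 * C) * ln T * (S + 1)"
          by (simp only: G_def)
      qed
    qed
  qed
qed

theorem corollary2:
  fixes l :: nat and A :: real
  assumes "A > 0"
  shows "\<exists>\<epsilon> :: real \<Rightarrow> real. (\<epsilon> \<longlongrightarrow> 0) at_top \<and>
    (\<forall>\<^sub>F T in at_top.
       (SUP t\<in>{sqrt T..T}. Re ((deriv ^^ l) zeta (Complex (1 / 2 + A / ln (ln T)) t)))
         \<ge> exp ((1 / (exp A * sqrt (exp 1 - 1)) + \<epsilon> T)
                  * sqrt (ln T * ln (ln (ln T)) / ln (ln T))))"
proof -
  obtain C where C: "C > 0" and big: "\<forall>\<^sub>F T in at_top. \<forall>S. line_bound l T (1/2 + A / ln (ln T)) S \<longrightarrow>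
     exp (4/5 * exp (- A) * sqrt (ln T * ln (ln (ln T)) / ln (ln T))) \<le> C * ln T * (S + 1)"
    using large_value_bound[OF assms, of l] by blast
  define k where "k = 1 / (exp A * sqrt (exp 1 - 1))"
  define \<delta> where "\<delta> = 4/5 * exp (- A) - k"
  have \<delta>: "\<delta> > 0"
  proof -
    have "(25/16 :: real) < exp 1 - 1"
    proof -
      have "1 + 1/2 + (1/2)\<^sup>2 / 2 \<le> exp (1/2 :: real)" by (rule exp_lower_Taylor_quadratic) simp
      hence "(13/8 :: real) * (13/8) \<le> exp (1/2) * exp (1/2)" by (intro mult_mono) (auto simp: power2_eq_square)
      also have "exp (1/2) * exp (1/2) = exp (1 :: real)" by (simp add: exp_add[symmetric])
      finally show ?thesis by simp
    qed
    hence "5/4 < sqrt (exp 1 - 1)" by (intro real_less_rsqrt) (simp add: power2_eq_square)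
    hence "1 / sqrt (exp 1 - 1) < 4/5" by (simp add: field_simps)
    hence "exp (- A) * (1 / sqrt (exp 1 - 1)) < exp (- A) * (4/5)" by (intro mult_strict_left_mono) auto
    thus ?thesis by (simp add: \<delta>_def k_def exp_minus field_simps)
  qed
  have k0: "k \<ge> 0" unfolding k_def by simp
  have ev1: "\<forall>\<^sub>F T in at_top. 3 * C * ln T \<le> exp (\<delta> * sqrt (ln T * ln (ln (ln T)) / ln (ln T)))"
    using \<delta> C by real_asymp
  have ev2: "\<forall>\<^sub>F T in at_top. ln (ln (ln T)) \<ge> (0::real)" by real_asymp
  have ev2': "\<forall>\<^sub>F T in at_top. ln (ln T) \<ge> (0::real)" by real_asymp
  have ev3: "\<forall>\<^sub>F T in at_top. ln T > (0::real)" by real_asymp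
  have ev4: "\<forall>\<^sub>F T in at_top. T > (1::real)" by real_asymp
  have main: "\<forall>\<^sub>F T in at_top. exp (k * sqrt (ln T * ln (ln (ln T)) / ln (ln T))) \<le>
      (SUP t\<in>{sqrt T..T}. Re ((deriv ^^ l) zeta (Complex (1 / 2 + A / ln (ln T)) t)))"
    using big ev1 ev2 ev2' ev3 ev4
  proof eventually_elim
    case (elim T)
    define V where "V = sqrt (ln T * ln (ln (ln T)) / ln (ln T))"
    define g where "g = (\<lambda>t. Re ((deriv ^^ l) zeta (Complex (1 / 2 + A / ln (ln T)) t)))"
    define s where "s = (SUP t\<in>{sqrt T..T}. g t)"
    have V: "V \<ge> 0" unfolding V_def using elim(3-5) by (intro real_sqrt_ge_zero divide_nonneg_nonneg mult_nonneg_nonneg) auto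
    have T: "sqrt T > 1" using elim(6) by simp
    have "continuous_on {sqrt T..T} g"
      unfolding g_def
      by (intro continuous_on_Re continuous_on_compose2[OF holomorphic_on_imp_continuous_on[OF zeta_derivs_holomorphic]])
         (use T in \<open>auto intro!: continuous_intros simp: continuous_on_Complex complex_eq_iff\<close>)
    hence "bdd_above (g ` {sqrt T..T})"
      by (intro bounded_imp_bdd_above compact_imp_bounded compact_continuous_image) auto
    hence le: "g y \<le> s" if "y \<in> {sqrt T..T}" for y unfolding s_def using that by (intro cSUP_upper)
    have "exp (4/5 * exp (- A) * V) \<le> C * ln T * (max s 0 + 1)"
      using elim(1)[rule_format, of "max s 0"] le unfolding V_def g_def line_bound_def by (simp add: le_max_iff_disj)
    also have "exp (4/5 * exp (- A) * V) = exp (\<delta> * V) * exp (k * V)"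
      by (simp add: \<delta>_def exp_add[symmetric] algebra_simps)
    finally have "exp (\<delta> * V) * exp (k * V) \<le> C * ln T * (max s 0 + 1)" .
    moreover have "3 * C * ln T * exp (k * V) \<le> exp (\<delta> * V) * exp (k * V)"
      using elim(2) unfolding V_def by (intro mult_right_mono) auto
    ultimately have "3 * C * ln T * exp (k * V) \<le> C * ln T * (max s 0 + 1)" by (rule order_trans[rotated])
    hence "(C * ln T) * (3 * exp (k * V)) \<le> (C * ln T) * (max s 0 + 1)" by (simp only: mult_ac)
    hence "3 * exp (k * V) \<le> max s 0 + 1" using C elim(5) by (simp only: mult_le_cancel_left_pos[OF mult_pos_pos])
    moreover have "1 \<le> exp (k * V)" using k0 V by simp
    ultimately have "exp (k * V) \<le> max s 0" "max s 0 > 0" by linarith+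
    hence "exp (k * V) \<le> s" by (simp add: max_def split: if_splits)
    thus ?case by (simp only: V_def s_def g_def)
  qed
  show ?thesis
    by (rule exI[of _ "\<lambda>_. 0"]) (use main in \<open>simp add: k_def\<close>)
qed

end
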